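(* Fix $M\in\mathbb{N}$ and a master graph $\mathbf{\Gamma}$ on $\{1,\ldots,M\}$ with adjacency entries $\gamma_{s,t}(\mathbf{\Gamma})$. Let $n=\sum_{s=1}^Mn_s$ with layer sizes $n_s=n_s(n)\to\infty$ for all $s$, and let $\mathcal{G}_{n_1,\ldots,n_M}(\mathbf{\Gamma})$ be the associated set of multi-layer graphs with layers $\Lambda_1,\ldots,\Lambda_M$. Consider the microcanonical and canonical ensembles $P_{\mathrm{mic}},P_{\mathrm{can}}$ on $\mathcal{G}_{n_1,\ldots,n_M}(\mathbf{\Gamma})$ with constraint $$\vec{C}^*=\left\{\vec{k}^{\,*}_{s\to t}\colon\, s,t=1,\ldots,M,\ \gamma_{s,t}(\mathbf{\Gamma})=1\right\}$$ on the $t$-targeted degree sequences of the layers $s$, where $\vec{k}^{\,*}_{s\to t}=(k_i^{*\,t})_{i\in\Lambda_s}$ and $\vec{C}^*$ is realised by at least one graph in $\mathcal{G}_{n_1,\ldots,n_M}(\mathbf{\Gamma})$ (and $\vec{k}^{\,*}_{s\to t}=\vec 0$ when $\gamma_{s,t}(\mathbf{\Gamma})=0$). Put $$L^*_{s,t}=\sum_{i\in\Lambda_s}k_i^{*\,t}=\sum_{j\in\Lambda_t}k_j^{*\,s},\qquad m^*_{s\to t}=\max_{i\in\Lambda_s}k_i^{*\,t},\qquad f_{s\to t}^{(n_s)}=n_s^{-1}\sum_{i\in\Lambda_s}\delta_{k_i^{*\,t}}.$$ Suppose that the limits $A_s=\lim_{n_1,\ldots,n_M\to\infty}\frac{n_s}{n}$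 exist for all $s$, that $$m^*_{s\to t}m^*_{t\to s}=o\big({L^*_{s,t}}^{2/3}\big),\quad n_s,n_t\to\infty,\ \forall\,s\ne t,\qquad m^*_{s\to s}=o\big(n_s^{1/2}\big),\quad n_s\to\infty,\ \forall\,s,$$ and that for all $s,t$ (including $s=t$) there exist probability distributions $f_{s\to t}$ on $\mathbb{N}_0$ such that $$\lim_{n_s\to\infty}\|f_{s\to t}^{(n_s)}-f_{s\to t}\|_{\ell^1(g)}=0.$$ Then $$s_\infty=\lim_{n\to\infty}n^{-1}S_n(P_{\mathrm{mic}}\mid P_{\mathrm{can}})=\sum_{\substack{s,t=1\\ \gamma_{s,t}(\mathbf{\Gamma})=1}}^MA_s\,\|f_{s\to t}\|_{\ell^1(g)}.$$
   Context: $\mathbb{N}_0=\{0,1,2,\ldots\}$; $\delta_k$ is the point measure at $k$; $a=o(b)$ means that for every $\varepsilon>0$, eventually $|a|\le\varepsilon b$. Graphs are simple and undirected, with adjacency entries $g_{i,j}(\mathbf{G})\in\{0,1\}$. The master graph $\mathbf{\Gamma}$ is an undirected graph with node set $\{1,\ldots,M\}$ in which self-loops are allowed but multi-links are not; $\gamma_{s,t}(\mathbf{\Gamma})=\gamma_{t,s}(\mathbf{\Gamma})\in\{0,1\}$ equals $1$ iff there is a link between $s$ and $t$. The set $\mathcal{G}_{n_1,\ldots,n_M}(\mathbf{\Gamma})$ consists of all simple undirected graphs whose node set is the disjoint union of layers $\Lambda_1,\ldots,\Lambda_M$, $|\Lambda_s|=n_s$, and in which a link between a node of $\Lambda_s$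 and a node of $\Lambda_t$ ($s=t$ allowed) is permitted only if $\gamma_{s,t}(\mathbf{\Gamma})=1$. The $t$-targeted degree sequence of layer $s$ in $\mathbf{G}$ is $\vec k_{s\to t}(\mathbf{G})=(k_i^t(\mathbf{G}))_{i\in\Lambda_s}$ with $k_i^t(\mathbf{G})=\sum_{j\in\Lambda_t}g_{i,j}(\mathbf{G})$. Ensembles: given a finite set $\mathcal{G}$ of graphs, a vector-valued function $\vec C$ on $\mathcal{G}$ and a value $\vec C^*$ attained by $\vec C$ for at least one graph in $\mathcal{G}$, the microcanonical distribution is $P_{\mathrm{mic}}(\mathbf{G})=1/\Omega_{\vec C^*}$ if $\vec C(\mathbf{G})=\vec C^*$ and $0$ otherwise, where $\Omega_{\vec C^*}=|\{\mathbf{G}\in\mathcal{G}\colon\vec C(\mathbf{G})=\vec C^*\}|$. The canonical distribution $P_{\mathrm{can}}$ is the probability distribution on $\mathcal{G}$ that maximises the entropy $-\sum_{\mathbf{G}\in\mathcal{G}}P(\mathbf{G})\ln P(\mathbf{G})$ subject to $\sum_{\mathbf{G}\in\mathcal{G}}P(\mathbf{G})\,\vec C(\mathbf{G})=\vec C^*$; it has the form $P_{\mathrm{can}}(\mathbf{G})=e^{-\vec\theta^*\cdot\vec C(\mathbf{G})}/Z(\vec\theta^* )$ with $Z(\vec\theta)=\sum_{\mathbf{G}\in\mathcal{G}}e^{-\vec\theta\cdot\vec C(\mathbf{G})}$ and $\vec\theta^*$ chosen such that the average of $\vec C$ equals $\vec C^*$. The relative entropy is $S_n(P_{\mathrm{mic}}\mid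 P_{\mathrm{can}})=\sum_{\mathbf{G}\in\mathcal{G}}P_{\mathrm{mic}}(\mathbf{G})\ln\frac{P_{\mathrm{mic}}(\mathbf{G})}{P_{\mathrm{can}}(\mathbf{G})}$. The function $g\colon\mathbb{N}_0\to[0,\infty)$ is $g(k)=\log\left(\frac{k!}{k^ke^{-k}}\right)$ (so $g(0)=0$), and $\|h\|_{\ell^1(g)}=\sum_{k\in\mathbb{N}_0}|h(k)|\,g(k)$. *)

theory Defs
  imports "HOL-Probability.Probability" "HOL-Library.Landau_Symbols"
begin

section \<open>Graphs\<close>

text \<open>An undirected graph on a fixed node set is identified with its set of links, a link between
  \<open>i\<close> and \<open>j\<close> being the set \<open>{i, j}\<close>. Hence there are no multi-links, adjacency is symmetric,
  and a self-loop at \<open>i\<close> is the singleton \<open>{i}\<close>.\<close>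

definition adj :: "'v set set \<Rightarrow> 'v \<Rightarrow> 'v \<Rightarrow> nat" where
  "adj G i j = (if {i, j} \<in> G then 1 else 0)"

definition master_graph :: "nat \<Rightarrow> nat set set \<Rightarrow> bool" where
  "master_graph M \<Gamma> \<longleftrightarrow> \<Gamma> \<subseteq> {{s, t} | s t. s \<in> {1..M} \<and> t \<in> {1..M}}"

text \<open>\<open>n s\<close> is the size of layer \<open>s\<close>; tagging the nodes by their layer makes the layers disjoint.\<close>

type_synonym node = "nat \<times> nat"

definition layer :: "(nat \<Rightarrow> nat) \<Rightarrow> nat \<Rightarrow> node set" where
  "layer n s = {s} \<times> {..<n s}"

definition multilayer_graphs :: "nat \<Rightarrow> (nat \<Rightarrow> nat) \<Rightarrow> nat set set \<Rightarrow> node set set set" where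
  "multilayer_graphs M n \<Gamma> =
     Pow {{i, j} | i j s t. s \<in> {1..M} \<and> t \<in> {1..M} \<and> adj \<Gamma> s t = 1 \<and>
                            i \<in> layer n s \<and> j \<in> layer n t \<and> i \<noteq> j}"

definition tdegree :: "(nat \<Rightarrow> nat) \<Rightarrow> node set set \<Rightarrow> node \<Rightarrow> nat \<Rightarrow> nat" where
  "tdegree n G i t = (\<Sum>j\<in>layer n t. adj G i j)"


section \<open>Ensembles\<close>

text \<open>A vector-valued constraint is a function \<open>C\<close> sending a graph to its components, which are
  indexed by the set \<open>I\<close>; components outside \<open>I\<close> are not constrained.\<close>

definition microcanonical :: "'g set \<Rightarrow> 'i set \<Rightarrow> ('g \<Rightarrow> 'i \<Rightarrow> real) \<Rightarrow> ('i \<Rightarrow> real) \<Rightarrow> 'g pmf" where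
  "microcanonical \<G> I C c = pmf_of_set {G \<in> \<G>. \<forall>x\<in>I. C G x = c x}"

text \<open>Terms with \<open>pmf P G = 0\<close> contribute \<open>0\<close>, the usual convention.\<close>

definition shannon_entropy :: "'g set \<Rightarrow> 'g pmf \<Rightarrow> real" where
  "shannon_entropy \<G> P = - (\<Sum>G\<in>\<G>. pmf P G * ln (pmf P G))"

text \<open>The canonical distribution is defined as the entropy maximiser. Its exponential form
  \<open>exp (- \<theta> \<bullet> C G) / Z \<theta>\<close> is not part of the definition: a finite \<open>\<theta>\<close> need not exist when \<open>c\<close>
  lies on the boundary of the convex hull of the values of \<open>C\<close> (e.g. if some degrees are \<open>0\<close>),
  whereas the maximiser exists and is unique as soon as \<open>c\<close> is attained on the finite
  set \<open>\<G>\<close>.\<close>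

definition canonical :: "'g set \<Rightarrow> 'i set \<Rightarrow> ('g \<Rightarrow> 'i \<Rightarrow> real) \<Rightarrow> ('i \<Rightarrow> real) \<Rightarrow> 'g pmf" where
  "canonical \<G> I C c =
     arg_max_on (shannon_entropy \<G>)
       {P. set_pmf P \<subseteq> \<G> \<and> (\<forall>x\<in>I. (\<Sum>G\<in>\<G>. pmf P G * C G x) = c x)}"

text \<open>The convention \<open>ln (x / 0) = 0\<close> is harmless for \<open>P\<close> microcanonical and \<open>Q\<close> canonical: the
  entropy maximiser is positive wherever some admissible distribution, such as \<open>P\<close>, is.\<close>

definition relative_entropy :: "'g set \<Rightarrow> 'g pmf \<Rightarrow> 'g pmf \<Rightarrow> real" where
  "relative_entropy \<G> P Q = (\<Sum>G\<in>\<G>. pmf P G * ln (pmf P G / pmf Q G))"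


section \<open>Targeted degree sequences\<close>

text \<open>A family of targeted degree sequences is a function \<open>k\<close>, with \<open>k i t\<close> the prescribed number
  of neighbours in layer \<open>t\<close> of the node \<open>i\<close>.\<close>

definition constraint_index :: "nat \<Rightarrow> (nat \<Rightarrow> nat) \<Rightarrow> nat set set \<Rightarrow> (node \<times> nat) set" where
  "constraint_index M n \<Gamma> =
     {(i, t) | i t s. s \<in> {1..M} \<and> t \<in> {1..M} \<and> adj \<Gamma> s t = 1 \<and> i \<in> layer n s}"

definition degree_constraint :: "(nat \<Rightarrow> nat) \<Rightarrow> node set set \<Rightarrow> node \<times> nat \<Rightarrow> real" where
  "degree_constraint n G = (\<lambda>(i, t). real (tdegree n G i t))"

definition realised :: "nat \<Rightarrow> (nat \<Rightarrow> nat) \<Rightarrow> nat set set \<Rightarrow> (node \<Rightarrow> nat \<Rightarrow> nat) \<Rightarrow> bool" where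
  "realised M n \<Gamma> k \<longleftrightarrow>
     (\<exists>G\<in>multilayer_graphs M n \<Gamma>. \<forall>(i, t)\<in>constraint_index M n \<Gamma>. tdegree n G i t = k i t)"

definition P_mic :: "nat \<Rightarrow> (nat \<Rightarrow> nat) \<Rightarrow> nat set set \<Rightarrow> (node \<Rightarrow> nat \<Rightarrow> nat) \<Rightarrow> node set set pmf" where
  "P_mic M n \<Gamma> k =
     microcanonical (multilayer_graphs M n \<Gamma>) (constraint_index M n \<Gamma>)
       (degree_constraint n) (\<lambda>(i, t). real (k i t))"

definition P_can :: "nat \<Rightarrow> (nat \<Rightarrow> nat) \<Rightarrow> nat set set \<Rightarrow> (node \<Rightarrow> nat \<Rightarrow> nat) \<Rightarrow> node set set pmf" where
  "P_can M n \<Gamma> k =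
     canonical (multilayer_graphs M n \<Gamma>) (constraint_index M n \<Gamma>)
       (degree_constraint n) (\<lambda>(i, t). real (k i t))"

definition total_links :: "(nat \<Rightarrow> nat) \<Rightarrow> (node \<Rightarrow> nat \<Rightarrow> nat) \<Rightarrow> nat \<Rightarrow> nat \<Rightarrow> nat" where
  "total_links n k s t = (\<Sum>i\<in>layer n s. k i t)"

definition max_degree :: "(nat \<Rightarrow> nat) \<Rightarrow> (node \<Rightarrow> nat \<Rightarrow> nat) \<Rightarrow> nat \<Rightarrow> nat \<Rightarrow> nat" where
  "max_degree n k s t = Max ((\<lambda>i. k i t) ` layer n s)"

definition empirical_degree :: "(nat \<Rightarrow> nat) \<Rightarrow> (node \<Rightarrow> nat \<Rightarrow> nat) \<Rightarrow> nat \<Rightarrow> nat \<Rightarrow> nat \<Rightarrow> real" where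
  "empirical_degree n k s t x = (\<Sum>i\<in>layer n s. indicator {k i t} x) / real (n s)"


section \<open>The weighted norm\<close>

definition gfun :: "nat \<Rightarrow> real" where
  "gfun k = ln (fact k / (real k ^ k * exp (- real k)))"

text \<open>Extended-real valued, so that the series of nonnegative terms has its true value, possibly
  \<open>\<infinity>\<close>, for every \<open>h\<close>.\<close>

definition l1g_norm :: "(nat \<Rightarrow> real) \<Rightarrow> ereal" where
  "l1g_norm h = (\<Sum>k. ereal (\<bar>h k\<bar> * gfun k))"

end

theory Submission
  imports Defs
begin

text \<open>
  The relative entropy is the entropy of the canonical ensemble minus \<open>ln \<Omega>\<close>, because the entropy is
  stationary at its maximiser along the line towards the microcanonical ensemble. The canonical
  entropy is the largest value of the sum of the binary entropies of link probabilities \<open>p\<close> with the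
  prescribed mean degrees, so both terms split into contributions of the unordered pairs of layers.

  For a pair with \<open>L\<close> links and degrees \<open>k\<^sub>i\<close>, \<open>l\<^sub>j\<close>, comparison with \<open>p = k\<^sub>i l\<^sub>j / L\<close> gives
  \<open>L ln L + L - \<Sum> k\<^sub>i ln k\<^sub>i - \<Sum> l\<^sub>j ln l\<^sub>j\<close> for the entropy, while \<open>\<Omega>\<close> is close to
  \<open>L! / (\<Prod> k\<^sub>i! \<Prod> l\<^sub>j!)\<close>; the difference is the sum of \<open>gfun\<close> over all degrees, less
  \<open>gfun L = O(ln L)\<close>. The errors are of the order of the product of the two maximal degrees, which the hypotheses make
  negligible compared with \<open>n\<close>. The lower bound on \<open>\<Omega>\<close> comes from the lopsided local lemma: a random
  matching of half-links is simple with probability at least \<open>exp (- 20 a b)\<close> if the number of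
  half-links is large compared with the product \<open>a b\<close> of the maximal degrees.

  Inside one layer \<open>L\<close> may be comparable to the square of the maximal degree \<open>m\<close>. Then only the links
  touching nodes of degree at most \<open>\<theta>\<close> are counted afresh, the others being kept from a given
  realisation, where \<open>\<theta>\<close> is the largest threshold for which the nodes below it carry at least
  \<open>320 \<theta> m\<close> half-links. Maximality of \<open>\<theta>\<close> makes the entropy lost on the other nodes \<open>O(m\<^sup>2)\<close>.
\<close>

section \<open>Maximum entropy under linear constraints\<close>

text \<open>The mean number of clashes in a random matching can be of order \<open>a * b\<close>,
  which may tend to infinity, so a union bound gives nothing. A loss factor
  \<open>exp (- O(a b))\<close> is affordable, however, since its logarithm is negligible against
  \<open>n\<close>, and the local lemma yields exactly such a factor. The lopsided form is used
  because the values of a random permutation are never independent.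

  The canonical law may have no finite multipliers, so its entropy is enclosed rather than computed:
  upper bounds compare every feasible \<open>p\<close> with one reference value per link through
  \<open>ln t \<le> t - 1\<close>, and lower bounds exhibit one feasible \<open>p\<close>. The
  reference is a constant times the product of the end degrees, because its logarithm is additive
  over ends, so that its mean is the same for all feasible \<open>p\<close>. Between two layers this
  reference is itself feasible. Inside one layer the missing diagonal spoils the degree sums, and an
  explicit correction repairs them.\<close>

definition xlnx :: "real \<Rightarrow> real" where "xlnx x = x * ln x"

text \<open>The convention \<open>ln 0 = 0\<close> gives \<open>xlnx 0 = 0\<close>, which is the
  continuous extension. Entropy is therefore continuous up to the boundary of the simplex, and a
  compactness argument applies there.\<close>

lemma continuous_on_xlnx: "continuous_on {0..} xlnx"
  unfolding continuous_on_def
proof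
  fix x :: real assume x: "x \<in> {0..}"
  show "(xlnx \<longlongrightarrow> xlnx x) (at x within {0..})"
  proof (cases "x = 0")
    case False
    then have "isCont (\<lambda>x. x * ln x) x" using x by (intro continuous_intros) auto
    then show ?thesis
      unfolding xlnx_def[abs_def] isCont_def by (rule tendsto_within_subset) auto
  next
    case True
    \<comment> \<open>\<open>- ln y\<close> equals \<open>2 * ln (1 / sqrt y)\<close>, which
      \<open>ln t \<le> t - 1\<close> bounds by \<open>2 / sqrt y\<close>.\<close>
    have b: "\<bar>xlnx y\<bar> \<le> 2 * sqrt y" if "0 \<le> y" "y < 1" for y :: real
    proof (cases "y = 0")
      case False
      then have y: "y > 0" using that by auto
      have "ln (1 / sqrt y) \<le> 1 / sqrt y - 1" using y by (intro ln_le_minus_one) auto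
      then have "- ln y \<le> 2 / sqrt y" using y by (simp add: ln_div ln_sqrt)
      then have "y * (- ln y) \<le> y * (2 / sqrt y)" using y by (intro mult_left_mono) auto
      also have "\<dots> = 2 * sqrt y" using y by (simp add: field_simps)
      finally show ?thesis using y that
        by (auto simp: xlnx_def abs_if mult_less_0_iff zero_less_mult_iff)
    qed (simp add: xlnx_def)
    have "((\<lambda>y. 2 * sqrt y) \<longlongrightarrow> 2 * sqrt 0) (at (0::real) within {0..})"
      by (intro tendsto_intros)
    then have lim: "((\<lambda>y. 2 * sqrt y) \<longlongrightarrow> 0) (at (0::real) within {0..})" by simp
    have ev: "eventually (\<lambda>y. norm (xlnx y) \<le> 2 * sqrt y) (at (0::real) within {0..})"
      unfolding eventually_at by (rule exI[of _ 1]) (auto intro!: b simp: dist_real_def)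
    have "(xlnx \<longlongrightarrow> 0) (at (0::real) within {0..})"
      by (rule Lim_null_comparison[OF ev lim])
    then show ?thesis using True by (simp add: xlnx_def)
  qed
qed

lemma pmf_with_weights:
  fixes w :: "'a \<Rightarrow> real"
  assumes "finite S" "\<And>x. 0 \<le> w x" "\<And>x. x \<notin> S \<Longrightarrow> w x = 0" "sum w S = 1"
  obtains P where "\<And>x. pmf P x = w x"
proof -
  have "(\<integral>\<^sup>+x. ennreal (w x) \<partial>count_space UNIV) = (\<integral>\<^sup>+x. ennreal (w x) * indicator S x \<partial>count_space UNIV)"
    by (intro nn_integral_cong) (use assms(3) in \<open>auto simp: indicator_def\<close>)
  also have "\<dots> = (\<integral>\<^sup>+x. ennreal (w x) \<partial>count_space S)"
    by (simp add: nn_integral_count_space_indicator)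
  also have "\<dots> = (\<Sum>x\<in>S. ennreal (w x))"
    by (rule nn_integral_count_space_finite[OF assms(1)])
  also have "\<dots> = ennreal (sum w S)" by (simp add: assms(2))
  finally have "pmf (embed_pmf w) x = w x" for x
    using assms by (intro pmf_embed_pmf) auto
  then show ?thesis by (rule that)
qed

text \<open>Nonnegativity of relative entropy. Positivity of \<open>q\<close> wherever
  \<open>p\<close> is positive has to be assumed, because \<open>ln 0 = 0\<close> would hide an
  infinite term.\<close>

lemma gibbs_inequality:
  fixes p q :: "'a \<Rightarrow> real"
  assumes "finite S" "\<And>x. x \<in> S \<Longrightarrow> 0 \<le> p x" "\<And>x. x \<in> S \<Longrightarrow> 0 \<le> q x"
    "\<And>x. x \<in> S \<Longrightarrow> 0 < p x \<Longrightarrow> 0 < q x" "sum q S \<le> sum p S"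
  shows "(\<Sum>x\<in>S. p x * ln (q x)) \<le> (\<Sum>x\<in>S. xlnx (p x))"
proof -
  have "p x * ln (q x) - xlnx (p x) \<le> q x - p x" if x: "x \<in> S" for x
  proof (cases "p x = 0")
    case False
    then have p: "p x > 0" "q x > 0" using assms(2,4)[OF x] by auto
    have "p x * ln (q x) - xlnx (p x) = p x * ln (q x / p x)"
      using p by (simp add: xlnx_def ln_div algebra_simps)
    also have "\<dots> \<le> p x * (q x / p x - 1)"
      using p by (intro mult_left_mono ln_le_minus_one) auto
    also have "\<dots> = q x - p x" using p by (simp add: field_simps)
    finally show ?thesis .
  qed (use assms(3)[OF x] in \<open>simp add: xlnx_def\<close>)
  then have "(\<Sum>x\<in>S. p x * ln (q x) - xlnx (p x)) \<le> (\<Sum>x\<in>S. q x - p x)" by (rule sum_mono)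
  then show ?thesis using assms(5) by (simp add: sum_subtractf)
qed

section \<open>Existence and first-order conditions of the entropy maximiser\<close>

definition feasible_pmfs :: "'g set \<Rightarrow> 'i set \<Rightarrow> ('g \<Rightarrow> 'i \<Rightarrow> real) \<Rightarrow> ('i \<Rightarrow> real) \<Rightarrow> 'g pmf set" where
  "feasible_pmfs \<G> I C c = {P. set_pmf P \<subseteq> \<G> \<and> (\<forall>x\<in>I. (\<Sum>G\<in>\<G>. pmf P G * C G x) = c x)}"

lemma shannon_entropy_xlnx: "shannon_entropy \<G> P = - (\<Sum>G\<in>\<G>. xlnx (pmf P G))"
  by (simp add: shannon_entropy_def xlnx_def)

lemma pmf_zero_outside: "set_pmf P \<subseteq> \<G> \<Longrightarrow> G \<notin> \<G> \<Longrightarrow> pmf P G = 0"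
  by (auto simp: set_pmf_iff)

lemma exists_entropy_maximiser:
  fixes C :: "'g \<Rightarrow> 'i \<Rightarrow> real"
  assumes fin: "finite \<G>" and ne: "feasible_pmfs \<G> I C c \<noteq> {}"
  shows "\<exists>P. is_arg_max (shannon_entropy \<G>) (\<lambda>P. P \<in> feasible_pmfs \<G> I C c) P"
proof -
  \<comment> \<open>The weights live on the whole type \<open>'g\<close>, which may be infinite.
    Coordinates outside \<G> are pinned to 0, and compactness is that of a closed part of a product
    of unit intervals.\<close>
  define K :: "('g \<Rightarrow> real) set" where "K = (\<Pi>\<^sub>E x\<in>UNIV. {0..1}) \<inter>
     ((\<Inter>x\<in>-\<G>. {w. w x = 0}) \<inter> {w. sum w \<G> = 1} \<inter> (\<Inter>x\<in>I. {w. (\<Sum>G\<in>\<G>. w G * C G x) = c x}))"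
  have "compact (\<Pi>\<^sub>E x\<in>(UNIV::'g set). {0..1::real})"
    using compactin_PiE[of "\<lambda>_::'g. euclidean :: real topology" UNIV "\<lambda>_. {0..1}"]
    by (simp add: euclidean_product_topology)
  then have "compact K" unfolding K_def
    by (intro compact_Int_closed closed_Int closed_INT ballI closed_Collect_eq continuous_intros
        continuous_on_product_coordinates)
  have inK: "pmf P \<in> K" if "P \<in> feasible_pmfs \<G> I C c" for P
    using that fin unfolding K_def feasible_pmfs_def
    by (auto simp: pmf_le_1 sum_pmf_eq_1 pmf_zero_outside)
  have ofK: "\<exists>P. P \<in> feasible_pmfs \<G> I C c \<and> pmf P = w" if "w \<in> K" for w
  proof -
    obtain P where P: "\<And>x. pmf P x = w x"
      using pmf_with_weights[of \<G> w] \<open>w \<in> K\<close> fin by (auto simp: K_def PiE_iff)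
    then have eq: "pmf P = w" by auto
    have "set_pmf P \<subseteq> \<G>" using that P by (auto simp: set_pmf_iff K_def)
    then have "P \<in> feasible_pmfs \<G> I C c" using that P by (auto simp: feasible_pmfs_def K_def)
    with eq show ?thesis by blast
  qed
  have cont: "continuous_on K (\<lambda>w. - (\<Sum>G\<in>\<G>. xlnx (w G)))"
    by (intro continuous_intros continuous_on_compose2[OF continuous_on_xlnx]
        continuous_on_subset[OF continuous_on_product_coordinates]) (auto simp: K_def PiE_iff)
  have "K \<noteq> {}" using ne inK by blast
  from continuous_attains_sup[OF \<open>compact K\<close> this cont]
  obtain w where w: "w \<in> K" "\<And>v. v \<in> K \<Longrightarrow> - (\<Sum>G\<in>\<G>. xlnx (v G)) \<le> - (\<Sum>G\<in>\<G>. xlnx (w G))" by blast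
  obtain P where P: "P \<in> feasible_pmfs \<G> I C c" "pmf P = w" using ofK[OF w(1)] by blast
  have "shannon_entropy \<G> Q \<le> shannon_entropy \<G> P" if "Q \<in> feasible_pmfs \<G> I C c" for Q
    using w(2)[OF inK[OF that]] P(2) by (simp add: shannon_entropy_xlnx)
  then show ?thesis using P(1) by (auto simp: is_arg_max_def not_less)
qed

text \<open>\<open>canonical\<close> is a Hilbert choice, so it has its defining property only once
  a maximiser is known to exist.\<close>

lemma canonical_arg_max:
  assumes "finite \<G>" "feasible_pmfs \<G> I C c \<noteq> {}"
  shows "canonical \<G> I C c \<in> feasible_pmfs \<G> I C c"
    "\<And>Q. Q \<in> feasible_pmfs \<G> I C c \<Longrightarrow> shannon_entropy \<G> Q \<le> shannon_entropy \<G> (canonical \<G> I C c)"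
proof -
  have "is_arg_max (shannon_entropy \<G>) (\<lambda>P. P \<in> feasible_pmfs \<G> I C c) (canonical \<G> I C c)"
    using someI_ex[OF exists_entropy_maximiser[OF assms]]
    unfolding canonical_def arg_max_on_def arg_max_def feasible_pmfs_def by simp
  then show "canonical \<G> I C c \<in> feasible_pmfs \<G> I C c"
    "\<And>Q. Q \<in> feasible_pmfs \<G> I C c \<Longrightarrow> shannon_entropy \<G> Q \<le> shannon_entropy \<G> (canonical \<G> I C c)"
    by (auto simp: is_arg_max_def not_less)
qed

text \<open>Nonnegativity of the weights is the only restriction on \<open>e\<close>; negative
  values give points beyond \<open>P\<close>, on the side away from \<open>Q\<close>.\<close>

lemma feasible_pmfs_line:
  assumes fin: "finite \<G>" and P: "P \<in> feasible_pmfs \<G> I C c" and Q: "Q \<in> feasible_pmfs \<G> I C c"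
    and nn: "\<And>G. G \<in> \<G> \<Longrightarrow> 0 \<le> pmf P G + e * (pmf Q G - pmf P G)"
  obtains R where "R \<in> feasible_pmfs \<G> I C c" "\<And>G. pmf R G = pmf P G + e * (pmf Q G - pmf P G)"
proof -
  have out: "pmf P G = 0 \<and> pmf Q G = 0" if "G \<notin> \<G>" for G
    using P Q that by (auto simp: feasible_pmfs_def pmf_zero_outside)
  obtain R where R: "\<And>G. pmf R G = pmf P G + e * (pmf Q G - pmf P G)"
  proof (rule pmf_with_weights[of \<G> "\<lambda>G. pmf P G + e * (pmf Q G - pmf P G)"])
    show "0 \<le> pmf P G + e * (pmf Q G - pmf P G)" for G
      using nn[of G] out[of G] by (cases "G \<in> \<G>") auto
    show "(\<Sum>G\<in>\<G>. pmf P G + e * (pmf Q G - pmf P G)) = 1"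
      using P Q fin by (simp add: sum.distrib sum_distrib_left[symmetric] sum_subtractf
          feasible_pmfs_def sum_pmf_eq_1)
  qed (use fin out in auto)
  have "set_pmf R \<subseteq> \<G>"
  proof
    fix G assume "G \<in> set_pmf R"
    then show "G \<in> \<G>" using out[of G] R[of G] by (cases "G \<in> \<G>") (auto simp: set_pmf_iff)
  qed
  moreover have "(\<Sum>G\<in>\<G>. pmf R G * C G x) = c x" if "x \<in> I" for x
  proof -
    have "(\<Sum>G\<in>\<G>. pmf R G * C G x) = (\<Sum>G\<in>\<G>. pmf P G * C G x + e * (pmf Q G * C G x - pmf P G * C G x))"
      by (simp add: R algebra_simps)
    also have "\<dots> = c x + e * (c x - c x)"
      using P Q that by (simp add: sum.distrib sum_distrib_left[symmetric] sum_subtractf feasible_pmfs_def)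
    finally show ?thesis by simp
  qed
  ultimately have "R \<in> feasible_pmfs \<G> I C c" by (auto simp: feasible_pmfs_def)
  then show ?thesis using R by (rule that)
qed

text \<open>Moving a fraction \<open>e\<close> of the way towards \<open>Q\<close> puts mass of
  order \<open>e\<close> on a point that had none, which gains entropy of order
  \<open>e * ln (1 / e)\<close>, while everything else loses only \<open>O(e)\<close>. So a
  maximiser cannot vanish at such a point.\<close>

lemma entropy_maximiser_support:
  assumes fin: "finite \<G>" and P: "P \<in> feasible_pmfs \<G> I C c" and Q: "Q \<in> feasible_pmfs \<G> I C c"
    and max: "\<And>R. R \<in> feasible_pmfs \<G> I C c \<Longrightarrow> shannon_entropy \<G> R \<le> shannon_entropy \<G> P"
  shows "set_pmf Q \<subseteq> set_pmf P"
proof (rule ccontr)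
  assume "\<not> ?thesis"
  then obtain G0 where G0: "pmf Q G0 > 0" "pmf P G0 = 0"
    by (auto simp: set_pmf_iff) (metis less_eq_real_def pmf_nonneg)
  have G0in: "G0 \<in> \<G>" using Q G0 by (auto simp: feasible_pmfs_def set_pmf_iff)
  let ?H = "shannon_entropy \<G> P"
  \<comment> \<open>The right-hand side is independent of \<open>e\<close>, whereas the left-hand
    side diverges as \<open>e\<close> tends to 0.\<close>
  have key: "pmf Q G0 * (- ln (e * pmf Q G0)) \<le> ?H" if e: "0 < e" "e < 1" for e
  proof -
    have nn: "0 \<le> pmf P G + e * (pmf Q G - pmf P G)" for G
    proof -
      have "pmf P G + e * (pmf Q G - pmf P G) = (1 - e) * pmf P G + e * pmf Q G" by (simp add: algebra_simps)
      also have "\<dots> \<ge> 0" using e by (intro add_nonneg_nonneg mult_nonneg_nonneg) auto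
      finally show ?thesis .
    qed
    obtain R where R: "R \<in> feasible_pmfs \<G> I C c" "\<And>G. pmf R G = pmf P G + e * (pmf Q G - pmf P G)"
      using feasible_pmfs_line[OF fin P Q, of e] nn by metis
    have R': "pmf R G = (1 - e) * pmf P G + e * pmf Q G" for G using R(2) by (simp add: algebra_simps)
    have g: "(\<Sum>G\<in>\<G>. pmf P G * ln (pmf R G)) \<le> (\<Sum>G\<in>\<G>. xlnx (pmf P G))"
    proof (rule gibbs_inequality[OF fin])
      show "0 < pmf R G" if "0 < pmf P G" for G
        using that e unfolding R' by (intro add_pos_nonneg) auto
      show "sum (pmf R) \<G> \<le> sum (pmf P) \<G>"
        using P R(1) fin by (simp add: feasible_pmfs_def sum_pmf_eq_1)
    qed auto
    have "(\<Sum>G\<in>\<G>. xlnx (pmf R G)) = (1 - e) * (\<Sum>G\<in>\<G>. pmf P G * ln (pmf R G)) + e * (\<Sum>G\<in>\<G>. pmf Q G * ln (pmf R G))"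
      unfolding sum_distrib_left sum.distrib[symmetric]
      by (rule sum.cong) (auto simp: xlnx_def R' algebra_simps)
    moreover have "(1 - e) * (\<Sum>G\<in>\<G>. pmf P G * ln (pmf R G)) \<le> (1 - e) * (- ?H)"
      using g e by (intro mult_left_mono) (auto simp: shannon_entropy_xlnx)
    ultimately have "- shannon_entropy \<G> R \<le> (1 - e) * (- ?H) + e * (\<Sum>G\<in>\<G>. pmf Q G * ln (pmf R G))"
      by (simp add: shannon_entropy_xlnx)
    with max[OF R(1)] have "- ?H \<le> (1 - e) * (- ?H) + e * (\<Sum>G\<in>\<G>. pmf Q G * ln (pmf R G))" by linarith
    then have "0 \<le> e * (?H + (\<Sum>G\<in>\<G>. pmf Q G * ln (pmf R G)))" by (simp add: algebra_simps)
    then have 1: "- (\<Sum>G\<in>\<G>. pmf Q G * ln (pmf R G)) \<le> ?H" using e by (simp add: zero_le_mult_iff)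
    have nonpos: "ln (pmf R G) \<le> 0" for G
      using pmf_le_1[of R G] pmf_nonneg[of R G] by (cases "pmf R G = 0") auto
    have "pmf Q G0 * (- ln (pmf R G0)) \<le> (\<Sum>G\<in>\<G>. pmf Q G * (- ln (pmf R G)))"
      using fin G0in nonpos by (intro member_le_sum mult_nonneg_nonneg) auto
    with 1 G0(2) show ?thesis by (simp add: R' sum_negf)
  qed
  \<comment> \<open>Small enough for the left-hand side of \<open>key\<close> to reach
    \<open>?H + 1\<close>.\<close>
  define e where "e = min (1/2) (exp (- (?H + 1) / pmf Q G0) / pmf Q G0)"
  have e: "0 < e" "e < 1" using G0 by (auto simp: e_def)
  have "e * pmf Q G0 \<le> exp (- (?H + 1) / pmf Q G0) / pmf Q G0 * pmf Q G0"
    unfolding e_def by (intro mult_right_mono) auto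
  then have le: "e * pmf Q G0 \<le> exp (- (?H + 1) / pmf Q G0)" using G0 by simp
  have "ln (e * pmf Q G0) \<le> - (?H + 1) / pmf Q G0"
    using le e G0 by (subst (asm) ln_le_cancel_iff[symmetric]) auto
  then have "(?H + 1) \<le> pmf Q G0 * (- ln (e * pmf Q G0))" using G0 by (simp add: field_simps)
  with key[OF e] show False by linarith
qed

text \<open>The entropy is stationary at its maximiser along the line towards any feasible \<open>Q\<close>, because the
  line can be prolonged a little beyond the maximiser.\<close>

lemma entropy_maximiser_cross_entropy:
  assumes fin: "finite \<G>" and P: "P \<in> feasible_pmfs \<G> I C c" and Q: "Q \<in> feasible_pmfs \<G> I C c"
    and max: "\<And>R. R \<in> feasible_pmfs \<G> I C c \<Longrightarrow> shannon_entropy \<G> R \<le> shannon_entropy \<G> P"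
  shows "- (\<Sum>G\<in>\<G>. pmf Q G * ln (pmf P G)) = shannon_entropy \<G> P"
proof -
  define S where "S = set_pmf P"
  have supp: "set_pmf Q \<subseteq> S" unfolding S_def by (rule entropy_maximiser_support[OF fin P Q max])
  have SG: "S \<subseteq> \<G>" using P by (auto simp: S_def feasible_pmfs_def)
  have finS: "finite S" using fin SG finite_subset by blast
  have Ppos: "pmf P G > 0" if "G \<in> S" for G using that by (auto simp: S_def pmf_positive)
  have zero: "pmf P G = 0 \<and> pmf Q G = 0" if "G \<notin> S" for G
    using that supp by (auto simp: S_def set_pmf_iff)
  \<comment> \<open>Two masses differ by at most 1, so for step lengths below the smallest positive
    mass of \<open>P\<close> the line keeps nonnegative weights on both sides of
    \<open>P\<close>.\<close>
  define d where "d = (if S = {} then 1 else Min ((\<lambda>G. pmf P G) ` S))"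
  have d: "d > 0" "\<And>G. G \<in> S \<Longrightarrow> d \<le> pmf P G"
    using finS Ppos by (auto simp: d_def)
  let ?f = "\<lambda>e. - (\<Sum>G\<in>S. (pmf P G + e * (pmf Q G - pmf P G)) * ln (pmf P G + e * (pmf Q G - pmf P G)))"
  have D: "(?f has_real_derivative - (\<Sum>G\<in>S. (pmf Q G - pmf P G) * (ln (pmf P G) + 1))) (at 0)"
  proof (intro DERIV_minus DERIV_sum)
    fix G assume "G \<in> S"
    then have "pmf P G > 0" by (rule Ppos)
    then show "((\<lambda>e. (pmf P G + e * (pmf Q G - pmf P G)) * ln (pmf P G + e * (pmf Q G - pmf P G)))
       has_real_derivative (pmf Q G - pmf P G) * (ln (pmf P G) + 1)) (at 0)"
      by (auto intro!: derivative_eq_intros simp: algebra_simps)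
  qed
  have "?f y \<le> ?f 0" if "\<bar>0 - y\<bar> < d" for y
  proof -
    have nn: "0 \<le> pmf P G + y * (pmf Q G - pmf P G)" if "G \<in> \<G>" for G
    proof (cases "G \<in> S")
      case True
      have "\<bar>y * (pmf Q G - pmf P G)\<bar> \<le> d * 1" unfolding abs_mult
        using \<open>\<bar>0 - y\<bar> < d\<close> pmf_le_1[of P G] pmf_le_1[of Q G] pmf_nonneg[of P G] pmf_nonneg[of Q G]
        by (intro mult_mono) (auto simp del: pmf_nonneg)
      with d(2)[OF True] show ?thesis by linarith
    qed (use zero in auto)
    obtain R where R: "R \<in> feasible_pmfs \<G> I C c" "\<And>G. pmf R G = pmf P G + y * (pmf Q G - pmf P G)"
      using feasible_pmfs_line[OF fin P Q nn] by blast
    have "shannon_entropy \<G> R = ?f y"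
      unfolding shannon_entropy_def neg_equal_iff_equal
      by (rule sum.mono_neutral_cong_right) (use fin SG R zero in auto)
    moreover have "shannon_entropy \<G> P = ?f 0"
      unfolding shannon_entropy_def neg_equal_iff_equal
      by (rule sum.mono_neutral_cong_right) (use fin SG zero in auto)
    ultimately show ?thesis using max[OF R(1)] by simp
  qed
  \<comment> \<open>Stationarity. The \<open>+ 1\<close> coming from the derivative of
    \<open>x * ln x\<close> contributes nothing, because \<open>P\<close> and \<open>Q\<close> both
    have total mass 1 on \<open>S\<close>.\<close>
  then have "- (\<Sum>G\<in>S. (pmf Q G - pmf P G) * (ln (pmf P G) + 1)) = 0"
    using DERIV_local_max[OF D d(1)] by blast
  moreover have "(\<Sum>G\<in>S. (pmf Q G - pmf P G) * (ln (pmf P G) + 1)) =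
      (\<Sum>G\<in>S. pmf Q G * ln (pmf P G)) - (\<Sum>G\<in>S. pmf P G * ln (pmf P G)) + (sum (pmf Q) S - sum (pmf P) S)"
    by (simp add: sum.distrib sum_subtractf algebra_simps)
  moreover have "sum (pmf Q) S = 1" "sum (pmf P) S = 1"
    using finS supp by (auto simp: sum_pmf_eq_1 S_def)
  moreover have "(\<Sum>G\<in>S. pmf Q G * ln (pmf P G)) = (\<Sum>G\<in>\<G>. pmf Q G * ln (pmf P G))"
      "(\<Sum>G\<in>S. pmf P G * ln (pmf P G)) = (\<Sum>G\<in>\<G>. pmf P G * ln (pmf P G))"
    by (rule sum.mono_neutral_left; use fin SG zero in auto)+
  ultimately show ?thesis by (simp add: shannon_entropy_def)
qed

section \<open>Relative entropy of the two ensembles\<close>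

lemma relative_entropy_microcanonical_canonical:
  fixes C :: "'g \<Rightarrow> 'i \<Rightarrow> real"
  defines "S \<equiv> \<lambda>\<G> I C c. {G \<in> \<G>. \<forall>x\<in>I. C G x = c x}"
  assumes fin: "finite \<G>" and ne: "S \<G> I C c \<noteq> {}"
  shows "microcanonical \<G> I C c \<in> feasible_pmfs \<G> I C c"
    and "relative_entropy \<G> (microcanonical \<G> I C c) (canonical \<G> I C c) =
           shannon_entropy \<G> (canonical \<G> I C c) - ln (real (card (S \<G> I C c)))"
proof -
  let ?S = "S \<G> I C c" and ?Q = "microcanonical \<G> I C c" and ?P = "canonical \<G> I C c"
  have finS: "finite ?S" using fin by (auto simp: S_def)
  have Q: "pmf ?Q G = indicator ?S G / card ?S" for G
    unfolding microcanonical_def using finS ne by (simp add: S_def)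
  have setQ: "set_pmf ?Q = ?S"
    unfolding microcanonical_def using finS ne by (simp add: S_def)
  have cS: "real (card ?S) > 0" using finS ne by (simp add: card_gt_0_iff)
  have "(\<Sum>G\<in>\<G>. pmf ?Q G * C G x) = c x" if "x \<in> I" for x
  proof -
    have "(\<Sum>G\<in>\<G>. pmf ?Q G * C G x) = (\<Sum>G\<in>?S. c x / card ?S)"
      by (rule sum.mono_neutral_cong_right) (use fin that in \<open>auto simp: Q S_def indicator_def\<close>)
    then show ?thesis using cS by simp
  qed
  then show mem: "?Q \<in> feasible_pmfs \<G> I C c"
    using setQ by (auto simp: feasible_pmfs_def S_def)
  then have ne': "feasible_pmfs \<G> I C c \<noteq> {}" by blast
  note P = canonical_arg_max[OF fin ne']
  have supp: "set_pmf ?Q \<subseteq> set_pmf ?P" by (rule entropy_maximiser_support[OF fin P(1) mem P(2)])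
  have Ppos: "pmf ?P G > 0" if "G \<in> ?S" for G
    using that supp setQ by (auto intro: pmf_positive)
  have "relative_entropy \<G> ?Q ?P = (\<Sum>G\<in>\<G>. pmf ?Q G * - ln (card ?S) - pmf ?Q G * ln (pmf ?P G))"
    unfolding relative_entropy_def
  proof (rule sum.cong[OF refl])
    fix G assume "G \<in> \<G>"
    show "pmf ?Q G * ln (pmf ?Q G / pmf ?P G) = pmf ?Q G * - ln (card ?S) - pmf ?Q G * ln (pmf ?P G)"
    proof (cases "G \<in> ?S")
      case True
      then show ?thesis using Ppos[OF True] cS by (simp add: Q ln_div ln_mult divide_simps algebra_simps)
    qed (simp add: Q)
  qed
  also have "\<dots> = - ln (card ?S) * sum (pmf ?Q) \<G> - (\<Sum>G\<in>\<G>. pmf ?Q G * ln (pmf ?P G))"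
    unfolding sum_subtractf by (simp add: sum_distrib_right[symmetric] mult.commute sum_negf)
  also have "sum (pmf ?Q) \<G> = 1" using fin setQ by (auto simp: sum_pmf_eq_1 S_def)
  finally show "relative_entropy \<G> ?Q ?P = shannon_entropy \<G> ?P - ln (real (card ?S))"
    using entropy_maximiser_cross_entropy[OF fin P(1) mem P(2)] by simp
qed

section \<open>Bernoulli products on the subsets of a finite set\<close>

definition bernoulli_entropy :: "real \<Rightarrow> real" where
  "bernoulli_entropy p = - xlnx p - xlnx (1 - p)"

abbreviation total_entropy :: "'a set \<Rightarrow> ('a \<Rightarrow> real) \<Rightarrow> real" where
  "total_entropy E p \<equiv> (\<Sum>g\<in>E. bernoulli_entropy (p g))"

definition bernoulli_weight :: "'a set \<Rightarrow> ('a \<Rightarrow> real) \<Rightarrow> 'a set \<Rightarrow> real" where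
  "bernoulli_weight E p G = (\<Prod>g\<in>G. p g) * (\<Prod>g\<in>E - G. 1 - p g)"

definition marginal :: "'a set \<Rightarrow> 'a set pmf \<Rightarrow> 'a \<Rightarrow> real" where
  "marginal E Q g = (\<Sum>G\<in>Pow E. pmf Q G * of_bool (g \<in> G))"

lemma sum_bernoulli_weight:
  assumes "finite E"
  shows "(\<Sum>G\<in>Pow E. bernoulli_weight E p G) = 1"
proof -
  have "(\<Prod>g\<in>E. p g + (1 - p g)) = (\<Sum>G\<in>Pow E. (\<Prod>g\<in>G. p g) * (\<Prod>g\<in>E - G. 1 - p g))"
    by (rule prod_add[OF assms])
  then show ?thesis by (simp add: bernoulli_weight_def)
qed

lemma marginal_bernoulli_weight:
  assumes "finite E" "g \<in> E"
  shows "(\<Sum>G\<in>Pow E. bernoulli_weight E p G * of_bool (g \<in> G)) = p g"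
proof -
  \<comment> \<open>Replacing the factor \<open>1 - p g\<close> by 0 at the single element
    \<open>g\<close> removes from the expansion all subsets that miss \<open>g\<close>.\<close>
  let ?q = "\<lambda>x. if x = g then 0 else 1 - p x"
  have "(\<Prod>x\<in>E. p x + ?q x) = (\<Sum>G\<in>Pow E. (\<Prod>x\<in>G. p x) * (\<Prod>x\<in>E - G. ?q x))"
    by (rule prod_add[OF assms(1)])
  moreover have "(\<Prod>x\<in>G. p x) * (\<Prod>x\<in>E - G. ?q x) = bernoulli_weight E p G * of_bool (g \<in> G)"
    if "G \<in> Pow E" for G
  proof (cases "g \<in> G")
    case True
    then have "(\<Prod>x\<in>E - G. ?q x) = (\<Prod>x\<in>E - G. 1 - p x)" by (intro prod.cong) auto
    then show ?thesis using True by (simp add: bernoulli_weight_def)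
  next
    case False
    then have "(\<Prod>x\<in>E - G. ?q x) = 0" using assms by (intro prod_zero) auto
    then show ?thesis using False by simp
  qed
  moreover have "(\<Prod>x\<in>E. p x + ?q x) = p g"
  proof -
    have "(\<Prod>x\<in>E. p x + ?q x) = (\<Prod>x\<in>E. if x = g then p g else 1)" by (rule prod.cong) auto
    also have "\<dots> = p g" using assms by (simp add: prod.delta)
    finally show ?thesis .
  qed
  ultimately show ?thesis by (metis (no_types, lifting) sum.cong)
qed

lemma marginal_bounds:
  assumes "finite E" "set_pmf Q \<subseteq> Pow E"
  shows "0 \<le> marginal E Q g" "marginal E Q g \<le> 1"
    "\<And>G. G \<in> set_pmf Q \<Longrightarrow> g \<in> G \<Longrightarrow> 0 < marginal E Q g"
    "\<And>G. G \<in> set_pmf Q \<Longrightarrow> g \<notin> G \<Longrightarrow> marginal E Q g < 1"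
proof -
  have one: "(\<Sum>G\<in>Pow E. pmf Q G) = 1" using assms by (simp add: sum_pmf_eq_1)
  show "0 \<le> marginal E Q g" unfolding marginal_def by (intro sum_nonneg) auto
  have "marginal E Q g \<le> (\<Sum>G\<in>Pow E. pmf Q G)" unfolding marginal_def by (intro sum_mono) auto
  then show "marginal E Q g \<le> 1" using one by simp
  fix G assume G: "G \<in> set_pmf Q"
  then have GE: "G \<in> Pow E" and pos: "pmf Q G > 0" using assms by (auto intro: pmf_positive)
  show "0 < marginal E Q g" if "g \<in> G"
    unfolding marginal_def by (rule sum_pos2[OF _ GE]) (use assms pos that in auto)
  show "marginal E Q g < 1" if "g \<notin> G"
    unfolding marginal_def one[symmetric]
    by (rule sum_strict_mono_ex1) (use assms GE pos that in \<open>auto intro!: bexI[OF _ GE]\<close>)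
qed

text \<open>The logarithm of a product weight is a sum over elements, so its mean under
  \<open>Q\<close> sees \<open>Q\<close> only through its marginals. The sign claims are those that
  \<open>gibbs_inequality\<close> asks for.\<close>

lemma cross_entropy_bernoulli:
  assumes fin: "finite E" and Q: "set_pmf Q \<subseteq> Pow E"
    and p: "\<And>g. g \<in> E \<Longrightarrow> p g = marginal E Q g"
  shows "(\<Sum>G\<in>Pow E. pmf Q G * ln (bernoulli_weight E p G)) = - total_entropy E p"
    and "\<And>G. G \<in> set_pmf Q \<Longrightarrow> 0 < bernoulli_weight E p G"
    and "\<And>G. G \<in> Pow E \<Longrightarrow> 0 \<le> bernoulli_weight E p G"
proof -
  show nn: "0 \<le> bernoulli_weight E p G" if "G \<in> Pow E" for G
    unfolding bernoulli_weight_def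
    using marginal_bounds(1,2)[OF fin Q] that by (intro mult_nonneg_nonneg prod_nonneg) (auto simp: p subset_iff)
  show pos: "0 < bernoulli_weight E p G" if "G \<in> set_pmf Q" for G
    unfolding bernoulli_weight_def
    using marginal_bounds(3,4)[OF fin Q that] that Q
    by (intro mult_pos_pos prod_pos) (auto simp: p subset_iff)
  have one: "(\<Sum>G\<in>Pow E. pmf Q G) = 1" using fin Q by (simp add: sum_pmf_eq_1)
  have "pmf Q G * ln (bernoulli_weight E p G) =
      (\<Sum>g\<in>E. pmf Q G * of_bool (g \<in> G) * ln (p g) + (pmf Q G - pmf Q G * of_bool (g \<in> G)) * ln (1 - p g))"
    if G: "G \<in> Pow E" for G
  proof (cases "G \<in> set_pmf Q")
    case False
    then show ?thesis by (simp add: set_pmf_iff)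
  next
    case True
    have finG: "finite G" using G fin finite_subset by auto
    have GE: "G \<subseteq> E" using G by auto
    have pp: "0 < p g" if "g \<in> G" for g using marginal_bounds(3)[OF fin Q True that] GE that p by auto
    have pp': "0 < 1 - p g" if "g \<in> E - G" for g using marginal_bounds(4)[OF fin Q True, of g] that p by auto
    have "ln (bernoulli_weight E p G) = ln (\<Prod>g\<in>G. p g) + ln (\<Prod>g\<in>E - G. 1 - p g)"
      unfolding bernoulli_weight_def by (intro ln_mult_pos prod_pos pp pp')
    also have "\<dots> = (\<Sum>g\<in>G. ln (p g)) + (\<Sum>g\<in>E - G. ln (1 - p g))"
      using fin finG by (intro arg_cong2[of _ _ _ _ "(+)"] ln_prod less_imp_neq[symmetric] pp pp') auto
    also have "(\<Sum>g\<in>G. ln (p g)) = (\<Sum>g\<in>E. of_bool (g \<in> G) * ln (p g))"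
      by (rule sum.mono_neutral_cong_left) (use fin GE in auto)
    also have "(\<Sum>g\<in>E - G. ln (1 - p g)) = (\<Sum>g\<in>E. (1 - of_bool (g \<in> G)) * ln (1 - p g))"
      by (rule sum.mono_neutral_cong_left) (use fin GE in auto)
    finally show ?thesis by (simp add: sum.distrib[symmetric] sum_distrib_left algebra_simps)
  qed
  then have "(\<Sum>G\<in>Pow E. pmf Q G * ln (bernoulli_weight E p G)) =
     (\<Sum>G\<in>Pow E. \<Sum>g\<in>E. pmf Q G * of_bool (g \<in> G) * ln (p g) + (pmf Q G - pmf Q G * of_bool (g \<in> G)) * ln (1 - p g))"
    by (rule sum.cong[OF refl])
  also have "\<dots> = (\<Sum>g\<in>E. \<Sum>G\<in>Pow E. pmf Q G * of_bool (g \<in> G) * ln (p g) + (pmf Q G - pmf Q G * of_bool (g \<in> G)) * ln (1 - p g))"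
    by (rule sum.swap)
  also have "\<dots> = (\<Sum>g\<in>E. - bernoulli_entropy (p g))"
  proof (rule sum.cong[OF refl])
    fix g assume "g \<in> E"
    have "(\<Sum>G\<in>Pow E. pmf Q G * of_bool (g \<in> G) * ln (p g) + (pmf Q G - pmf Q G * of_bool (g \<in> G)) * ln (1 - p g))
        = marginal E Q g * ln (p g) + (1 - marginal E Q g) * ln (1 - p g)"
      unfolding sum.distrib sum_distrib_right[symmetric] sum_subtractf one marginal_def ..
    then show "(\<Sum>G\<in>Pow E. pmf Q G * of_bool (g \<in> G) * ln (p g) + (pmf Q G - pmf Q G * of_bool (g \<in> G)) * ln (1 - p g))
        = - bernoulli_entropy (p g)" using p[OF \<open>g \<in> E\<close>] by (simp add: bernoulli_entropy_def xlnx_def)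
  qed
  finally show "(\<Sum>G\<in>Pow E. pmf Q G * ln (bernoulli_weight E p G)) = - total_entropy E p"
    by (simp add: sum_negf)
qed

text \<open>Subadditivity of entropy: Gibbs' inequality against the Bernoulli product with the same
  marginals.\<close>

lemma entropy_le_marginal_entropies:
  assumes fin: "finite E" and Q: "set_pmf Q \<subseteq> Pow E"
  shows "shannon_entropy (Pow E) Q \<le> total_entropy E (marginal E Q)"
proof -
  note c = cross_entropy_bernoulli[OF fin Q refl]
  have "(\<Sum>G\<in>Pow E. pmf Q G * ln (bernoulli_weight E (marginal E Q) G)) \<le> (\<Sum>G\<in>Pow E. xlnx (pmf Q G))"
  proof (rule gibbs_inequality)
    show "sum (bernoulli_weight E (marginal E Q)) (Pow E) \<le> sum (pmf Q) (Pow E)"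
      using fin Q by (simp add: sum_bernoulli_weight sum_pmf_eq_1)
    show "0 < bernoulli_weight E (marginal E Q) G" if "0 < pmf Q G" for G
      using c(2)[of G] that by (simp add: set_pmf_iff)
  qed (use fin c(3) in auto)
  then show ?thesis unfolding c(1) shannon_entropy_xlnx by linarith
qed

text \<open>Subadditivity for the uniform law on \<open>S\<close>. It serves the dense single layer,
  where it shows that the link frequencies of a uniform realisation have a nonnegative entropy
  gap.\<close>

lemma ln_card_le_marginal_entropies:
  assumes fin: "finite E" and S: "S \<subseteq> Pow E" "S \<noteq> {}"
  shows "ln (real (card S)) \<le> (\<Sum>g\<in>E. bernoulli_entropy (real (card {G\<in>S. g \<in> G}) / real (card S)))"
proof -
  have finS: "finite S" using fin S finite_subset by auto
  let ?Q = "pmf_of_set S"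
  have Q: "set_pmf ?Q \<subseteq> Pow E" using finS S by simp
  have c: "real (card S) > 0" using finS S by (simp add: card_gt_0_iff)
  have "marginal E ?Q g = real (card {G\<in>S. g \<in> G}) / real (card S)" for g
  proof -
    have "marginal E ?Q g = (\<Sum>G\<in>{G\<in>S. g \<in> G}. 1 / real (card S))"
      unfolding marginal_def
      by (rule sum.mono_neutral_cong_right) (use fin finS S in \<open>auto simp: indicator_def\<close>)
    then show ?thesis by simp
  qed
  moreover have "shannon_entropy (Pow E) ?Q = ln (real (card S))"
  proof -
    have "shannon_entropy (Pow E) ?Q = - (\<Sum>G\<in>S. 1 / real (card S) * ln (1 / real (card S)))"
      unfolding shannon_entropy_def neg_equal_iff_equal
      by (rule sum.mono_neutral_cong_right) (use fin finS S in \<open>auto simp: indicator_def\<close>)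
    then show ?thesis using c by (simp add: ln_div)
  qed
  ultimately show ?thesis using entropy_le_marginal_entropies[OF fin Q] by simp
qed

lemma exists_bernoulli_product:
  assumes fin: "finite E" and p: "\<And>g. g \<in> E \<Longrightarrow> 0 \<le> p g \<and> p g \<le> 1"
  obtains Q where "set_pmf Q \<subseteq> Pow E" "\<And>g. g \<in> E \<Longrightarrow> marginal E Q g = p g"
    "shannon_entropy (Pow E) Q = total_entropy E p"
proof -
  obtain Q where Q: "\<And>G. pmf Q G = (if G \<in> Pow E then bernoulli_weight E p G else 0)"
  proof (rule pmf_with_weights[of "Pow E" "\<lambda>G. if G \<in> Pow E then bernoulli_weight E p G else 0"])
    show "0 \<le> (if G \<in> Pow E then bernoulli_weight E p G else 0)" for G
      using p by (auto simp: bernoulli_weight_def subset_iff intro!: mult_nonneg_nonneg prod_nonneg)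
    show "(\<Sum>G\<in>Pow E. if G \<in> Pow E then bernoulli_weight E p G else 0) = 1"
      using sum_bernoulli_weight[OF fin, of p] by simp
  qed (use fin in auto)
  have sub: "set_pmf Q \<subseteq> Pow E" using Q by (auto simp: set_pmf_iff split: if_splits)
  have m: "marginal E Q g = p g" if "g \<in> E" for g
  proof -
    have "marginal E Q g = (\<Sum>G\<in>Pow E. bernoulli_weight E p G * of_bool (g \<in> G))"
      unfolding marginal_def by (rule sum.cong) (simp_all add: Q)
    then show ?thesis using marginal_bernoulli_weight[OF fin that, of p] by simp
  qed
  have "shannon_entropy (Pow E) Q = - (\<Sum>G\<in>Pow E. pmf Q G * ln (bernoulli_weight E p G))"
    unfolding shannon_entropy_def neg_equal_iff_equal by (rule sum.cong) (simp_all add: Q)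
  then have "shannon_entropy (Pow E) Q = total_entropy E p"
    using cross_entropy_bernoulli(1)[OF fin sub, of p] m by simp
  with sub m show ?thesis by (rule that)
qed

text \<open>Constraints that are additive over links depend on a law only through its marginals, and
  among the laws with given marginals the Bernoulli product has the largest entropy. Maximising over
  laws therefore reduces to maximising over link probabilities.\<close>

lemma canonical_entropy_as_bernoulli:
  fixes E :: "'a set" and a :: "'a \<Rightarrow> 'i \<Rightarrow> real"
  assumes fin: "finite E" and ne: "feasible_pmfs (Pow E) I C c \<noteq> {}"
    and C: "\<And>G x. G \<subseteq> E \<Longrightarrow> x \<in> I \<Longrightarrow> C G x = (\<Sum>g\<in>G. a g x)"
  defines "F \<equiv> \<lambda>p. (\<forall>g\<in>E. 0 \<le> p g \<and> p g \<le> 1) \<and> (\<forall>x\<in>I. (\<Sum>g\<in>E. p g * a g x) = c x)"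
  shows "\<And>p. F p \<Longrightarrow> total_entropy E p \<le> shannon_entropy (Pow E) (canonical (Pow E) I C c)"
    and "\<exists>p. F p \<and> shannon_entropy (Pow E) (canonical (Pow E) I C c) \<le> total_entropy E p"
proof -
  have finP: "finite (Pow E)" using fin by simp
  note P = canonical_arg_max[OF finP ne]
  have mean: "(\<Sum>G\<in>Pow E. pmf Q G * C G x) = (\<Sum>g\<in>E. marginal E Q g * a g x)" if x: "x \<in> I" for Q x
  proof -
    have "(\<Sum>G\<in>Pow E. pmf Q G * C G x) = (\<Sum>G\<in>Pow E. \<Sum>g\<in>E. pmf Q G * of_bool (g \<in> G) * a g x)"
    proof (rule sum.cong[OF refl])
      fix G assume G: "G \<in> Pow E"
      have "C G x = (\<Sum>g\<in>G. a g x)" using G x by (intro C) auto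
      also have "\<dots> = (\<Sum>g\<in>E. of_bool (g \<in> G) * a g x)"
        by (rule sum.mono_neutral_cong_left) (use fin G in auto)
      finally show "pmf Q G * C G x = (\<Sum>g\<in>E. pmf Q G * of_bool (g \<in> G) * a g x)"
        by (simp add: sum_distrib_left mult.assoc)
    qed
    also have "\<dots> = (\<Sum>g\<in>E. \<Sum>G\<in>Pow E. pmf Q G * of_bool (g \<in> G) * a g x)" by (rule sum.swap)
    finally show ?thesis unfolding marginal_def sum_distrib_right .
  qed
  show "total_entropy E p \<le> shannon_entropy (Pow E) (canonical (Pow E) I C c)" if "F p" for p
  proof -
    obtain Q where Q: "set_pmf Q \<subseteq> Pow E" "\<And>g. g \<in> E \<Longrightarrow> marginal E Q g = p g"
      "shannon_entropy (Pow E) Q = total_entropy E p"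
      using exists_bernoulli_product[OF fin, of p] \<open>F p\<close> unfolding F_def by metis
    have "Q \<in> feasible_pmfs (Pow E) I C c"
      using Q(1) \<open>F p\<close> by (simp add: feasible_pmfs_def mean Q(2) F_def cong: sum.cong)
    from P(2)[OF this] Q(3) show ?thesis by simp
  qed
  let ?P = "canonical (Pow E) I C c"
  have sub: "set_pmf ?P \<subseteq> Pow E" using P(1) by (simp add: feasible_pmfs_def)
  have "F (marginal E ?P)"
    using P(1) marginal_bounds[OF fin sub] by (auto simp: F_def feasible_pmfs_def mean[symmetric])
  with entropy_le_marginal_entropies[OF fin sub]
  show "\<exists>p. F p \<and> shannon_entropy (Pow E) ?P \<le> total_entropy E p" by blast
qed

section \<open>The lopsided local lemma for random permutations\<close>

text \<open>\<open>J\<close> is split into the neighbours \<open>J1\<close> of \<open>e\<close> and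
  the rest \<open>J2\<close>. The lopsided hypothesis handles \<open>J2\<close>. By induction the
  events of \<open>J1\<close> remove at most half of the points avoiding \<open>J2\<close>, since
  \<open>2 * p f\<close> sums to at most 1/2, and this costs the factor 2. The claim is
  multiplicative instead of a conditional probability, so that an empty avoiding set does no
  harm.\<close>

lemma lovasz_local_lemma_aux:
  fixes Bad :: "'e \<Rightarrow> 'w set" and p :: "'e \<Rightarrow> real" and nb :: "'e \<Rightarrow> 'e set"
  defines "av \<equiv> \<lambda>W J. {w \<in> W. \<forall>f\<in>J. w \<notin> Bad f}"
  assumes finW: "finite W" and finE: "finite E" and p0: "\<And>e. e \<in> E \<Longrightarrow> 0 \<le> p e"
    and lop: "\<And>e J. e \<in> E \<Longrightarrow> J \<subseteq> E - nb e \<Longrightarrow>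
        real (card (Bad e \<inter> av W J)) \<le> p e * real (card (av W J))"
    and nbs: "\<And>e. e \<in> E \<Longrightarrow> (\<Sum>f\<in>E \<inter> nb e. p f) \<le> 1/4"
    and "e \<in> E" "J \<subseteq> E"
  shows "real (card (Bad e \<inter> av W J)) \<le> 2 * p e * real (card (av W J))"
  using \<open>e \<in> E\<close> \<open>J \<subseteq> E\<close>
proof (induction "card J" arbitrary: J e rule: less_induct)
  case less
  define J1 where "J1 = J \<inter> nb e"
  define J2 where "J2 = J - nb e"
  have finJ: "finite J" using less.prems finE finite_subset by blast
  have finav: "finite (av W K)" for K using finW by (simp add: av_def)
  have J2: "real (card (Bad e \<inter> av W J2)) \<le> p e * real (card (av W J2))"
    using less.prems by (intro lop) (auto simp: J2_def)
  have sub: "real (card (Bad e \<inter> av W J)) \<le> real (card (Bad e \<inter> av W J2))"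
    using finav by (intro of_nat_mono card_mono) (auto simp: av_def J2_def)
  show ?case
  proof (cases "J1 = {}")
    case True
    then have "J2 = J" by (auto simp: J1_def J2_def)
    moreover have "p e * real (card (av W J)) \<le> 2 * p e * real (card (av W J))"
      using p0 less.prems by (intro mult_right_mono) auto
    ultimately show ?thesis using J2 by auto
  next
    case False
    have "J2 \<subset> J" using False by (auto simp: J1_def J2_def)
    then have c: "card J2 < card J" using finJ by (rule psubset_card_mono[rotated])
    have IH: "real (card (Bad f \<inter> av W J2)) \<le> 2 * p f * real (card (av W J2))" if "f \<in> J1" for f
      using that less.prems by (intro less.hyps[OF c]) (auto simp: J1_def J2_def)
    have "av W J2 \<subseteq> av W J \<union> (\<Union>f\<in>J1. Bad f \<inter> av W J2)" by (auto simp: av_def J1_def J2_def)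
    moreover have finU: "finite (\<Union>f\<in>J1. Bad f \<inter> av W J2)" using finav by (rule_tac finite_subset[of _ "av W J2"]) auto
    ultimately have "card (av W J2) \<le> card (av W J \<union> (\<Union>f\<in>J1. Bad f \<inter> av W J2))"
      using finav by (intro card_mono) auto
    also have "\<dots> \<le> card (av W J) + card (\<Union>f\<in>J1. Bad f \<inter> av W J2)" by (rule card_Un_le)
    also have "card (\<Union>f\<in>J1. Bad f \<inter> av W J2) \<le> (\<Sum>f\<in>J1. card (Bad f \<inter> av W J2))"
      using finJ by (intro card_UN_le) (auto simp: J1_def)
    finally have "real (card (av W J2)) \<le> real (card (av W J)) + (\<Sum>f\<in>J1. real (card (Bad f \<inter> av W J2)))"
      using of_nat_mono by fastforce
    also have "(\<Sum>f\<in>J1. real (card (Bad f \<inter> av W J2))) \<le> (\<Sum>f\<in>J1. 2 * p f * real (card (av W J2)))"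
      by (intro sum_mono IH)
    also have "\<dots> = 2 * (\<Sum>f\<in>J1. p f) * real (card (av W J2))"
      by (simp add: sum_distrib_left sum_distrib_right)
    also have "\<dots> \<le> 2 * (1/4) * real (card (av W J2))"
    proof (intro mult_mono)
      have "(\<Sum>f\<in>J1. p f) \<le> (\<Sum>f\<in>E \<inter> nb e. p f)"
        using less.prems finE p0 by (intro sum_mono2) (auto simp: J1_def)
      with nbs[OF less.prems(1)] show "(\<Sum>f\<in>J1. p f) \<le> 1/4" by linarith
      show "0 \<le> sum p J1" using less.prems p0 by (intro sum_nonneg) (auto simp: J1_def)
    qed auto
    finally have half: "real (card (av W J2)) \<le> 2 * real (card (av W J))" by simp
    have "p e * real (card (av W J2)) \<le> p e * (2 * real (card (av W J)))"
      using half p0 less.prems by (intro mult_left_mono) auto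
    with J2 sub show ?thesis by simp
  qed
qed

text \<open>Adding the events one at a time keeps at least the fraction \<open>1 - 2 * p e\<close>
  at each step, and this is at least \<open>exp (- 4 * p e)\<close>.\<close>

lemma lovasz_local_lemma:
  fixes Bad :: "'e \<Rightarrow> 'w set" and p :: "'e \<Rightarrow> real" and nb :: "'e \<Rightarrow> 'e set"
  defines "av \<equiv> \<lambda>W J. {w \<in> W. \<forall>f\<in>J. w \<notin> Bad f}"
  assumes finW: "finite W" and finE: "finite E" and p0: "\<And>e. e \<in> E \<Longrightarrow> 0 \<le> p e"
    and p4: "\<And>e. e \<in> E \<Longrightarrow> p e \<le> 1/4"
    and lop: "\<And>e J. e \<in> E \<Longrightarrow> J \<subseteq> E - nb e \<Longrightarrow>
        real (card (Bad e \<inter> av W J)) \<le> p e * real (card (av W J))"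
    and nbs: "\<And>e. e \<in> E \<Longrightarrow> (\<Sum>f\<in>E \<inter> nb e. p f) \<le> 1/4"
  shows "exp (- 4 * (\<Sum>e\<in>E. p e)) * real (card W) \<le> real (card (av W E))"
proof -
  have "exp (- 4 * (\<Sum>e\<in>J. p e)) * real (card W) \<le> real (card (av W J))" if "J \<subseteq> E" for J
    using finite_subset[OF that finE] that
  proof (induction J rule: finite_induct)
    case empty
    show ?case by (simp add: av_def)
  next
    case (insert e J)
    then have e: "e \<in> E" and J: "J \<subseteq> E" by auto
    have finav: "finite (av W J)" using finW by (simp add: av_def)
    have "av W (insert e J) = av W J - (Bad e \<inter> av W J)" by (auto simp: av_def)
    then have "card (av W (insert e J)) = card (av W J) - card (Bad e \<inter> av W J)"
      using finav by (simp add: card_Diff_subset)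
    moreover have "card (Bad e \<inter> av W J) \<le> card (av W J)" using finav by (intro card_mono) auto
    ultimately have eq: "real (card (av W (insert e J))) = real (card (av W J)) - real (card (Bad e \<inter> av W J))"
      by simp
    have "real (card (Bad e \<inter> av W J)) \<le> 2 * p e * real (card (av W J))"
      using lovasz_local_lemma_aux[where Bad=Bad and p=p and nb=nb, OF finW finE p0 _ nbs e J] lop
      unfolding av_def by blast
    then have 1: "(1 - 2 * p e) * real (card (av W J)) \<le> real (card (av W (insert e J)))"
      unfolding eq by (simp add: algebra_simps)
    have 2: "exp (- 4 * p e) \<le> 1 - 2 * p e"
    proof -
      \<comment> \<open>The bound \<open>ln (1 - x) \<ge> - x - 2 * x^2\<close> at
        \<open>x = 2 * p e \<le> 1/2\<close>; then \<open>p e \<le> 1/4\<close> makes the quadratic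
        term at most \<open>2 * p e\<close>.\<close>
      have "- (2 * p e) - 2 * (2 * p e)\<^sup>2 \<le> ln (1 - 2 * p e)"
        using p0[OF e] p4[OF e] by (intro ln_one_minus_pos_lower_bound) auto
      moreover have "2 * (2 * p e)\<^sup>2 \<le> 2 * p e"
        using mult_left_mono[OF p4[OF e] p0[OF e]] by (simp add: power2_eq_square)
      ultimately have "- 4 * p e \<le> ln (1 - 2 * p e)" by linarith
      then show ?thesis using p4[OF e] by (subst ln_ge_iff[symmetric]) auto
    qed
    have "exp (- 4 * (\<Sum>e\<in>insert e J. p e)) * real (card W) =
        exp (- 4 * p e) * (exp (- 4 * (\<Sum>e\<in>J. p e)) * real (card W))"
      using insert by (simp add: algebra_simps exp_add[symmetric])
    also have "\<dots> \<le> (1 - 2 * p e) * real (card (av W J))"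
      using 2 insert.IH[OF J] p4[OF e] by (intro mult_mono) auto
    finally show ?case using 1 by linarith
  qed
  then show ?thesis by simp
qed

text \<open>Two successive transpositions suffice, and a displaced point can only land on a place
  vacated by \<open>x\<close> or \<open>x'\<close>. The switching below relies on this: it creates
  no other new value.\<close>

lemma exists_fixing_permutation:
  assumes "x < N" "x' < N" "c < N" "c' < (N::nat)" "(x = x') = (c = c')"
  obtains t where "t permutes {..<N}" "t x = c" "t x' = c'"
    "\<And>z. z \<noteq> x \<Longrightarrow> z \<noteq> x' \<Longrightarrow> t z = z \<or> t z = x \<or> t z = x'"
proof -
  define t1 where "t1 = Transposition.transpose x c"
  define t where "t = Transposition.transpose (t1 x') c' \<circ> t1"
  have "t1 permutes {..<N}" unfolding t1_def using assms by (intro permutes_swap_id) auto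
  moreover have "t1 x' < N" using assms by (auto simp: t1_def Transposition.transpose_def)
  ultimately have "t permutes {..<N}" unfolding t_def using assms
    by (intro permutes_compose permutes_swap_id) auto
  moreover have "t x = c" "t x' = c'" using assms by (auto simp: t_def t1_def Transposition.transpose_def)
  moreover have "t z = z \<or> t z = x \<or> t z = x'" if "z \<noteq> x" "z \<noteq> x'" for z
    using assms that by (auto simp: t_def t1_def Transposition.transpose_def)
  ultimately show ?thesis by (rule that)
qed

section \<open>Bad events of a random permutation\<close>

text \<open>One type of quadruple encodes both kinds of bad event. With \<open>y = y'\<close>, hence
  \<open>x = x'\<close> by \<open>consistent\<close>, a single value is prescribed, which will mean
  a self-loop; otherwise two values are prescribed, which will mean a double link.
  \<open>hit_prob\<close> is the probability of the event under a uniform permutation.\<close>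

definition hits :: "nat \<times> nat \<times> nat \<times> nat \<Rightarrow> (nat \<Rightarrow> nat) set" where
  "hits = (\<lambda>(y, x, y', x'). {\<sigma>. \<sigma> y = x \<and> \<sigma> y' = x'})"

definition hit_prob :: "nat \<Rightarrow> nat \<times> nat \<times> nat \<times> nat \<Rightarrow> real" where
  "hit_prob N = (\<lambda>(y, x, y', x'). if y = y' then 1 / real N else 1 / (real N * real (N - 1)))"

definition touching :: "nat \<times> nat \<times> nat \<times> nat \<Rightarrow> (nat \<times> nat \<times> nat \<times> nat) set" where
  "touching = (\<lambda>(y, x, y', x'). {(y2, x2, y2', x2').
      y2 \<in> {y, y'} \<or> y2' \<in> {y, y'} \<or> x2 \<in> {x, x'} \<or> x2' \<in> {x, x'}})"

definition consistent :: "nat \<Rightarrow> (nat \<times> nat \<times> nat \<times> nat) set" where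
  "consistent N = {(y, x, y', x'). y < N \<and> x < N \<and> y' < N \<and> x' < N \<and> (y = y') = (x = x')}"

text \<open>Switching: a permutation hitting \<open>e\<close> and avoiding \<open>J\<close> is moved to one with arbitrary other values
  at the positions of \<open>e\<close>; the new values arising elsewhere are those of \<open>e\<close>, which \<open>J\<close> does not mention.\<close>

lemma hits_lopsided:
  fixes N :: nat
  defines "av \<equiv> \<lambda>J. {\<sigma> \<in> {\<sigma>. \<sigma> permutes {..<N}}. \<forall>f\<in>J. \<sigma> \<notin> hits f}"
  assumes e: "e \<in> consistent N" and J: "J \<subseteq> consistent N - touching e"
  shows "real (card (hits e \<inter> av J)) \<le> hit_prob N e * real (card (av J))"
proof -
  obtain y x y' x' where e_eq: "e = (y, x, y', x')" by (cases e)
  note lt = e[unfolded e_eq consistent_def]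
  \<comment> \<open>The admissible new values at \<open>y\<close> and \<open>y'\<close>. Their
    number is the inverse of \<open>hit_prob N e\<close>, so it suffices to inject \<open>D\<close>
    times the permutations hitting \<open>e\<close> and avoiding \<open>J\<close> into
    \<open>av J\<close>.\<close>
  define D where "D = {(c, c'). c < N \<and> c' < N \<and> (x = x') = (c = c')}"
  define T where "T = (\<lambda>(c, c'). SOME t. t permutes {..<N} \<and> t x = c \<and> t x' = c' \<and>
      (\<forall>z. z \<noteq> x \<longrightarrow> z \<noteq> x' \<longrightarrow> t z = z \<or> t z = x \<or> t z = x'))"
  have T: "T d permutes {..<N}" "T d x = fst d" "T d x' = snd d"
    "\<And>z. z \<noteq> x \<Longrightarrow> z \<noteq> x' \<Longrightarrow> T d z = z \<or> T d z = x \<or> T d z = x'" if "d \<in> D" for d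
  proof -
    obtain c c' where d: "d = (c, c')" by (cases d)
    have "\<exists>t. t permutes {..<N} \<and> t x = c \<and> t x' = c' \<and>
      (\<forall>z. z \<noteq> x \<longrightarrow> z \<noteq> x' \<longrightarrow> t z = z \<or> t z = x \<or> t z = x')"
      using exists_fixing_permutation[of x N x' c c'] lt that by (auto simp: D_def d)
    from someI_ex[OF this] show "T d permutes {..<N}" "T d x = fst d" "T d x' = snd d"
      "\<And>z. z \<noteq> x \<Longrightarrow> z \<noteq> x' \<Longrightarrow> T d z = z \<or> T d z = x \<or> T d z = x'"
      unfolding T_def d by auto
  qed
  \<comment> \<open>The values at \<open>y\<close> and \<open>y'\<close> reveal the chosen element
    of \<open>D\<close>, after which the permutation \<open>T d\<close> can be cancelled.\<close>
  have inj: "inj_on (\<lambda>(d, \<sigma>). T d \<circ> \<sigma>) (D \<times> (hits e \<inter> av J))"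
  proof (rule inj_onI, clarify)
    fix c c' \<sigma> d d' \<tau>
    assume A: "(c, c') \<in> D" "(d, d') \<in> D" "\<sigma> \<in> hits e" "\<tau> \<in> hits e" "\<sigma> \<in> av J" "\<tau> \<in> av J"
      and eq: "T (c, c') \<circ> \<sigma> = T (d, d') \<circ> \<tau>"
    have "\<sigma> y = x" "\<sigma> y' = x'" "\<tau> y = x" "\<tau> y' = x'" using A by (auto simp: hits_def e_eq)
    then have 1: "c = d" "c' = d'" using fun_cong[OF eq, of y] fun_cong[OF eq, of y'] T(2,3)[OF A(1)] T(2,3)[OF A(2)] by auto
    have "inj (T (d, d'))" using T(1)[OF A(2)] by (rule permutes_inj)
    then have "\<sigma> = \<tau>" using eq 1 by (metis fun.inj_map_strong comp_def inj_eq ext)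
    with 1 show "(c, c') = (d, d') \<and> \<sigma> = \<tau>" by simp
  qed
  have im: "(\<lambda>(d, \<sigma>). T d \<circ> \<sigma>) ` (D \<times> (hits e \<inter> av J)) \<subseteq> av J"
  proof clarify
    fix c c' \<sigma> assume d: "(c, c') \<in> D" and s: "\<sigma> \<in> hits e" "\<sigma> \<in> av J"
    have perm: "\<sigma> permutes {..<N}" using s by (simp add: av_def)
    have sy: "\<sigma> y = x" "\<sigma> y' = x'" using s by (auto simp: hits_def e_eq)
    have inj: "inj \<sigma>" using perm by (rule permutes_inj)
    have "T (c, c') \<circ> \<sigma> \<notin> hits f" if f: "f \<in> J" for f
    proof
      obtain y2 x2 y2' x2' where f_eq: "f = (y2, x2, y2', x2')" by (cases f)
      assume "T (c, c') \<circ> \<sigma> \<in> hits f"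
      then have h: "T (c, c') (\<sigma> y2) = x2" "T (c, c') (\<sigma> y2') = x2'" by (auto simp: hits_def f_eq)
      have nt: "y2 \<notin> {y, y'}" "y2' \<notin> {y, y'}" "x2 \<notin> {x, x'}" "x2' \<notin> {x, x'}"
        using J f by (auto simp: touching_def e_eq f_eq)
      \<comment> \<open>\<open>\<sigma>\<close> takes the values \<open>x\<close> and
        \<open>x'\<close> only at \<open>y\<close> and \<open>y'\<close>, so a changed value at
        another position is \<open>x\<close> or \<open>x'\<close>, which \<open>f\<close> does not
        mention.\<close>
      have "\<sigma> y2 \<noteq> x" "\<sigma> y2 \<noteq> x'" "\<sigma> y2' \<noteq> x" "\<sigma> y2' \<noteq> x'"
        using nt sy inj by (auto dest: injD)
      with T(4)[OF d] h nt have "\<sigma> y2 = x2" "\<sigma> y2' = x2'" by (metis insertCI)+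
      then have "\<sigma> \<in> hits f" by (simp add: hits_def f_eq)
      with s f show False by (auto simp: av_def)
    qed
    moreover have "T (c, c') \<circ> \<sigma> permutes {..<N}" using perm T(1)[OF d] by (rule permutes_compose)
    ultimately show "T (c, c') \<circ> \<sigma> \<in> av J" by (simp add: av_def)
  qed
  have finav: "finite (av J)" by (simp add: av_def finite_permutations)
  have "card D * card (hits e \<inter> av J) = card ((\<lambda>(d, \<sigma>). T d \<circ> \<sigma>) ` (D \<times> (hits e \<inter> av J)))"
    by (simp add: card_image[OF inj] card_cartesian_product)
  also have "\<dots> \<le> card (av J)" by (rule card_mono[OF finav im])
  finally have le: "real (card D) * real (card (hits e \<inter> av J)) \<le> real (card (av J))"
    by (metis of_nat_le_iff of_nat_mult)
  have N0: "N > 0" using lt by auto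
  have "real (card D) * hit_prob N e = 1 \<and> hit_prob N e \<ge> 0"
  proof (cases "y = y'")
    case True
    then have "D = (\<lambda>c. (c, c)) ` {..<N}" using lt by (auto simp: D_def)
    then have "card D = N" by (simp add: card_image inj_on_def)
    then show ?thesis using True N0 by (simp add: hit_prob_def e_eq)
  next
    case False
    then have "D = (SIGMA c:{..<N}. {..<N} - {c})" using lt by (auto simp: D_def)
    then have "card D = N * (N - 1)" by simp
    moreover have "N \<ge> 2" using False lt by auto
    ultimately show ?thesis using False by (simp add: hit_prob_def e_eq)
  qed
  then have "real (card (hits e \<inter> av J)) = hit_prob N e * (real (card D) * real (card (hits e \<inter> av J)))"
    by (simp add: mult.commute mult.left_commute)
  also have "\<dots> \<le> hit_prob N e * real (card (av J))"
    using le \<open>_ = 1 \<and> hit_prob N e \<ge> 0\<close> by (intro mult_left_mono) auto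
  finally show ?thesis .
qed

text \<open>\<open>w\<close> and \<open>v\<close> name the owners of the half-links on the two sides
  of the matching. A permutation matching \<open>y\<close> with \<open>x\<close> joins
  \<open>w y\<close> to \<open>v x\<close>: a clash is a pair that makes a self-loop, or two pairs
  that make the same unordered link.\<close>

definition clashes :: "nat \<Rightarrow> (nat \<Rightarrow> 'v) \<Rightarrow> (nat \<Rightarrow> 'v) \<Rightarrow> (nat \<times> nat \<times> nat \<times> nat) set" where
  "clashes N w v = {(y, x, y', x') \<in> consistent N.
     if y = y' then w y = v x else {w y', v x'} = {w y, v x}}"

text \<open>The loops contribute at most \<open>q / N\<close>. Since
  \<open>1 / (N - 1) \<le> 2 / N\<close>, the doubles contribute at most
  \<open>4 * q / N\<close>.\<close>

lemma sum_hit_prob_le: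
  assumes F: "F \<subseteq> consistent N" and N: "2 \<le> N"
    and loops: "card {(y, x, y', x') \<in> F. y = y'} \<le> q"
    and doubles: "card {(y, x, y', x') \<in> F. y \<noteq> y'} \<le> N * (2 * q)"
  shows "(\<Sum>f\<in>F. hit_prob N f) \<le> 5 * real q / real N"
proof -
  have "consistent N \<subseteq> {..<N} \<times> {..<N} \<times> {..<N} \<times> {..<N}" by (auto simp: consistent_def)
  then have finF: "finite F" using F by (meson finite_SigmaI finite_lessThan finite_subset)
  let ?A = "{(y, x, y', x') \<in> F. y = y'}" and ?B = "{(y, x, y', x') \<in> F. y \<noteq> y'}"
  have fin: "finite ?A" "finite ?B" by (rule finite_subset[OF _ finF]; auto)+
  have "(\<Sum>f\<in>F. hit_prob N f) = (\<Sum>f\<in>?A \<union> ?B. hit_prob N f)" by (rule sum.cong) auto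
  also have "\<dots> = (\<Sum>f\<in>?A. hit_prob N f) + (\<Sum>f\<in>?B. hit_prob N f)"
    by (rule sum.union_disjoint) (use fin in auto)
  also have "(\<Sum>f\<in>?A. hit_prob N f) = (\<Sum>f\<in>?A. 1 / real N)"
    by (rule sum.cong) (auto simp: hit_prob_def)
  also have "(\<Sum>f\<in>?B. hit_prob N f) = (\<Sum>f\<in>?B. 1 / (real N * real (N - 1)))"
    by (rule sum.cong) (auto simp: hit_prob_def)
  also have "(\<Sum>f\<in>?A. 1 / real N) \<le> real q / real N"
    using loops by (simp add: divide_right_mono)
  also have "(\<Sum>f\<in>?B. 1 / (real N * real (N - 1))) \<le> real (N * (2 * q)) * (1 / (real N * real (N - 1)))"
    unfolding sum_constant using doubles by (intro mult_right_mono of_nat_mono) auto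
  also have "\<dots> = 2 * real q / real (N - 1)" using N by simp
  also have "\<dots> \<le> 4 * real q / real N"
  proof -
    have "real N \<le> 2 * real (N - 1)" using N by linarith
    then show ?thesis using N mult_left_mono[of "real N" "2 * real (N - 1)" "2 * real q"]
      by (simp add: divide_simps algebra_simps)
  qed
  finally show ?thesis by (simp add: add_divide_distrib[symmetric])
qed

text \<open>With one coordinate fixed, a loop leaves at most \<open>a\<close> or \<open>b\<close>
  choices. A double leaves \<open>N\<close> choices for the partner of that coordinate and then at
  most \<open>2 * (a * b)\<close> for the second pair, the 2 coming from the two ways to match an
  unordered link. The last two bounds follow by exchanging the two halves of a quadruple.\<close>

lemma clashes_degree:
  fixes w v :: "nat \<Rightarrow> 'v"
  assumes N: "2 \<le> N" and a: "\<And>u. card {x\<in>{..<N}. v x = u} \<le> a" and b: "\<And>u. card {y\<in>{..<N}. w y = u} \<le> b"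
    and "1 \<le> a" "1 \<le> b"
  shows "(\<Sum>f\<in>{(y, x, y', x') \<in> clashes N w v. y = z}. hit_prob N f) \<le> 5 * real (a * b) / real N" (is ?t1)
    and "(\<Sum>f\<in>{(y, x, y', x') \<in> clashes N w v. x = z}. hit_prob N f) \<le> 5 * real (a * b) / real N" (is ?t2)
    and "(\<Sum>f\<in>{(y, x, y', x') \<in> clashes N w v. y' = z}. hit_prob N f) \<le> 5 * real (a * b) / real N" (is ?t3)
    and "(\<Sum>f\<in>{(y, x, y', x') \<in> clashes N w v. x' = z}. hit_prob N f) \<le> 5 * real (a * b) / real N" (is ?t4)
proof -
  let ?X = "\<lambda>u. {x\<in>{..<N}. v x = u}" and ?Y = "\<lambda>u. {y\<in>{..<N}. w y = u}"
  \<comment> \<open>The pairs \<open>(y', x')\<close> whose owners repeat the link of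
    \<open>(y, x)\<close> in either orientation.\<close>
  define K where "K y x = ?Y (w y) \<times> ?X (v x) \<union> ?Y (v x) \<times> ?X (w y)" for y x
  have finK: "finite (K y x)" for y x by (simp add: K_def)
  have cK: "card (K y x) \<le> 2 * (a * b)" for y x
  proof -
    have "card (K y x) \<le> card (?Y (w y) \<times> ?X (v x)) + card (?Y (v x) \<times> ?X (w y))"
      unfolding K_def by (rule card_Un_le)
    also have "\<dots> \<le> b * a + b * a" unfolding card_cartesian_product
      by (intro add_mono mult_mono a b) auto
    finally show ?thesis by (simp add: mult.commute)
  qed
  have aq: "a \<le> a * b" "b \<le> a * b" using \<open>1 \<le> a\<close> \<open>1 \<le> b\<close> by auto
  show t1: ?t1
  proof (rule sum_hit_prob_le[OF _ N])
    show "{(y, x, y', x') \<in> clashes N w v. y = z} \<subseteq> consistent N" by (auto simp: clashes_def)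
    have "card {(y, x, y', x') \<in> {(y, x, y', x') \<in> clashes N w v. y = z}. y = y'}
      \<le> card ((\<lambda>x. (z, x, z, x)) ` ?X (w z))"
      by (rule card_mono) (auto simp: clashes_def consistent_def)
    also have "\<dots> \<le> card (?X (w z))" by (rule card_image_le) auto
    also have "\<dots> \<le> a * b" using a aq order_trans by blast
    finally show "card {(y, x, y', x') \<in> {(y, x, y', x') \<in> clashes N w v. y = z}. y = y'} \<le> a * b" .
    have "card {(y, x, y', x') \<in> {(y, x, y', x') \<in> clashes N w v. y = z}. y \<noteq> y'}
      \<le> card ((\<lambda>(x, y', x'). (z, x, y', x')) ` (SIGMA x:{..<N}. K z x))"
      by (rule card_mono) (use finK in \<open>auto simp: clashes_def consistent_def K_def image_iff doubleton_eq_iff\<close>)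
    also have "\<dots> \<le> card (SIGMA x:{..<N}. K z x)" by (rule card_image_le) (use finK in auto)
    also have "\<dots> \<le> (\<Sum>x<N. 2 * (a * b))" using finK by (simp add: sum_mono cK del: sum_constant)
    finally show "card {(y, x, y', x') \<in> {(y, x, y', x') \<in> clashes N w v. y = z}. y \<noteq> y'} \<le> N * (2 * (a * b))" by simp
  qed
  show t2: ?t2
  proof (rule sum_hit_prob_le[OF _ N])
    show "{(y, x, y', x') \<in> clashes N w v. x = z} \<subseteq> consistent N" by (auto simp: clashes_def)
    have "card {(y, x, y', x') \<in> {(y, x, y', x') \<in> clashes N w v. x = z}. y = y'}
      \<le> card ((\<lambda>y. (y, z, y, z)) ` ?Y (v z))"
      by (rule card_mono) (auto simp: clashes_def consistent_def)
    also have "\<dots> \<le> card (?Y (v z))" by (rule card_image_le) auto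
    also have "\<dots> \<le> a * b" using b aq order_trans by blast
    finally show "card {(y, x, y', x') \<in> {(y, x, y', x') \<in> clashes N w v. x = z}. y = y'} \<le> a * b" .
    have "card {(y, x, y', x') \<in> {(y, x, y', x') \<in> clashes N w v. x = z}. y \<noteq> y'}
      \<le> card ((\<lambda>(y, y', x'). (y, z, y', x')) ` (SIGMA y:{..<N}. K y z))"
      by (rule card_mono) (use finK in \<open>auto simp: clashes_def consistent_def K_def image_iff doubleton_eq_iff\<close>)
    also have "\<dots> \<le> card (SIGMA y:{..<N}. K y z)" by (rule card_image_le) (use finK in auto)
    also have "\<dots> \<le> (\<Sum>x<N. 2 * (a * b))" using finK by (simp add: sum_mono cK del: sum_constant)
    finally show "card {(y, x, y', x') \<in> {(y, x, y', x') \<in> clashes N w v. x = z}. y \<noteq> y'} \<le> N * (2 * (a * b))" by simp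
  qed
  let ?sw = "\<lambda>(y, x, y', x'). (y', x', y, x) :: nat \<times> nat \<times> nat \<times> nat"
  have "(\<Sum>f\<in>{(y, x, y', x') \<in> clashes N w v. y' = z}. hit_prob N f) = (\<Sum>f\<in>{(y, x, y', x') \<in> clashes N w v. y = z}. hit_prob N f)"
    by (rule sum.reindex_bij_witness[of _ ?sw ?sw]) (auto simp: clashes_def consistent_def hit_prob_def split: if_splits)
  with t1 show ?t3 by simp
  have "(\<Sum>f\<in>{(y, x, y', x') \<in> clashes N w v. x' = z}. hit_prob N f) = (\<Sum>f\<in>{(y, x, y', x') \<in> clashes N w v. x = z}. hit_prob N f)"
    by (rule sum.reindex_bij_witness[of _ ?sw ?sw]) (auto simp: clashes_def consistent_def hit_prob_def split: if_splits)
  with t2 show ?t4 by simp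
qed

lemma sum_Un_le:
  fixes f :: "'a \<Rightarrow> real"
  assumes "finite A" "finite B" "\<And>x. x \<in> A \<union> B \<Longrightarrow> 0 \<le> f x"
  shows "sum f (A \<union> B) \<le> sum f A + sum f B"
proof -
  have "sum f (A \<union> B) + sum f (A \<inter> B) = sum f A + sum f B" using assms(1,2) by (rule sum.union_inter)
  moreover have "0 \<le> sum f (A \<inter> B)" using assms(3) by (intro sum_nonneg) auto
  ultimately show ?thesis by linarith
qed

text \<open>An event has two positions and two values, and each can be shared with either half of
  another clash. So a neighbourhood is covered by eight families of weight at most
  \<open>5 * a * b / N\<close>, and \<open>N \<ge> 160 * (a * b)\<close> makes their total at most
  1/4. All clashes together weigh at most \<open>5 * a * b\<close>, which the factor 4 in the
  exponent of the local lemma turns into 20.\<close>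

lemma card_simple_permutations:
  fixes w v :: "nat \<Rightarrow> 'v"
  assumes a: "\<And>u. card {x\<in>{..<N}. v x = u} \<le> a" and b: "\<And>u. card {y\<in>{..<N}. w y = u} \<le> b"
    and N: "160 * (a * b) \<le> N"
  shows "exp (- 20 * real (a * b)) * fact N \<le> real (card {\<sigma>. \<sigma> permutes {..<N} \<and>
     (\<forall>y<N. w y \<noteq> v (\<sigma> y)) \<and> (\<forall>y<N. \<forall>y'<N. y \<noteq> y' \<longrightarrow> {w y', v (\<sigma> y')} \<noteq> {w y, v (\<sigma> y)})})"
proof (cases "N = 0")
  case True
  have "{\<sigma>. \<sigma> permutes {..<N} \<and> (\<forall>y<N. w y \<noteq> v (\<sigma> y)) \<and>
      (\<forall>y<N. \<forall>y'<N. y \<noteq> y' \<longrightarrow> {w y', v (\<sigma> y')} \<noteq> {w y, v (\<sigma> y)})} = {id}"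
    unfolding True by auto
  then show ?thesis by (simp add: True)
next
  case False
  \<comment> \<open>A nonempty class on each side forces \<open>a\<close> and \<open>b\<close> to be
    positive, so the size hypothesis also gives \<open>2 \<le> N\<close> and
    \<open>4 \<le> N\<close>.\<close>
  have "card {x \<in> {..<N}. v x = v 0} > 0" "card {x \<in> {..<N}. w x = w 0} > 0"
    using False by (auto simp: card_gt_0_iff)
  then have a1: "1 \<le> a" and b1: "1 \<le> b" using a[of "v 0"] b[of "w 0"] by linarith+
  have "a * b \<ge> 1" using a1 b1 by (simp add: Suc_leI)
  then have N2: "2 \<le> N" and N4: "4 \<le> N" using N by linarith+
  let ?C = "clashes N w v" and ?P = "{\<sigma>. \<sigma> permutes {..<N}}"
  note deg = clashes_degree[OF N2 a b a1 b1]
  have "consistent N \<subseteq> {..<N} \<times> {..<N} \<times> {..<N} \<times> {..<N}" by (auto simp: consistent_def)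
  then have finCon: "finite (consistent N)" by (meson finite_SigmaI finite_lessThan finite_subset)
  have CC: "?C \<subseteq> consistent N" by (auto simp: clashes_def)
  have finC: "finite ?C" by (rule finite_subset[OF CC finCon])
  have nn: "0 \<le> hit_prob N e" for e by (auto simp: hit_prob_def split: prod.split)
  have "hit_prob N e \<le> 1 / 4" for e
  proof -
    have "4 * 1 \<le> real N * real (N - 1)" using N4 by (intro mult_mono) auto
    then show ?thesis using N4 by (auto simp: hit_prob_def divide_simps split: prod.split)
  qed
  moreover have "(\<Sum>f\<in>?C \<inter> touching e. hit_prob N f) \<le> 1/4" for e
  proof -
    obtain y0 x0 y1 x1 where e: "e = (y0, x0, y1, x1)" by (cases e)
    let ?D = "\<lambda>y0 x0. {(y, x, y', x') \<in> ?C. y = y0} \<union> ({(y, x, y', x') \<in> ?C. x = x0} \<union>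
       ({(y, x, y', x') \<in> ?C. y' = y0} \<union> {(y, x, y', x') \<in> ?C. x' = x0}))"
    have fin1: "finite {(y, x, y', x') \<in> ?C. P y x y' x'}" for P by (rule finite_subset[OF _ finC]) auto
    have D: "(\<Sum>f\<in>?D y0 x0. hit_prob N f) \<le> 4 * (5 * real (a * b) / real N)" for y0 x0
    proof -
      have "(\<Sum>f\<in>?D y0 x0. hit_prob N f) \<le> (\<Sum>f\<in>{(y, x, y', x') \<in> ?C. y = y0}. hit_prob N f) +
        ((\<Sum>f\<in>{(y, x, y', x') \<in> ?C. x = x0}. hit_prob N f) + ((\<Sum>f\<in>{(y, x, y', x') \<in> ?C. y' = y0}. hit_prob N f) +
         (\<Sum>f\<in>{(y, x, y', x') \<in> ?C. x' = x0}. hit_prob N f)))"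
        by (intro order_trans[OF sum_Un_le] add_left_mono finite_UnI fin1 nn order_refl)
      then show ?thesis using deg(1)[of y0] deg(2)[of x0] deg(3)[of y0] deg(4)[of x0] by linarith
    qed
    have finD: "finite (?D y0 x0)" for y0 x0 by (intro finite_UnI fin1)
    have "(\<Sum>f\<in>?C \<inter> touching e. hit_prob N f) \<le> (\<Sum>f\<in>?D y0 x0 \<union> ?D y1 x1. hit_prob N f)"
      by (rule sum_mono2[OF finite_UnI[OF finD finD]]) (auto simp: touching_def e nn)
    also have "\<dots> \<le> (\<Sum>f\<in>?D y0 x0. hit_prob N f) + (\<Sum>f\<in>?D y1 x1. hit_prob N f)"
      by (rule sum_Un_le[OF finD finD nn])
    also have "\<dots> \<le> 40 * real (a * b) / real N" using D[of y0 x0] D[of y1 x1] by simp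
    also have "\<dots> \<le> 1 / 4"
    proof -
      have "real (160 * (a * b)) \<le> real N" using N by (rule of_nat_mono)
      then show ?thesis using N4 by (simp add: divide_simps)
    qed
    finally show ?thesis .
  qed
  moreover have "real (card (hits e \<inter> {\<sigma> \<in> ?P. \<forall>f\<in>J. \<sigma> \<notin> hits f})) \<le> hit_prob N e * real (card {\<sigma> \<in> ?P. \<forall>f\<in>J. \<sigma> \<notin> hits f})"
    if "e \<in> ?C" "J \<subseteq> ?C - touching e" for e J
    using hits_lopsided[of e N J] that CC by auto
  ultimately have "exp (- 4 * (\<Sum>e\<in>?C. hit_prob N e)) * real (card ?P) \<le> real (card {\<sigma> \<in> ?P. \<forall>f\<in>?C. \<sigma> \<notin> hits f})"
    using finC nn by (intro lovasz_local_lemma[where nb = touching]) (auto simp: finite_permutations)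
  moreover have "{\<sigma> \<in> ?P. \<forall>f\<in>?C. \<sigma> \<notin> hits f} \<subseteq> {\<sigma>. \<sigma> permutes {..<N} \<and>
     (\<forall>y<N. w y \<noteq> v (\<sigma> y)) \<and> (\<forall>y<N. \<forall>y'<N. y \<noteq> y' \<longrightarrow> {w y', v (\<sigma> y')} \<noteq> {w y, v (\<sigma> y)})}"
  proof clarify
    fix \<sigma> assume s: "\<sigma> permutes {..<N}" and C: "\<forall>f\<in>?C. \<sigma> \<notin> hits f"
    have lt: "\<sigma> y < N" if "y < N" for y using permutes_in_image[OF s, of y] that by simp
    have inj: "(\<sigma> y = \<sigma> y') = (y = y')" for y y' using permutes_inj[OF s] by (auto dest: injD)
    have "w y \<noteq> v (\<sigma> y)" if "y < N" for y
      using C[rule_format, of "(y, \<sigma> y, y, \<sigma> y)"] that lt by (auto simp: clashes_def consistent_def hits_def)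
    moreover have "{w y', v (\<sigma> y')} \<noteq> {w y, v (\<sigma> y)}" if "y < N" "y' < N" "y \<noteq> y'" for y y'
      using C[rule_format, of "(y, \<sigma> y, y', \<sigma> y')"] that lt inj by (auto simp: clashes_def consistent_def hits_def)
    ultimately show "(\<forall>y<N. w y \<noteq> v (\<sigma> y)) \<and> (\<forall>y<N. \<forall>y'<N. y \<noteq> y' \<longrightarrow> {w y', v (\<sigma> y')} \<noteq> {w y, v (\<sigma> y)})"
      by blast
  qed
  ultimately have main: "exp (- 4 * (\<Sum>e\<in>?C. hit_prob N e)) * fact N \<le> real (card {\<sigma>. \<sigma> permutes {..<N} \<and>
     (\<forall>y<N. w y \<noteq> v (\<sigma> y)) \<and> (\<forall>y<N. \<forall>y'<N. y \<noteq> y' \<longrightarrow> {w y', v (\<sigma> y')} \<noteq> {w y, v (\<sigma> y)})})"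
    by (simp only: card_permutations[OF refl] card_lessThan finite_lessThan of_nat_fact)
      (erule order_trans, intro of_nat_mono card_mono, simp_all add: finite_permutations)
  have "(\<Sum>e\<in>?C. hit_prob N e) = (\<Sum>y<N. \<Sum>f\<in>{e\<in>?C. fst e = y}. hit_prob N f)"
    by (rule sum.group[symmetric, OF finC]) (auto simp: clashes_def consistent_def)
  also have "\<dots> = (\<Sum>z<N. \<Sum>f\<in>{(y, x, y', x') \<in> ?C. y = z}. hit_prob N f)"
    by (intro sum.cong) auto
  also have "\<dots> \<le> (\<Sum>z<N. 5 * real (a * b) / real N)" by (intro sum_mono deg(1))
  also have "\<dots> = 5 * real (a * b)" using N2 by simp
  finally have "exp (- 20 * real (a * b)) \<le> exp (- 4 * (\<Sum>e\<in>?C. hit_prob N e))" by simp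
  then have "exp (- 20 * real (a * b)) * fact N \<le> exp (- 4 * (\<Sum>e\<in>?C. hit_prob N e)) * fact N"
    by (rule mult_right_mono) simp
  with main show ?thesis by linarith
qed

section \<open>Simple matchings of words\<close>

definition edge :: "'v \<times> 'v \<Rightarrow> 'v set" where
  "edge p = {fst p, snd p}"

definition simple_links :: "('v \<times> 'v) list \<Rightarrow> bool" where
  "simple_links ps \<longleftrightarrow> (\<forall>p\<in>set ps. fst p \<noteq> snd p) \<and> distinct (map edge ps)"

text \<open>The fibres of \<open>\<sigma> \<mapsto> permute_list \<sigma> xs0\<close> are cosets of
  the stabiliser of \<open>xs0\<close>, hence of equal size. The factor \<open>k\<close> is chosen
  before \<open>P\<close>, so that proportions carry over from permutations to words.\<close>

lemma card_permutations_by_word: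
  fixes xs0 :: "'v list"
  shows "\<exists>k. \<forall>P. card {\<sigma>. \<sigma> permutes {..<length xs0} \<and> P (permute_list \<sigma> xs0)} =
     k * card {xs \<in> permutations_of_multiset (mset xs0). P xs}"
proof -
  let ?n = "length xs0"
  let ?fib = "\<lambda>xs. {\<sigma>. \<sigma> permutes {..<?n} \<and> permute_list \<sigma> xs0 = xs}"
  have fib: "card (?fib xs) = card (?fib xs0)" if xs: "xs \<in> permutations_of_multiset (mset xs0)" for xs
  proof -
    have "mset xs = mset xs0" using xs by (simp add: permutations_of_multiset_def)
    then obtain t where t: "t permutes {..<?n}" "permute_list t xs0 = xs"
      by (rule mset_eq_permutation)
    have invt: "inv t permutes {..<?n}" using t by (simp add: permutes_inv)
    have undo: "permute_list (inv t) xs = xs0"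
      using permute_list_compose[OF invt, of t] t permutes_inv_o[OF t(1)] by simp
    have tt: "\<rho> \<circ> t \<circ> inv t = \<rho>" "\<rho> \<circ> inv t \<circ> t = \<rho>" for \<rho> :: "nat \<Rightarrow> nat"
      by (simp_all only: o_assoc[symmetric] permutes_inv_o[OF t(1)] o_id)
    have "bij_betw (\<lambda>\<rho>. \<rho> \<circ> t) (?fib xs0) (?fib xs)"
    proof (rule bij_betw_byWitness[where f' = "\<lambda>\<rho>. \<rho> \<circ> inv t"])
      show "(\<lambda>\<rho>. \<rho> \<circ> t) ` ?fib xs0 \<subseteq> ?fib xs"
        using t(2) permute_list_compose[OF t(1)] permutes_compose[OF t(1)] by auto
      show "(\<lambda>\<rho>. \<rho> \<circ> inv t) ` ?fib xs \<subseteq> ?fib xs0"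
        using undo permute_list_compose[OF invt] permutes_compose[OF invt] by auto
    qed (simp_all only: tt, simp_all)
    then show ?thesis by (simp add: bij_betw_same_card)
  qed
  have "card {\<sigma>. \<sigma> permutes {..<?n} \<and> P (permute_list \<sigma> xs0)} =
     card (?fib xs0) * card {xs \<in> permutations_of_multiset (mset xs0). P xs}" for P
  proof -
    let ?S = "{\<sigma>. \<sigma> permutes {..<?n} \<and> P (permute_list \<sigma> xs0)}"
    let ?T = "{xs \<in> permutations_of_multiset (mset xs0). P xs}"
    have finS: "finite ?S" using finite_permutations[of "{..<?n}"] by simp
    have "card ?S = (\<Sum>xs\<in>?T. card {\<sigma>\<in>?S. permute_list \<sigma> xs0 = xs})"
      unfolding card_eq_sum
      by (rule sum.group[symmetric, OF finS])
        (auto simp: permutations_of_multisetI)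
    also have "\<dots> = (\<Sum>xs\<in>?T. card (?fib xs))"
      by (intro sum.cong arg_cong[where f = card]) auto
    also have "\<dots> = (\<Sum>xs\<in>?T. card (?fib xs0))" by (intro sum.cong fib) auto
    finally show ?thesis by simp
  qed
  then show ?thesis by blast
qed

lemma card_index_eq_count: "card {i\<in>{..<length xs}. xs ! i = u} = count (mset xs) u"
  by (simp add: count_mset count_list_eq_length_filter length_filter_conv_card eq_commute[of u])

lemma simple_links_zip:
  assumes "length ws = N" "length xs = N"
  shows "simple_links (zip ws xs) \<longleftrightarrow> (\<forall>y<N. ws ! y \<noteq> xs ! y) \<and>
    (\<forall>y<N. \<forall>y'<N. y \<noteq> y' \<longrightarrow> {ws ! y', xs ! y'} \<noteq> {ws ! y, xs ! y})"
proof -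
  have 1: "(\<forall>p\<in>set (zip ws xs). fst p \<noteq> snd p) \<longleftrightarrow> (\<forall>y<N. ws ! y \<noteq> xs ! y)"
    using assms by (simp add: all_set_conv_all_nth)
  have 2: "distinct (map edge (zip ws xs)) \<longleftrightarrow>
      (\<forall>y<N. \<forall>y'<N. y \<noteq> y' \<longrightarrow> {ws ! y', xs ! y'} \<noteq> {ws ! y, xs ! y})"
  proof -
    have "(\<forall>y<N. \<forall>y'<N. y \<noteq> y' \<longrightarrow> P y \<noteq> P y') = (\<forall>y<N. \<forall>y'<N. y \<noteq> y' \<longrightarrow> P y' \<noteq> P y)"
      for P :: "nat \<Rightarrow> 'a set" by metis
    note sym = this
    have nth: "map edge (zip ws xs) ! y = {ws ! y, xs ! y}" if "y < N" for y
      using that assms by (simp add: edge_def)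
    have "distinct (map edge (zip ws xs)) \<longleftrightarrow>
        (\<forall>y<N. \<forall>y'<N. y \<noteq> y' \<longrightarrow> map edge (zip ws xs) ! y \<noteq> map edge (zip ws xs) ! y')"
      unfolding distinct_conv_nth length_map length_zip assms min.idem ..
    also note sym
    finally show ?thesis by (simp only: nth cong: imp_cong)
  qed
  show ?thesis unfolding simple_links_def 1 2 ..
qed

text \<open>A uniform permutation of one fixed ordering of \<open>Mh\<close> induces the uniform
  word, so the proportion of simple matchings is the same for both.\<close>

lemma card_simple_words:
  fixes ws :: "'v list" and Mh :: "'v multiset"
  assumes size: "size Mh = length ws" and a: "\<And>u. count Mh u \<le> a" and b: "\<And>u. count (mset ws) u \<le> b"
    and N: "160 * (a * b) \<le> length ws"
  shows "exp (- 20 * real (a * b)) * real (card (permutations_of_multiset Mh)) \<le>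
    real (card {xs \<in> permutations_of_multiset Mh. simple_links (zip ws xs)})"
proof -
  obtain xs0 where xs0: "mset xs0 = Mh" using ex_mset by blast
  define N where "N = length ws"
  have len: "length xs0 = N" using size xs0 by (metis N_def size_mset)
  obtain k where k: "\<And>P. card {\<sigma>. \<sigma> permutes {..<N} \<and> P (permute_list \<sigma> xs0)} =
     k * card {xs \<in> permutations_of_multiset Mh. P xs}"
    using card_permutations_by_word[of xs0] unfolding xs0 len by blast
  have k1: "fact N = k * card (permutations_of_multiset Mh)"
    using k[of "\<lambda>_. True"] card_permutations[of "{..<N}" N] by simp
  then have kpos: "real k > 0" by (metis fact_nonzero mult_is_0 of_nat_0_less_iff neq0_conv)
  let ?S = "{\<sigma>. \<sigma> permutes {..<N} \<and> (\<forall>y<N. ws ! y \<noteq> xs0 ! \<sigma> y) \<and>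
     (\<forall>y<N. \<forall>y'<N. y \<noteq> y' \<longrightarrow> {ws ! y', xs0 ! \<sigma> y'} \<noteq> {ws ! y, xs0 ! \<sigma> y})}"
  have "exp (- 20 * real (a * b)) * fact N \<le> real (card ?S)"
  proof (rule card_simple_permutations)
    show "card {x \<in> {..<N}. xs0 ! x = u} \<le> a" for u
      using a[of u] card_index_eq_count[of xs0 u] unfolding len xs0 by linarith
    show "card {y \<in> {..<N}. ws ! y = u} \<le> b" for u
      using b[of u] card_index_eq_count[of ws u] unfolding N_def by linarith
  qed (use N in \<open>simp add: N_def\<close>)
  also have "?S = {\<sigma>. \<sigma> permutes {..<N} \<and> simple_links (zip ws (permute_list \<sigma> xs0))}"
  proof (rule Collect_cong, rule conj_cong[OF refl])
    fix \<sigma> assume "\<sigma> permutes {..<N}"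
    then have nth: "permute_list \<sigma> xs0 ! y = xs0 ! \<sigma> y" if "y < N" for y
      using that by (simp add: permute_list_nth len)
    show "((\<forall>y<N. ws ! y \<noteq> xs0 ! \<sigma> y) \<and>
       (\<forall>y<N. \<forall>y'<N. y \<noteq> y' \<longrightarrow> {ws ! y', xs0 ! \<sigma> y'} \<noteq> {ws ! y, xs0 ! \<sigma> y})) =
      simple_links (zip ws (permute_list \<sigma> xs0))"
      using len by (subst simple_links_zip[of _ N]) (simp_all add: N_def[symmetric] nth)
  qed
  also have "card \<dots> = k * card {xs \<in> permutations_of_multiset Mh. simple_links (zip ws xs)}"
    by (rule k)
  finally have "exp (- 20 * real (a * b)) * fact N
      \<le> real k * real (card {xs \<in> permutations_of_multiset Mh. simple_links (zip ws xs)})" by simp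
  moreover have "(fact N :: real) = real k * real (card (permutations_of_multiset Mh))"
    using arg_cong[OF k1, of real] by simp
  ultimately have "real k * (exp (- 20 * real (a * b)) * real (card (permutations_of_multiset Mh)))
      \<le> real k * real (card {xs \<in> permutations_of_multiset Mh. simple_links (zip ws xs)})"
    by (simp only: mult.left_commute)
  then show ?thesis using kpos by simp
qed

section \<open>Graphs encoded by words of half-links\<close>

text \<open>The links that touch \<open>A\<close>; links inside \<open>B\<close> are excluded. One
  count over these serves three situations: \<open>B\<close> empty for a single layer, equal degree
  totals for two layers, and \<open>B\<close> the set of nodes of large degree whose mutual links
  are frozen.\<close>

definition links :: "'v set \<Rightarrow> 'v set \<Rightarrow> 'v set set" where
  "links A B = {{x, y} | x y. x \<in> A \<union> B \<and> y \<in> A \<and> x \<noteq> y}"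

definition realisations :: "'v set \<Rightarrow> 'v set \<Rightarrow> ('v \<Rightarrow> nat) \<Rightarrow> 'v set set set" where
  "realisations A B d = {G. G \<subseteq> links A B \<and> (\<forall>i\<in>A \<union> B. card {g\<in>G. i \<in> g} = d i)}"

definition degree_mset :: "'v set \<Rightarrow> ('v \<Rightarrow> nat) \<Rightarrow> 'v multiset" where
  "degree_mset A d = (\<Sum>i\<in>A. replicate_mset (d i) i)"

lemma count_degree_mset: "finite A \<Longrightarrow> count (degree_mset A d) i = (if i \<in> A then d i else 0)"
  by (simp add: degree_mset_def count_sum)

lemma size_degree_mset: "size (degree_mset A d) = (\<Sum>i\<in>A. d i)"
  by (induction A rule: infinite_finite_induct) (simp_all add: degree_mset_def)

lemma card_words_degree_mset:
  assumes "finite A"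
  shows "card (permutations_of_multiset (degree_mset A d)) * (\<Prod>i\<in>A. fact (d i)) = (fact (\<Sum>i\<in>A. d i) :: nat)"
proof -
  let ?M = "degree_mset A d"
  have sub: "set_mset ?M \<subseteq> A"
    using assms by (auto simp: count_degree_mset set_mset_def split: if_splits)
  have "(\<Prod>x\<in>set_mset ?M. fact (count ?M x) :: nat) = (\<Prod>i\<in>A. fact (count ?M i))"
    by (rule prod.mono_neutral_left[OF assms sub]) (auto simp: not_in_iff)
  then show ?thesis
    using card_permutations_of_multiset_aux[of ?M] assms
    by (simp add: count_degree_mset size_degree_mset)
qed

lemma simple_links_degree:
  assumes "simple_links ps"
  shows "card {g \<in> edge ` set ps. i \<in> g} = count (mset (map fst ps)) i + count (mset (map snd ps)) i"
  using assms
proof (induction ps)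
  case (Cons p ps)
  have fin: "finite {g \<in> edge ` set ps. i \<in> g}" by simp
  have s: "simple_links ps" "edge p \<notin> edge ` set ps" "fst p \<noteq> snd p"
    using Cons.prems by (auto simp: simple_links_def)
  have "{g \<in> edge ` set (p # ps). i \<in> g} =
     (if i \<in> edge p then insert (edge p) {g \<in> edge ` set ps. i \<in> g} else {g \<in> edge ` set ps. i \<in> g})" by auto
  moreover have "card (insert (edge p) {g \<in> edge ` set ps. i \<in> g}) = Suc (card {g \<in> edge ` set ps. i \<in> g})"
    using s(2) fin by (intro card_insert_disjoint) auto
  ultimately have "card {g \<in> edge ` set (p # ps). i \<in> g} =
      card {g \<in> edge ` set ps. i \<in> g} + of_bool (i \<in> edge p)" by (simp only: split: if_split) simp
  then show ?case using Cons.IH[OF s(1)] s(3)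
    by (cases "fst p = i"; cases "snd p = i") (simp_all add: edge_def)
qed simp

lemma card_oriented_lists:
  assumes "\<And>g. g \<in> set es \<Longrightarrow> card {p\<in>R. edge p = g} = c" "finite R"
  shows "card {ps. set ps \<subseteq> R \<and> map edge ps = es} = c ^ length es"
  using assms(1)
proof (induction es)
  case (Cons g es)
  have "{ps. set ps \<subseteq> R \<and> map edge ps = g # es} =
     (\<lambda>(p, ps). p # ps) ` ({p\<in>R. edge p = g} \<times> {ps. set ps \<subseteq> R \<and> map edge ps = es})"
  proof (rule set_eqI)
    fix qs show "(qs \<in> {ps. set ps \<subseteq> R \<and> map edge ps = g # es}) = (qs \<in>
       (\<lambda>(p, ps). p # ps) ` ({p\<in>R. edge p = g} \<times> {ps. set ps \<subseteq> R \<and> map edge ps = es}))"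
      by (cases qs) auto
  qed
  moreover have "inj_on (\<lambda>(p, ps). p # ps) X" for X :: "(('a \<times> 'a) \<times> ('a \<times> 'a) list) set"
    by (auto simp: inj_on_def)
  ultimately show ?case using Cons by (simp add: card_image card_cartesian_product)
next
  case Nil
  have "{ps. set ps \<subseteq> R \<and> map edge ps = []} = {[]}" by auto
  then show ?case by simp
qed

text \<open>\<open>c\<close> will be 2 for links inside \<open>A\<close>, which can be oriented both
  ways, and 1 for links between \<open>B\<close> and \<open>A\<close>, whose orientation is
  forced.\<close>

lemma card_oriented_orderings:
  assumes E: "finite E" and R: "finite R" and c: "\<And>g. g \<in> E \<Longrightarrow> card {p\<in>R. edge p = g} = c"
  shows "card {ps. set ps \<subseteq> R \<and> map edge ps \<in> permutations_of_set E} = fact (card E) * c ^ card E"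
proof -
  let ?f = "\<lambda>es. {ps. set ps \<subseteq> R \<and> map edge ps = es}"
  have fin: "finite (?f es)" for es
    by (rule finite_subset[OF _ finite_lists_length_eq[OF R, of "length es"]]) auto
  have "{ps. set ps \<subseteq> R \<and> map edge ps \<in> permutations_of_set E} = (\<Union>es\<in>permutations_of_set E. ?f es)" by auto
  also have "card \<dots> = (\<Sum>es\<in>permutations_of_set E. card (?f es))"
    by (rule card_UN_disjoint) (use fin in auto)
  also have "\<dots> = (\<Sum>es\<in>permutations_of_set E. c ^ card E)"
  proof (rule sum.cong[OF refl])
    fix es assume "es \<in> permutations_of_set E"
    then have "set es = E" "length es = card E"
      by (simp_all add: permutations_of_setD length_finite_permutations_of_set)
    then show "card (?f es) = c ^ card E" using card_oriented_lists[of es R c] c R by simp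
  qed
  finally show ?thesis using E by simp
qed

section \<open>Counting graphs with given degrees\<close>

context
  fixes A B :: "'v set" and d :: "'v \<Rightarrow> nat" and e :: nat
  assumes finA: "finite A" and finB: "finite B" and disj: "A \<inter> B = {}"
    and total: "(\<Sum>i\<in>A. d i) = 2 * e + (\<Sum>i\<in>B. d i)"
begin

text \<open>A pair \<open>(ps, qs)\<close> lists the links inside \<open>A\<close>, each with an orientation, and the links between
  \<open>B\<close> and \<open>A\<close>.\<close>

definition listings :: "(('v \<times> 'v) list \<times> ('v \<times> 'v) list) set" where
  "listings = {(ps, qs). simple_links (ps @ qs) \<and>
     mset (map fst ps @ map snd ps @ map snd qs) = degree_mset A d \<and> mset (map fst qs) = degree_mset B d}"

lemma listings_props:
  assumes "(ps, qs) \<in> listings"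
  shows "length ps = e" "length qs = (\<Sum>i\<in>B. d i)" "set ps \<subseteq> A \<times> A" "set qs \<subseteq> B \<times> A"
proof -
  have 1: "mset (map fst ps @ map snd ps @ map snd qs) = degree_mset A d"
    and 2: "mset (map fst qs) = degree_mset B d" using assms by (auto simp: listings_def)
  show q: "length qs = (\<Sum>i\<in>B. d i)"
    using arg_cong[OF 2, of size] by (simp add: size_degree_mset)
  show "length ps = e"
    using arg_cong[OF 1, of size] total q by (simp add: size_degree_mset)
  have "set_mset (degree_mset A d) \<subseteq> A" "set_mset (degree_mset B d) \<subseteq> B"
    using finA finB by (auto simp: count_degree_mset set_mset_def split: if_splits)
  moreover have "set (map fst ps @ map snd ps @ map snd qs) = set_mset (degree_mset A d)"
    "set (map fst qs) = set_mset (degree_mset B d)"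
    using 1 2 by (metis set_mset_mset)+
  ultimately have "set (map fst ps @ map snd ps @ map snd qs) \<subseteq> A" "set (map fst qs) \<subseteq> B" by simp_all
  then show "set ps \<subseteq> A \<times> A" "set qs \<subseteq> B \<times> A" by force+
qed

lemma listings_subset:
  "listings \<subseteq> {ps. set ps \<subseteq> A \<times> A \<and> length ps = e} \<times> {qs. set qs \<subseteq> B \<times> A \<and> length qs = (\<Sum>i\<in>B. d i)}"
proof
  fix r assume r: "r \<in> listings"
  obtain ps qs where "r = (ps, qs)" by (cases r)
  with r listings_props[of ps qs] show "r \<in> {ps. set ps \<subseteq> A \<times> A \<and> length ps = e} \<times>
      {qs. set qs \<subseteq> B \<times> A \<and> length qs = (\<Sum>i\<in>B. d i)}" by blast
qed

lemma finite_listings: "finite listings"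
  by (rule finite_subset[OF listings_subset]) (intro finite_cartesian_product finite_lists_length_eq finA finB)

lemma finite_links: "finite (links A B)"
proof -
  have "links A B \<subseteq> Pow (A \<union> B)" by (auto simp: links_def)
  then show ?thesis using finA finB by (meson finite_Pow_iff finite_UnI finite_subset)
qed

lemma links_of_listing:
  assumes "(ps, qs) \<in> listings"
  shows "edge ` set (ps @ qs) \<in> realisations A B d"
proof -
  note pr = listings_props[OF assms]
  have s: "simple_links (ps @ qs)" and 1: "mset (map fst ps @ map snd ps @ map snd qs) = degree_mset A d"
    and 2: "mset (map fst qs) = degree_mset B d" using assms by (auto simp: listings_def)
  have "edge ` set (ps @ qs) \<subseteq> links A B"
  proof clarify
    fix x y assume xy: "(x, y) \<in> set (ps @ qs)"
    then have "x \<noteq> y" using s unfolding simple_links_def by fastforce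
    moreover have "x \<in> A \<union> B" "y \<in> A" using xy pr(3,4) by auto
    ultimately show "edge (x, y) \<in> links A B" by (auto simp: links_def edge_def)
  qed
  moreover have "card {g \<in> edge ` set (ps @ qs). i \<in> g} = d i" if "i \<in> A \<union> B" for i
  proof -
    have "card {g \<in> edge ` set (ps @ qs). i \<in> g} =
       count (mset (map fst ps @ map snd ps @ map snd qs)) i + count (mset (map fst qs)) i"
      using simple_links_degree[OF s, of i] by simp
    also have "\<dots> = d i" unfolding 1 2 using that disj finA finB by (auto simp: count_degree_mset)
    finally show ?thesis .
  qed
  ultimately show ?thesis by (simp add: realisations_def)
qed

text \<open>The listings of a fixed graph order and orient its inner links, and order its crossing
  links, independently. The count does not depend on the graph, so counting graphs is the same as
  counting listings.\<close>

lemma card_listings_of_graph: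
  assumes G: "G \<in> realisations A B d"
  shows "card {(ps, qs) \<in> listings. edge ` set (ps @ qs) = G} = fact e * 2 ^ e * fact (\<Sum>i\<in>B. d i)"
    and card_inner_links: "card (G \<inter> Pow A) = e"
proof -
  define X where "X = {ps. set ps \<subseteq> A \<times> A \<and> map edge ps \<in> permutations_of_set (G \<inter> Pow A)}"
  define Y where "Y = {qs. set qs \<subseteq> B \<times> A \<and> map edge qs \<in> permutations_of_set (G - Pow A)}"
  have GL: "G \<subseteq> links A B" using G by (simp add: realisations_def)
  have finG: "finite G" using GL finite_links finite_subset by blast
  have eq: "{(ps, qs) \<in> listings. edge ` set (ps @ qs) = G} = X \<times> Y"
  proof (intro equalityI subrelI)
    fix ps qs assume "(ps, qs) \<in> {(ps, qs) \<in> listings. edge ` set (ps @ qs) = G}"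
    then have L: "(ps, qs) \<in> listings" and im: "G = edge ` set (ps @ qs)" by auto
    note pr = listings_props[OF L]
    have dist: "distinct (map edge ps)" "distinct (map edge qs)"
      using L by (auto simp: listings_def simple_links_def)
    have pA: "edge ` set ps \<subseteq> Pow A" using pr(3) by (auto simp: edge_def)
    have qA: "edge ` set qs \<inter> Pow A = {}" using pr(4) disj by (auto simp: edge_def)
    have "edge ` set (ps @ qs) \<inter> Pow A = edge ` set ps" "edge ` set (ps @ qs) - Pow A = edge ` set qs"
      using pA qA by auto
    then show "(ps, qs) \<in> X \<times> Y"
      using pr(3,4) dist by (auto simp: X_def Y_def im permutations_of_set_def)
  next
    fix ps qs assume "(ps, qs) \<in> X \<times> Y"
    then have pq: "set ps \<subseteq> A \<times> A" "set qs \<subseteq> B \<times> A" "edge ` set ps = G \<inter> Pow A" "edge ` set qs = G - Pow A"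
      "distinct (map edge ps)" "distinct (map edge qs)"
      by (auto simp: X_def Y_def permutations_of_set_def)
    have im: "edge ` set (ps @ qs) = G" using pq(3,4) unfolding set_append image_Un by blast
    have s: "simple_links (ps @ qs)"
      unfolding simple_links_def
    proof
      show "\<forall>p\<in>set (ps @ qs). fst p \<noteq> snd p"
      proof clarify
        fix x y assume xy: "(x, y) \<in> set (ps @ qs)" "fst (x, y) = snd (x, y)"
        have "edge (x, y) \<in> G" using imageI[OF xy(1), of edge] unfolding im .
        then have "{x} \<in> G" using xy(2) by (simp add: edge_def)
        then show False using GL by (auto simp: links_def doubleton_eq_iff)
      qed
      show "distinct (map edge (ps @ qs))" using pq by auto
    qed
    have deg: "count (mset (map fst ps @ map snd ps @ map snd qs)) i + count (mset (map fst qs)) i = d i"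
      if "i \<in> A \<union> B" for i
      using simple_links_degree[OF s, of i] im G that by (simp add: realisations_def)
    have z1: "count (mset (map fst qs)) i = 0" if "i \<notin> B" for i
      using pq(2) that by (force simp: count_eq_zero_iff)
    have z2: "count (mset (map fst ps @ map snd ps @ map snd qs)) i = 0" if "i \<notin> A" for i
      using pq(1,2) that by (force simp: count_eq_zero_iff simp del: count_union)
    have "mset (map fst ps @ map snd ps @ map snd qs) = degree_mset A d"
    proof (rule multiset_eqI)
      fix i show "count (mset (map fst ps @ map snd ps @ map snd qs)) i = count (degree_mset A d) i"
        unfolding count_degree_mset[OF finA]
        using deg[of i] z1[of i] z2[of i] disj by (cases "i \<in> A"; cases "i \<in> B") (auto simp del: mset_append)
    qed
    moreover have "mset (map fst qs) = degree_mset B d"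
    proof (rule multiset_eqI)
      fix i show "count (mset (map fst qs)) i = count (degree_mset B d) i"
        unfolding count_degree_mset[OF finB]
        using deg[of i] z1[of i] z2[of i] disj by (cases "i \<in> A"; cases "i \<in> B") (auto simp del: mset_append)
    qed
    ultimately show "(ps, qs) \<in> {(ps, qs) \<in> listings. edge ` set (ps @ qs) = G}"
      using s im by (simp add: listings_def)
  qed
  have "card {p \<in> A \<times> A. edge p = g} = 2" if g: "g \<in> G \<inter> Pow A" for g
  proof -
    obtain x y where xy: "g = {x, y}" "x \<noteq> y" using g GL by (auto simp: links_def)
    then have "{p \<in> A \<times> A. edge p = g} = {(x, y), (y, x)}"
      using g by (auto simp: edge_def doubleton_eq_iff)
    then show ?thesis using xy by simp
  qed
  then have cX: "card X = fact (card (G \<inter> Pow A)) * 2 ^ card (G \<inter> Pow A)"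
    unfolding X_def using finG finA by (intro card_oriented_orderings) auto
  have "card {p \<in> B \<times> A. edge p = g} = 1" if g: "g \<in> G - Pow A" for g
  proof -
    obtain x y where "g = {x, y}" "x \<in> A \<union> B" "y \<in> A" using g GL unfolding links_def by blast
    then have xy: "g = {x, y}" "x \<in> B" "y \<in> A" using g by auto
    then have "{p \<in> B \<times> A. edge p = g} = {(x, y)}"
      using disj by (auto simp: edge_def doubleton_eq_iff)
    then show ?thesis by simp
  qed
  then have cY: "card Y = fact (card (G - Pow A)) * 1 ^ card (G - Pow A)"
    unfolding Y_def using finG finA finB by (intro card_oriented_orderings) auto
  \<comment> \<open>The computed cardinalities are positive, so \<open>G\<close> has at least one
    listing, and the lengths of its two parts give the numbers of inner and crossing links.\<close>
  have "X \<noteq> {}" "Y \<noteq> {}" using cX cY by (auto intro!: notI)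
  then obtain ps qs where pq: "ps \<in> X" "qs \<in> Y" by blast
  then have "(ps, qs) \<in> listings" using eq by blast
  note pr = listings_props[OF this]
  show inner: "card (G \<inter> Pow A) = e"
    using pq pr(1) by (auto simp: X_def dest!: length_finite_permutations_of_set)
  have "card (G - Pow A) = (\<Sum>i\<in>B. d i)"
    using pq pr(2) by (auto simp: Y_def dest!: length_finite_permutations_of_set)
  with inner show "card {(ps, qs) \<in> listings. edge ` set (ps @ qs) = G} = fact e * 2 ^ e * fact (\<Sum>i\<in>B. d i)"  unfolding eq card_cartesian_product cX cY by simp
qed

lemma card_listings:
  "card listings = card (realisations A B d) * (fact e * 2 ^ e * fact (\<Sum>i\<in>B. d i))"
proof -
  have finR: "finite (realisations A B d)"
    by (rule finite_subset[of _ "Pow (links A B)"]) (auto simp: realisations_def finite_links)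
  have "card listings = (\<Sum>G\<in>realisations A B d. card {r\<in>listings. (\<lambda>(ps, qs). edge ` set (ps @ qs)) r = G})"
    unfolding card_eq_sum
    by (rule sum.group[symmetric, OF finite_listings finR]) (use links_of_listing in auto)
  also have "\<dots> = (\<Sum>G\<in>realisations A B d. fact e * 2 ^ e * fact (\<Sum>i\<in>B. d i))"
  proof (rule sum.cong[OF refl])
    fix G assume "G \<in> realisations A B d"
    moreover have "{r\<in>listings. (\<lambda>(ps, qs). edge ` set (ps @ qs)) r = G} = {(ps, qs) \<in> listings. edge ` set (ps @ qs) = G}" by auto
    ultimately show "card {r\<in>listings. (\<lambda>(ps, qs). edge ` set (ps @ qs)) r = G} = fact e * 2 ^ e * fact (\<Sum>i\<in>B. d i)"
      using card_listings_of_graph by simp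
  qed
  finally show ?thesis by simp
qed

abbreviation "words \<equiv> card (permutations_of_multiset (degree_mset A d)) * card (permutations_of_multiset (degree_mset B d))"

text \<open>The two lengths are known, so a listing can be recovered from its words of half-links.
  The words that are missed are the matchings that are not simple.\<close>

lemma card_listings_le: "card listings \<le> words"
proof -
  let ?f = "\<lambda>(ps, qs). (map fst ps @ map snd ps @ map snd qs, map fst qs)"
  have inj: "inj_on ?f listings"
  proof (rule inj_onI, clarify)
    fix ps qs ps' qs' assume L: "(ps, qs) \<in> listings" "(ps', qs') \<in> listings"
      and eq: "map fst ps @ map snd ps @ map snd qs = map fst ps' @ map snd ps' @ map snd qs'" "map fst qs = map fst qs'"
    have "length ps = length ps'" using listings_props(1) L by simp
    then have "map fst ps = map fst ps'" "map snd ps = map snd ps'" "map snd qs = map snd qs'"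
      using eq by auto
    with eq(2) show "ps = ps' \<and> qs = qs'" by (metis zip_map_fst_snd)
  qed
  have "card listings = card (?f ` listings)" by (simp add: card_image[OF inj])
  also have "\<dots> \<le> card (permutations_of_multiset (degree_mset A d) \<times> permutations_of_multiset (degree_mset B d))"
    by (rule card_mono) (auto simp: listings_def intro!: permutations_of_multisetI)
  finally show ?thesis by (simp add: card_cartesian_product)
qed

text \<open>The first \<open>e\<close> letters of a word for \<open>A\<close> serve as tails of the
  inner links. Together with \<open>wB\<close> they are matched with the remaining letters. For a
  fixed prefix the remainder is a uniform word, to which \<open>card_simple_words\<close> applies.
  The matched words have length \<open>e\<close> plus the degree total of \<open>B\<close>, at least
  half the degree total of \<open>A\<close>; this is why 320 replaces 160.\<close>

lemma card_simple_words_split: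
  assumes wB: "mset wB = degree_mset B d" and a: "\<And>i. i \<in> A \<Longrightarrow> d i \<le> a" and m: "\<And>i. i \<in> A \<union> B \<Longrightarrow> d i \<le> m"
    and big: "320 * (a * m) \<le> (\<Sum>i\<in>A. d i)"
  shows "exp (- 20 * real (a * m)) * real (card (permutations_of_multiset (degree_mset A d))) \<le>
    real (card {z \<in> permutations_of_multiset (degree_mset A d). simple_links (zip (take e z @ wB) (drop e z))})"
proof -
  let ?W = "permutations_of_multiset (degree_mset A d)"
  let ?P = "\<lambda>z. simple_links (zip (take e z @ wB) (drop e z))"
  let ?TL = "take e ` ?W"
  have lenB: "length wB = (\<Sum>i\<in>B. d i)" using wB by (metis size_degree_mset size_mset)
  have lenW: "length z = 2 * e + length wB" if "z \<in> ?W" for z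
    using that total lenB by (metis permutations_of_multisetD size_degree_mset size_mset)
  have split: "card {z \<in> ?W. Q z} = (\<Sum>tl\<in>?TL. card {z \<in> ?W. Q z \<and> take e z = tl})" for Q
  proof -
    have "card {z \<in> ?W. Q z} = (\<Sum>tl\<in>?TL. card {z \<in> {z \<in> ?W. Q z}. take e z = tl})"
      unfolding card_eq_sum by (rule sum.group[symmetric]) auto
    then show ?thesis by (simp add: conj_assoc)
  qed
  have part: "card {z \<in> ?W. Q z \<and> take e z = tl} =
      card {hs \<in> permutations_of_multiset (degree_mset A d - mset tl). Q (tl @ hs)}"
    if tl: "tl \<in> ?TL" for tl Q
  proof -
    obtain z0 where z0: "z0 \<in> ?W" "tl = take e z0" using tl by blast
    have ltl: "length tl = e" using z0 lenW by simp
    have sub: "mset tl \<subseteq># degree_mset A d"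
      using z0 by (metis append_take_drop_id mset_append mset_subset_eq_add_left permutations_of_multisetD)
    have "{z \<in> ?W. Q z \<and> take e z = tl} = (@) tl ` {hs \<in> permutations_of_multiset (degree_mset A d - mset tl). Q (tl @ hs)}"
    proof (intro equalityI subsetI)
      fix z assume "z \<in> {z \<in> ?W. Q z \<and> take e z = tl}"
      then have z: "z \<in> ?W" "Q z" "tl = take e z" by auto
      have "mset (drop e z) = degree_mset A d - mset (take e z)"
        using z(1) by (metis add_diff_cancel_left' append_take_drop_id mset_append permutations_of_multisetD)
      then show "z \<in> (@) tl ` {hs \<in> permutations_of_multiset (degree_mset A d - mset tl). Q (tl @ hs)}"
        using z by (intro image_eqI[of _ _ "drop e z"]) (auto simp: permutations_of_multiset_def)
    next
      fix z assume "z \<in> (@) tl ` {hs \<in> permutations_of_multiset (degree_mset A d - mset tl). Q (tl @ hs)}"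
      then obtain hs where hs: "hs \<in> permutations_of_multiset (degree_mset A d - mset tl)" "Q (tl @ hs)"
        and zh: "z = tl @ hs" by blast
      then have "mset (tl @ hs) = degree_mset A d" using sub by (simp add: permutations_of_multiset_def)
      then show "z \<in> {z \<in> ?W. Q z \<and> take e z = tl}" using hs(2) ltl by (simp add: permutations_of_multiset_def zh)
    qed
    then show ?thesis by (simp add: card_image inj_on_def)
  qed
  have "exp (- 20 * real (a * m)) * real (card ?W) =
      (\<Sum>tl\<in>?TL. exp (- 20 * real (a * m)) * real (card (permutations_of_multiset (degree_mset A d - mset tl))))"
    using split[of "\<lambda>_. True"] part[of _ "\<lambda>_. True"] by (simp add: sum_distrib_left)
  also have "\<dots> \<le> (\<Sum>tl\<in>?TL. real (card {z \<in> ?W. ?P z \<and> take e z = tl}))"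
  proof (rule sum_mono)
    fix tl assume tl: "tl \<in> ?TL"
    obtain z0 where z0: "z0 \<in> ?W" "tl = take e z0" using tl by blast
    have ltl: "length tl = e" using z0 lenW by simp
    have sub: "mset tl \<subseteq># degree_mset A d"
      using z0 by (metis append_take_drop_id mset_append mset_subset_eq_add_left permutations_of_multisetD)
    have "exp (- 20 * real (a * m)) * real (card (permutations_of_multiset (degree_mset A d - mset tl))) \<le>
      real (card {xs \<in> permutations_of_multiset (degree_mset A d - mset tl). simple_links (zip (tl @ wB) xs)})"
    proof (rule card_simple_words)
      show "size (degree_mset A d - mset tl) = length (tl @ wB)"
        using sub ltl total lenB by (simp add: size_Diff_submset size_degree_mset)
      \<comment> \<open>The remaining letters come from \<open>A\<close> only, hence the bound
        \<open>a\<close>; the other side mixes letters from \<open>A\<close> and \<open>B\<close>,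
        hence the bound \<open>m\<close>.\<close>
      show "count (degree_mset A d - mset tl) u \<le> a" for u
        using a[of u] finA by (auto simp: count_degree_mset)
      show "count (mset (tl @ wB)) u \<le> m" for u
      proof -
        have "count (mset tl) u \<le> count (degree_mset A d) u" using sub by (rule mset_subset_eq_count)
        then have "count (mset (tl @ wB)) u \<le> count (degree_mset A d) u + count (degree_mset B d) u"
          unfolding mset_append wB by simp
        also have "\<dots> \<le> m" using m[of u] disj finA finB by (auto simp: count_degree_mset)
        finally show ?thesis .
      qed
      show "160 * (a * m) \<le> length (tl @ wB)" using big ltl lenB total by simp
    qed
    then show "exp (- 20 * real (a * m)) * real (card (permutations_of_multiset (degree_mset A d - mset tl))) \<le>
        real (card {z \<in> ?W. ?P z \<and> take e z = tl})"
      unfolding part[OF tl] using ltl by simp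
  qed
  also have "\<dots> = real (card {z \<in> ?W. ?P z})" unfolding split[of ?P] by simp
  finally show ?thesis .
qed

lemma card_listings_ge:
  assumes a: "\<And>i. i \<in> A \<Longrightarrow> d i \<le> a" and m: "\<And>i. i \<in> A \<union> B \<Longrightarrow> d i \<le> m"
    and big: "320 * (a * m) \<le> (\<Sum>i\<in>A. d i)"
  shows "exp (- 20 * real (a * m)) * real words \<le> real (card listings)"
proof -
  let ?WA = "permutations_of_multiset (degree_mset A d)" and ?WB = "permutations_of_multiset (degree_mset B d)"
  define S where "S = (SIGMA wB:?WB. {z \<in> ?WA. simple_links (zip (take e z @ wB) (drop e z))})"
  let ?f = "\<lambda>(wB, z). (zip (take e z) (take e (drop e z)), zip wB (drop e (drop e z)))"
  have lenB: "length wB = (\<Sum>i\<in>B. d i)" if "wB \<in> ?WB" for wB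
    using that by (metis permutations_of_multisetD size_degree_mset size_mset)
  have lenW: "length z = 2 * e + (\<Sum>i\<in>B. d i)" if "z \<in> ?WA" for z
    using that total by (metis permutations_of_multisetD size_degree_mset size_mset)
  have maps: "map fst (zip (take e z) (take e (drop e z))) = take e z"
    "map snd (zip (take e z) (take e (drop e z))) = take e (drop e z)"
    "map fst (zip wB (drop e (drop e z))) = wB" "map snd (zip wB (drop e (drop e z))) = drop e (drop e z)"
    if "wB \<in> ?WB" "z \<in> ?WA" for wB z
    using lenB[OF that(1)] lenW[OF that(2)] by simp_all
  have inj: "inj_on ?f S"
  proof (rule inj_onI)
    fix r r' assume R: "r \<in> S" "r' \<in> S" and eq: "?f r = ?f r'"
    obtain wB z wB' z' where r: "r = (wB, z)" "r' = (wB', z')" by (cases r; cases r')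
    have mem: "wB \<in> ?WB" "z \<in> ?WA" "wB' \<in> ?WB" "z' \<in> ?WA" using R by (auto simp: S_def r)
    have eqs: "zip (take e z) (take e (drop e z)) = zip (take e z') (take e (drop e z'))"
       "zip wB (drop e (drop e z)) = zip wB' (drop e (drop e z'))" using eq by (simp_all add: r)
    have "take e z = take e z'" "take e (drop e z) = take e (drop e z')" "wB = wB'" "drop e (drop e z) = drop e (drop e z')"
      using maps[OF mem(1,2)] maps[OF mem(3,4)] eqs by metis+
    then show "r = r'" unfolding r by (metis append_take_drop_id)
  qed
  have im: "?f ` S \<subseteq> listings"
  proof
    fix x assume "x \<in> ?f ` S"
    then obtain wB z where mem: "wB \<in> ?WB" "z \<in> ?WA" and s: "simple_links (zip (take e z @ wB) (drop e z))"
      and x: "x = (zip (take e z) (take e (drop e z)), zip wB (drop e (drop e z)))" by (auto simp: S_def)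
    have "zip (take e z @ wB) (take e (drop e z) @ drop e (drop e z)) =
        zip (take e z) (take e (drop e z)) @ zip wB (drop e (drop e z))"
      using lenW[OF mem(2)] by (intro zip_append) simp
    then have "zip (take e z @ wB) (drop e z) = zip (take e z) (take e (drop e z)) @ zip wB (drop e (drop e z))"
      by (simp only: append_take_drop_id)
    moreover have "mset (take e z @ take e (drop e z) @ drop e (drop e z)) = degree_mset A d"
      using permutations_of_multisetD[OF mem(2)] by (metis append_take_drop_id)
    ultimately show "x \<in> listings"
      using s permutations_of_multisetD[OF mem(1)] unfolding x listings_def
      by (simp only: mem_Collect_eq case_prod_conv maps[OF mem])
  qed
  have "exp (- 20 * real (a * m)) * real words =
      (\<Sum>wB\<in>?WB. exp (- 20 * real (a * m)) * real (card ?WA))" by simp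
  also have "\<dots> \<le> (\<Sum>wB\<in>?WB. real (card {z \<in> ?WA. simple_links (zip (take e z @ wB) (drop e z))}))"
    by (intro sum_mono card_simple_words_split[OF permutations_of_multisetD a m big]) auto
  also have "\<dots> = real (card S)" by (simp add: S_def)
  also have "card S = card (?f ` S)" by (rule card_image[OF inj, symmetric])
  also have "real \<dots> \<le> real (card listings)" by (intro of_nat_mono card_mono finite_listings im)
  finally show ?thesis by simp
qed

lemma words_eq:
  "words * ((\<Prod>i\<in>A \<union> B. fact (d i)) :: nat) = fact (\<Sum>i\<in>A. d i) * fact (\<Sum>i\<in>B. d i)"
proof -
  have "words * ((\<Prod>i\<in>A \<union> B. fact (d i)) :: nat) =
      (card (permutations_of_multiset (degree_mset A d)) * (\<Prod>i\<in>A. fact (d i))) *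
      (card (permutations_of_multiset (degree_mset B d)) * (\<Prod>i\<in>B. fact (d i)))"
    unfolding prod.union_disjoint[OF finA finB disj] by (simp only: ac_simps)
  then show ?thesis unfolding card_words_degree_mset[OF finA] card_words_degree_mset[OF finB] .
qed

lemma card_realisations_upper:
  "card (realisations A B d) * (fact e * 2 ^ e * (\<Prod>i\<in>A \<union> B. fact (d i))) \<le> (fact (\<Sum>i\<in>A. d i) :: nat)"
proof -
  have "card (realisations A B d) * (fact e * 2 ^ e * (\<Prod>i\<in>A \<union> B. fact (d i))) * fact (\<Sum>i\<in>B. d i)
     = card listings * (\<Prod>i\<in>A \<union> B. fact (d i))" unfolding card_listings by (simp add: mult_ac)
  also have "\<dots> \<le> words * (\<Prod>i\<in>A \<union> B. fact (d i))" by (intro mult_right_mono card_listings_le) simp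
  also have "\<dots> = fact (\<Sum>i\<in>A. d i) * fact (\<Sum>i\<in>B. d i)" by (rule words_eq)
  finally show ?thesis by simp
qed

lemma card_realisations_lower:
  assumes a: "\<And>i. i \<in> A \<Longrightarrow> d i \<le> a" and m: "\<And>i. i \<in> A \<union> B \<Longrightarrow> d i \<le> m"
    and big: "320 * (a * m) \<le> (\<Sum>i\<in>A. d i)"
  shows "exp (- 20 * real (a * m)) * fact (\<Sum>i\<in>A. d i) \<le>
    real (card (realisations A B d)) * (fact e * 2 ^ e * (\<Prod>i\<in>A \<union> B. fact (d i)))"
proof -
  let ?F = "\<Prod>i\<in>A \<union> B. fact (d i) :: real"
  have w: "real words * ?F = fact (\<Sum>i\<in>A. d i) * fact (\<Sum>i\<in>B. d i)"
    using arg_cong[OF words_eq, of real] by simp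
  have "exp (- 20 * real (a * m)) * fact (\<Sum>i\<in>A. d i) * fact (\<Sum>i\<in>B. d i) = exp (- 20 * real (a * m)) * real words * ?F"
    using w by (simp add: mult_ac)
  also have "\<dots> \<le> real (card listings) * ?F"
    by (intro mult_right_mono card_listings_ge[OF a m big] prod_nonneg) auto
  also have "\<dots> = real (card (realisations A B d)) * (fact e * 2 ^ e * ?F) * fact (\<Sum>i\<in>B. d i)"
    unfolding card_listings by (simp add: mult_ac)
  finally show ?thesis by simp
qed

end

section \<open>Entropies of link probabilities\<close>

lemma gfun_eq: "gfun k = ln (fact k) - xlnx (real k) + real k"
proof (cases "k = 0")
  case False
  then have "ln (real k ^ k * exp (- real k)) = xlnx (real k) - real k"
    by (subst ln_mult_pos) (simp_all add: ln_realpow xlnx_def)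
  then show ?thesis using False by (simp add: gfun_def ln_div)
qed (simp add: gfun_def xlnx_def)

lemma gfun_0 [simp]: "gfun 0 = 0" and gfun_1 [simp]: "gfun (Suc 0) = 1"
  by (simp_all add: gfun_eq xlnx_def)

text \<open>The increment is \<open>1 - k * ln (1 + 1 / k)\<close>, and the three bounds come from
  \<open>ln (1 + 1 / k)\<close> being at most \<open>1 / k\<close>, at least 0 and at least
  \<open>1 / (k + 1)\<close>. The last one telescopes to logarithmic growth, which makes
  \<open>gfun\<close> of the number of links negligible.\<close>

lemma gfun_Suc_diff:
  assumes "k \<ge> 1"
  shows "gfun k \<le> gfun (Suc k)" "gfun (Suc k) \<le> gfun k + 1" "gfun (Suc k) \<le> gfun k + (ln (real (Suc k)) - ln (real k))"
proof -
  have k: "real k > 0" using assms by simp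
  have "ln (fact (Suc k) :: real) = ln (real (Suc k)) + ln (fact k)"
    by (simp add: ln_mult_pos del: of_nat_Suc)
  then have d: "gfun (Suc k) = gfun k + 1 - real k * (ln (real (Suc k)) - ln (real k))"
    by (simp add: gfun_eq xlnx_def algebra_simps)
  have "ln (real (Suc k)) - ln (real k) = ln (1 + 1 / real k)"
  proof -
    have "1 + 1 / real k = real (Suc k) / real k" using k by (simp add: field_simps)
    then show ?thesis using k by (simp only: ln_div) simp
  qed
  also have "\<dots> \<le> 1 / real k" using k by (intro ln_add_one_self_le_self) auto
  finally have up: "real k * (ln (real (Suc k)) - ln (real k)) \<le> 1" using k by (simp add: field_simps)
  have "ln (real k / real (Suc k)) \<le> real k / real (Suc k) - 1" using k by (intro ln_le_minus_one) auto
  then have "ln (real k) - ln (real (Suc k)) \<le> real k / real (Suc k) - 1" using k by (subst (asm) ln_div) auto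
  then have low: "1 \<le> real (Suc k) * (ln (real (Suc k)) - ln (real k))"
    using k by (simp add: field_simps)
  have "ln (real k) \<le> ln (real (Suc k))" using k by simp
  then have "0 \<le> real k * (ln (real (Suc k)) - ln (real k))" by simp
  then show "gfun k \<le> gfun (Suc k)" "gfun (Suc k) \<le> gfun k + 1" using d up by linarith+
  show "gfun (Suc k) \<le> gfun k + (ln (real (Suc k)) - ln (real k))"
    using d low by (simp add: algebra_simps)
qed

lemma gfun_bounds:
  shows gfun_nonneg: "0 \<le> gfun k" and gfun_le: "gfun k \<le> real k" and gfun_le_ln: "k \<ge> 1 \<Longrightarrow> gfun k \<le> 1 + ln (real k)"
proof -
  have "0 \<le> gfun (Suc k) \<and> gfun (Suc k) \<le> real (Suc k) \<and> gfun (Suc k) \<le> 1 + ln (real (Suc k))" for k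
  proof (induction k)
    case (Suc k)
    then show ?case using gfun_Suc_diff[of "Suc k"] by simp
  qed simp
  then show "0 \<le> gfun k" "gfun k \<le> real k" "k \<ge> 1 \<Longrightarrow> gfun k \<le> 1 + ln (real k)"
    by (cases k; fastforce)+
qed

lemma xlnx_0 [simp]: "xlnx 0 = 0" and xlnx_1 [simp]: "xlnx 1 = 0"
  by (simp_all add: xlnx_def)

text \<open>\<open>q\<close> is a free comparison value that may exceed 1. Choosing it as a constant
  times a product of degrees makes the sum of the right-hand sides depend on the degrees
  only.\<close>

lemma bernoulli_entropy_upper:
  assumes "0 \<le> p" "p \<le> 1" "0 \<le> q" "p > 0 \<Longrightarrow> q > 0"
  shows "bernoulli_entropy p \<le> - p * ln q + q"
proof -
  have 1: "- xlnx (1 - p) \<le> p"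
  proof (cases "p = 1")
    case False
    then have p: "1 - p > 0" using assms by simp
    then have "ln (1 / (1 - p)) \<le> 1 / (1 - p) - 1" by (intro ln_le_minus_one) auto
    then have "(1 - p) * - ln (1 - p) \<le> (1 - p) * (1 / (1 - p) - 1)"
      using p by (intro mult_left_mono) (auto simp: ln_div)
    then show ?thesis using p by (simp add: xlnx_def algebra_simps)
  qed simp
  have "- xlnx p + p \<le> - p * ln q + q"
  proof (cases "p = 0")
    case False
    then have p: "p > 0" "q > 0" using assms by auto
    then have "p * ln (q / p) \<le> p * (q / p - 1)" by (intro mult_left_mono ln_le_minus_one) auto
    then show ?thesis using p by (simp add: xlnx_def ln_div algebra_simps)
  qed (use assms in simp)
  with 1 show ?thesis by (simp add: bernoulli_entropy_def)
qed

text \<open>The converse up to the second-order term \<open>p ^ 2\<close>, which comes from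
  \<open>- xlnx (1 - p) \<ge> p - p ^ 2\<close>.\<close>

lemma bernoulli_entropy_lower:
  assumes "0 \<le> p" "p \<le> 1" "p \<le> q"
  shows "- p * ln q + p - p ^ 2 \<le> bernoulli_entropy p"
proof -
  have 1: "p - p ^ 2 \<le> - xlnx (1 - p)"
  proof (cases "p = 1")
    case False
    then have p: "1 - p > 0" using assms by simp
    then have "(1 - p) * ln (1 - p) \<le> (1 - p) * ((1 - p) - 1)" by (intro mult_left_mono ln_le_minus_one) auto
    then show ?thesis by (simp add: xlnx_def algebra_simps power2_eq_square)
  qed simp
  have "p * ln p \<le> p * ln q"
    using assms by (cases "p = 0") (auto intro!: mult_left_mono)
  with 1 show ?thesis by (simp add: bernoulli_entropy_def xlnx_def)
qed

section \<open>Feasible link probabilities and the entropy gap\<close>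

definition feasible_odds :: "'v set set \<Rightarrow> 'v set \<Rightarrow> ('v \<Rightarrow> nat) \<Rightarrow> ('v set \<Rightarrow> real) \<Rightarrow> bool" where
  "feasible_odds E V d p \<longleftrightarrow> (\<forall>g\<in>E. 0 \<le> p g \<and> p g \<le> 1) \<and>
     (\<forall>i\<in>V. (\<Sum>g\<in>E. p g * of_bool (i \<in> g)) = real (d i))"

definition graphs_with_degrees :: "'v set set \<Rightarrow> 'v set \<Rightarrow> ('v \<Rightarrow> nat) \<Rightarrow> 'v set set set" where
  "graphs_with_degrees E V d = {G. G \<subseteq> E \<and> (\<forall>i\<in>V. card {g\<in>G. i \<in> g} = d i)}"

abbreviation entropy_gap :: "'v set set \<Rightarrow> 'v set \<Rightarrow> ('v \<Rightarrow> nat) \<Rightarrow> ('v set \<Rightarrow> real) \<Rightarrow> real" where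
  "entropy_gap E V d p \<equiv> total_entropy E p - ln (real (card (graphs_with_degrees E V d)))"

text \<open>The upper half concerns all feasible \<open>p\<close> and the lower half a single one,
  so together they enclose the maximal gap without naming a maximiser. The existential half also
  allows the choices for different pairs of layers to be glued.\<close>

definition gap_within :: "'v set set \<Rightarrow> 'v set \<Rightarrow> ('v \<Rightarrow> nat) \<Rightarrow> real \<Rightarrow> bool" where
  "gap_within E V d \<epsilon> \<longleftrightarrow>
     (\<forall>p. feasible_odds E V d p \<longrightarrow> entropy_gap E V d p \<le> (\<Sum>i\<in>V. gfun (d i)) + \<epsilon>) \<and>
     (\<exists>p. feasible_odds E V d p \<and> (\<Sum>i\<in>V. gfun (d i)) - \<epsilon> \<le> entropy_gap E V d p)"

lemma gap_within_mono: "gap_within E V d \<epsilon> \<Longrightarrow> \<epsilon> \<le> \<epsilon>' \<Longrightarrow> gap_within E V d \<epsilon>'"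
  unfolding gap_within_def by (meson add_left_mono diff_left_mono order_trans)

locale degree_problem =
  fixes E :: "'v set set" and V :: "'v set" and d :: "'v \<Rightarrow> nat"
  assumes finV: "finite V" and pairs: "\<And>g. g \<in> E \<Longrightarrow> g \<subseteq> V \<and> card g = 2"
begin

lemma finE: "finite E"
  using finV pairs by (intro finite_subset[of E "Pow V"]) auto

lemma fin_link: "g \<in> E \<Longrightarrow> finite g"
  using pairs finV finite_subset by blast

lemma link_positive:
  assumes p: "feasible_odds E V d p" and g: "g \<in> E" "p g > 0" and i: "i \<in> g"
  shows "d i > 0"
proof -
  have "0 < (\<Sum>g\<in>E. p g * of_bool (i \<in> g))"
    using p g i by (intro sum_pos2[OF finE g(1)]) (auto simp: feasible_odds_def)
  moreover have "i \<in> V" using pairs[OF g(1)] i by auto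
  ultimately show ?thesis using p by (simp add: feasible_odds_def)
qed

lemma sum_over_ends:
  assumes "feasible_odds E V d p"
  shows "(\<Sum>g\<in>E. p g * (\<Sum>i\<in>g. F i)) = (\<Sum>i\<in>V. real (d i) * F i)"
proof -
  have "(\<Sum>g\<in>E. p g * (\<Sum>i\<in>g. F i)) = (\<Sum>g\<in>E. \<Sum>i\<in>V. p g * of_bool (i \<in> g) * F i)"
  proof (rule sum.cong[OF refl])
    fix g assume g: "g \<in> E"
    have "(\<Sum>i\<in>g. F i) = (\<Sum>i\<in>V. of_bool (i \<in> g) * F i)"
      by (rule sum.mono_neutral_cong_left) (use finV pairs[OF g] in auto)
    then show "p g * (\<Sum>i\<in>g. F i) = (\<Sum>i\<in>V. p g * of_bool (i \<in> g) * F i)"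
      by (simp add: sum_distrib_left mult.assoc)
  qed
  also have "\<dots> = (\<Sum>i\<in>V. \<Sum>g\<in>E. p g * of_bool (i \<in> g) * F i)" by (rule sum.swap)
  also have "\<dots> = (\<Sum>i\<in>V. real (d i) * F i)"
    unfolding sum_distrib_right[symmetric] using assms by (intro sum.cong) (auto simp: feasible_odds_def)
  finally show ?thesis .
qed

lemma sum_odds:
  assumes "feasible_odds E V d p"
  shows "2 * (\<Sum>g\<in>E. p g) = real (\<Sum>i\<in>V. d i)"
proof -
  have "(\<Sum>g\<in>E. p g * (\<Sum>i\<in>g. 1)) = (\<Sum>g\<in>E. p g * 2)"
    using pairs by (intro sum.cong) auto
  then show ?thesis using sum_over_ends[OF assms, of "\<lambda>_. 1"] by (simp add: sum_distrib_right[symmetric])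
qed

text \<open>The value is the same for every feasible \<open>p\<close>, which is why this reference
  is chosen. Links with an end of degree 0 have \<open>p g = 0\<close>, so \<open>ln 0\<close> never
  enters with a positive weight.\<close>

lemma sum_log_degrees:
  assumes p: "feasible_odds E V d p" and c: "c > 0"
  shows "(\<Sum>g\<in>E. p g * ln (c * (\<Prod>i\<in>g. real (d i)))) = ln c * (real (\<Sum>i\<in>V. d i) / 2) + (\<Sum>i\<in>V. xlnx (real (d i)))"
proof -
  have "p g * ln (c * (\<Prod>i\<in>g. real (d i))) = p g * ln c + p g * (\<Sum>i\<in>g. ln (real (d i)))" if g: "g \<in> E" for g
  proof (cases "p g = 0")
    case False
    then have "p g > 0" using p g by (force simp: feasible_odds_def)
    then have "d i > 0" if "i \<in> g" for i using link_positive[OF p g _ that] by simp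
    then have "ln (c * (\<Prod>i\<in>g. real (d i))) = ln c + (\<Sum>i\<in>g. ln (real (d i)))"
      using c fin_link[OF g] by (subst ln_mult_pos) (auto intro!: prod_pos simp: ln_prod)
    then show ?thesis by (simp add: distrib_left)
  qed simp
  then have "(\<Sum>g\<in>E. p g * ln (c * (\<Prod>i\<in>g. real (d i)))) = (\<Sum>g\<in>E. p g * ln c + p g * (\<Sum>i\<in>g. ln (real (d i))))"
    by (rule sum.cong[OF refl])
  also have "\<dots> = ln c * (\<Sum>g\<in>E. p g) + (\<Sum>i\<in>V. real (d i) * ln (real (d i)))"
    unfolding sum.distrib sum_over_ends[OF p] sum_distrib_right[symmetric] by (simp add: mult.commute)
  also have "(\<Sum>g\<in>E. p g) = real (\<Sum>i\<in>V. d i) / 2" using sum_odds[OF p] by linarith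
  finally show ?thesis by (simp add: xlnx_def)
qed

lemma entropy_upper:
  assumes p: "feasible_odds E V d p" and c: "c > 0"
  shows "total_entropy E p \<le>
    - ln c * (real (\<Sum>i\<in>V. d i) / 2) - (\<Sum>i\<in>V. xlnx (real (d i))) + c * (\<Sum>g\<in>E. \<Prod>i\<in>g. real (d i))"
proof -
  have "total_entropy E p \<le>
     (\<Sum>g\<in>E. - p g * ln (c * (\<Prod>i\<in>g. real (d i))) + c * (\<Prod>i\<in>g. real (d i)))"
  proof (intro sum_mono bernoulli_entropy_upper)
    fix g assume g: "g \<in> E"
    show "0 \<le> c * (\<Prod>i\<in>g. real (d i))" using c by (intro mult_nonneg_nonneg prod_nonneg) auto
    show "0 < c * (\<Prod>i\<in>g. real (d i))" if "0 < p g"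
      using c link_positive[OF p g that] by (intro mult_pos_pos prod_pos) auto
  qed (use p in \<open>auto simp: feasible_odds_def\<close>)
  also have "\<dots> = - (\<Sum>g\<in>E. p g * ln (c * (\<Prod>i\<in>g. real (d i)))) + c * (\<Sum>g\<in>E. \<Prod>i\<in>g. real (d i))"
    by (simp add: sum.distrib sum_negf sum_subtractf sum_distrib_left)
  finally show ?thesis unfolding sum_log_degrees[OF p c] by simp
qed

lemma entropy_lower:
  assumes p: "feasible_odds E V d p" and c: "c > 0" and le: "\<And>g. g \<in> E \<Longrightarrow> p g \<le> c * (\<Prod>i\<in>g. real (d i))"
  shows "- ln c * (real (\<Sum>i\<in>V. d i) / 2) - (\<Sum>i\<in>V. xlnx (real (d i))) + real (\<Sum>i\<in>V. d i) / 2
     - c ^ 2 * (\<Sum>g\<in>E. \<Prod>i\<in>g. real (d i) ^ 2) \<le> total_entropy E p"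
proof -
  have "- (\<Sum>g\<in>E. p g * ln (c * (\<Prod>i\<in>g. real (d i)))) + (\<Sum>g\<in>E. p g) - c ^ 2 * (\<Sum>g\<in>E. \<Prod>i\<in>g. real (d i) ^ 2)
     = (\<Sum>g\<in>E. - p g * ln (c * (\<Prod>i\<in>g. real (d i))) + p g - (c * (\<Prod>i\<in>g. real (d i))) ^ 2)"
    by (simp add: sum.distrib sum_negf sum_subtractf sum_distrib_left power_mult_distrib prod_power_distrib)
  also have "\<dots> \<le> total_entropy E p"
  proof (rule sum_mono)
    fix g assume g: "g \<in> E"
    have p01: "0 \<le> p g" "p g \<le> 1" using p g by (auto simp: feasible_odds_def)
    have "p g ^ 2 \<le> (c * (\<Prod>i\<in>g. real (d i))) ^ 2" using p01 le[OF g] by (intro power_mono) auto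
    with bernoulli_entropy_lower[OF p01 le[OF g]]
    show "- p g * ln (c * (\<Prod>i\<in>g. real (d i))) + p g - (c * (\<Prod>i\<in>g. real (d i))) ^ 2 \<le> bernoulli_entropy (p g)"
      by linarith
  qed
  finally show ?thesis using sum_odds[OF p] unfolding sum_log_degrees[OF p c] by simp
qed

lemma finite_graphs: "finite (graphs_with_degrees E V d)"
  by (rule finite_subset[of _ "Pow E"]) (auto simp: graphs_with_degrees_def finE)

text \<open>The link frequencies of a uniform random realisation, the witness for a dense single
  layer.\<close>

lemma feasible_odds_uniform:
  assumes ne: "graphs_with_degrees E V d \<noteq> {}"
  defines "S \<equiv> graphs_with_degrees E V d"
  shows "feasible_odds E V d (\<lambda>g. real (card {G\<in>S. g \<in> G}) / real (card S))"
proof -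
  have finS: "finite S" unfolding S_def by (rule finite_graphs)
  have c: "real (card S) > 0" using ne finS by (simp add: S_def card_gt_0_iff)
  have "(\<Sum>g\<in>E. real (card {G\<in>S. g \<in> G}) / real (card S) * of_bool (i \<in> g)) = real (d i)" if i: "i \<in> V" for i
  proof -
    have "(\<Sum>g\<in>E. real (card {G\<in>S. g \<in> G}) * of_bool (i \<in> g)) = (\<Sum>g\<in>E. \<Sum>G\<in>S. of_bool (g \<in> G \<and> i \<in> g))"
      using finS by (intro sum.cong) (auto simp: Int_def)
    also have "\<dots> = (\<Sum>G\<in>S. \<Sum>g\<in>E. of_bool (g \<in> G \<and> i \<in> g))" by (rule sum.swap)
    also have "\<dots> = (\<Sum>G\<in>S. real (d i))"
    proof (rule sum.cong[OF refl])
      fix G assume G: "G \<in> S"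
      then have "{g\<in>E. g \<in> G \<and> i \<in> g} = {g\<in>G. i \<in> g}" by (auto simp: S_def graphs_with_degrees_def)
      moreover have "card {g\<in>G. i \<in> g} = d i" using G i by (auto simp: S_def graphs_with_degrees_def)
      ultimately show "(\<Sum>g\<in>E. of_bool (g \<in> G \<and> i \<in> g)) = real (d i)" using finE by (simp add: Int_def)
    qed
    finally have "(\<Sum>g\<in>E. real (card {G\<in>S. g \<in> G}) * of_bool (i \<in> g)) = real (card S) * real (d i)" by simp
    moreover have "(\<Sum>g\<in>E. real (card {G\<in>S. g \<in> G}) / real (card S) * of_bool (i \<in> g)) =
       (\<Sum>g\<in>E. real (card {G\<in>S. g \<in> G}) * of_bool (i \<in> g)) / real (card S)"
      by (simp add: sum_divide_distrib)
    ultimately show ?thesis using c by simp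
  qed
  moreover have "real (card {G\<in>S. g \<in> G}) / real (card S) \<le> 1" for g
    using card_mono[OF finS, of "{G\<in>S. g \<in> G}"] c by (simp add: divide_simps)
  ultimately show ?thesis by (auto simp: feasible_odds_def)
qed

end

section \<open>Two layers\<close>

lemma card_realisations_pos:
  assumes "exp (- x) * fact n \<le> real (card S) * y"
  shows "card S > 0"
proof (rule ccontr)
  assume "\<not> ?thesis"
  then have "exp (- x) * fact n \<le> 0" using assms by simp
  moreover have "exp (- x) * fact n > (0 :: real)" by simp
  ultimately show False by linarith
qed

lemma prod_fact_pos: "(\<Prod>i\<in>S. fact (d i)) > (0 :: real)"
  by (rule prod_pos) simp

lemma ln_prod_fact: "finite S \<Longrightarrow> ln (\<Prod>i\<in>S. fact (d i) :: real) = (\<Sum>i\<in>S. ln (fact (d i)))"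
  by (rule ln_prod) auto

lemma ln_card_realisations_upper:
  assumes "finite A" "finite B" "A \<inter> B = {}" "(\<Sum>i\<in>A. d i) = 2 * e + (\<Sum>i\<in>B. d i)" "card (realisations A B d) > 0"
  shows "ln (real (card (realisations A B d))) \<le>
    ln (fact (\<Sum>i\<in>A. d i)) - ln (fact e) - real e * ln 2 - (\<Sum>i\<in>A \<union> B. ln (fact (d i)))"
proof -
  let ?F = "\<Prod>i\<in>A \<union> B. fact (d i) :: real"
  have "real (card (realisations A B d) * (fact e * 2 ^ e * (\<Prod>i\<in>A \<union> B. fact (d i)))) \<le> real (fact (\<Sum>i\<in>A. d i))"
    by (rule of_nat_mono[OF card_realisations_upper[OF assms(1-4)]])
  then have le: "real (card (realisations A B d)) * (fact e * 2 ^ e * ?F) \<le> fact (\<Sum>i\<in>A. d i)" by simp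
  have "ln (real (card (realisations A B d)) * (fact e * 2 ^ e * ?F)) \<le> ln (fact (\<Sum>i\<in>A. d i))"
    using assms(5) prod_fact_pos[of d "A \<union> B"] by (intro ln_mono le mult_pos_pos) auto
  moreover have "ln (real (card (realisations A B d)) * (fact e * 2 ^ e * ?F)) =
     ln (real (card (realisations A B d))) + (ln (fact e) + real e * ln 2 + (\<Sum>i\<in>A \<union> B. ln (fact (d i))))"
    using assms(1,2,5) prod_fact_pos[of d "A \<union> B"]
    by (simp add: ln_mult_pos ln_prod_fact ln_realpow)
  ultimately show ?thesis by simp
qed

lemma ln_card_realisations_lower:
  assumes "finite A" "finite B" "A \<inter> B = {}" "(\<Sum>i\<in>A. d i) = 2 * e + (\<Sum>i\<in>B. d i)"
    and a: "\<And>i. i \<in> A \<Longrightarrow> d i \<le> a" and m: "\<And>i. i \<in> A \<union> B \<Longrightarrow> d i \<le> m"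
    and big: "320 * (a * m) \<le> (\<Sum>i\<in>A. d i)"
  shows "ln (fact (\<Sum>i\<in>A. d i)) - ln (fact e) - real e * ln 2 - (\<Sum>i\<in>A \<union> B. ln (fact (d i))) - 20 * real (a * m)
    \<le> ln (real (card (realisations A B d)))" and "card (realisations A B d) > 0"
proof -
  let ?F = "\<Prod>i\<in>A \<union> B. fact (d i) :: real"
  note low = card_realisations_lower[OF assms(1-4) a m big]
  show pos: "card (realisations A B d) > 0"
    using card_realisations_pos[of "20 * real (a * m)"] low by simp
  have "ln (exp (- 20 * real (a * m)) * fact (\<Sum>i\<in>A. d i)) \<le> ln (real (card (realisations A B d)) * (fact e * 2 ^ e * ?F))"
    using low by (intro ln_mono) auto
  moreover have "ln (real (card (realisations A B d)) * (fact e * 2 ^ e * ?F)) =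
     ln (real (card (realisations A B d))) + (ln (fact e) + real e * ln 2 + (\<Sum>i\<in>A \<union> B. ln (fact (d i))))"
    using assms(1,2) pos prod_fact_pos[of d "A \<union> B"]
    by (simp add: ln_mult_pos ln_prod_fact ln_realpow)
  moreover have "ln (exp (- 20 * real (a * m)) * fact (\<Sum>i\<in>A. d i)) = - 20 * real (a * m) + ln (fact (\<Sum>i\<in>A. d i))"
    by (subst ln_mult_pos) auto
  ultimately show "ln (fact (\<Sum>i\<in>A. d i)) - ln (fact e) - real e * ln 2 - (\<Sum>i\<in>A \<union> B. ln (fact (d i))) - 20 * real (a * m)
    \<le> ln (real (card (realisations A B d)))" by simp
qed

lemma sum_gfun:
  "(\<Sum>i\<in>V. gfun (d i)) = (\<Sum>i\<in>V. ln (fact (d i))) - (\<Sum>i\<in>V. xlnx (real (d i))) + real (\<Sum>i\<in>V. d i)"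
  by (simp add: gfun_eq sum.distrib sum_subtractf)

definition cross_links :: "'v set \<Rightarrow> 'v set \<Rightarrow> 'v set set" where
  "cross_links A B = {{x, y} | x y. x \<in> B \<and> y \<in> A}"

lemma cross_links_commute: "cross_links A B = cross_links B A"
  by (auto simp: cross_links_def)

lemma sum_cross_links:
  fixes f :: "'v set \<Rightarrow> real"
  assumes "A \<inter> B = {}"
  shows "(\<Sum>g\<in>cross_links A B. f g) = (\<Sum>x\<in>B. \<Sum>y\<in>A. f {x, y})"
proof -
  have inj: "inj_on (\<lambda>(x, y). {x, y}) (B \<times> A)"
    using assms by (auto simp: inj_on_def doubleton_eq_iff)
  have "cross_links A B = (\<lambda>(x, y). {x, y}) ` (B \<times> A)" by (auto simp: cross_links_def)
  then have "(\<Sum>g\<in>cross_links A B. f g) = (\<Sum>(x, y)\<in>B \<times> A. f {x, y})"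
    by (simp only: sum.reindex[OF inj]) (simp add: case_prod_unfold)
  then show ?thesis by (simp add: sum.cartesian_product)
qed

lemma degree_problem_cross_links:
  assumes "finite A" "finite B" "A \<inter> B = {}"
  shows "degree_problem (cross_links A B) (A \<union> B)"
proof
  fix g assume "g \<in> cross_links A B"
  then obtain x y where "g = {x, y}" "x \<in> B" "y \<in> A" by (auto simp: cross_links_def)
  moreover from this have "x \<noteq> y" using assms by auto
  ultimately show "g \<subseteq> A \<union> B \<and> card g = 2" by auto
qed (use assms in simp)

text \<open>Equal degree totals force the number \<open>e\<close> of links inside \<open>A\<close>
  to be 0, so a realisation can only use crossing links.\<close>

lemma graphs_cross_links_eq_realisations:
  assumes fin: "finite A" "finite B" and disj: "A \<inter> B = {}" and total: "(\<Sum>i\<in>A. d i) = (\<Sum>i\<in>B. d i)"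
  shows "graphs_with_degrees (cross_links A B) (A \<union> B) d = realisations A B d"
proof (intro equalityI subsetI)
  fix G assume "G \<in> graphs_with_degrees (cross_links A B) (A \<union> B) d"
  moreover have "cross_links A B \<subseteq> links A B" unfolding cross_links_def links_def using disj by blast
  ultimately show "G \<in> realisations A B d" by (auto simp: graphs_with_degrees_def realisations_def)
next
  fix G assume G: "G \<in> realisations A B d"
  have fl: "finite (links A B)" by (rule finite_links[OF fin disj, of d 0]) (simp add: total)
  have "finite G" using G finite_subset[OF _ fl] by (auto simp: realisations_def)
  moreover have "card (G \<inter> Pow A) = 0"
    by (rule card_inner_links[OF fin disj _ G]) (simp add: total)
  ultimately have no: "G \<inter> Pow A = {}" by simp
  have "G \<subseteq> cross_links A B"
  proof
    fix g assume g: "g \<in> G"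
    then obtain x y where xy: "g = {x, y}" "x \<in> A \<union> B" "y \<in> A"
      using G unfolding realisations_def links_def by blast
    then have "x \<in> B" using no g by auto
    then show "g \<in> cross_links A B" using xy by (auto simp: cross_links_def)
  qed
  then show "G \<in> graphs_with_degrees (cross_links A B) (A \<union> B) d"
    using G by (simp add: graphs_with_degrees_def realisations_def)
qed

text \<open>The \<open>20 * a * b\<close> comes from the lower bound on the number of graphs, which
  is also the larger of the two second-order errors, and \<open>gfun L\<close> from Stirling's
  formula for \<open>L!\<close>. The assumption \<open>a \<le> b\<close> makes \<open>b\<close> a
  degree bound on both sides, as the count demands.\<close>

lemma bipartite_gap_ordered:
  fixes d :: "'v \<Rightarrow> nat"
  assumes fin: "finite A" "finite B" and disj: "A \<inter> B = {}" and LA: "(\<Sum>i\<in>A. d i) = L" and LB: "(\<Sum>i\<in>B. d i) = L"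
    and a: "\<And>i. i \<in> A \<Longrightarrow> d i \<le> a" and b: "\<And>i. i \<in> B \<Longrightarrow> d i \<le> b" and ab: "a \<le> b" and big: "320 * (a * b) \<le> L"
  defines "E \<equiv> cross_links A B" and "V \<equiv> A \<union> B"
  shows "gap_within E V d (20 * real (a * b) + gfun L)"
proof -
  interpret degree_problem E V d unfolding E_def V_def by (rule degree_problem_cross_links[OF fin disj])
  let ?G = "graphs_with_degrees E V d"
  have G: "?G = realisations A B d"
    unfolding E_def V_def by (rule graphs_cross_links_eq_realisations[OF fin disj]) (simp add: LA LB)
  have total: "(\<Sum>i\<in>A. d i) = 2 * 0 + (\<Sum>i\<in>B. d i)" by (simp add: LA LB)
  have mb: "d i \<le> b" if "i \<in> A \<union> B" for i using a b ab that by (meson UnE le_trans)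
  have big': "320 * (a * b) \<le> (\<Sum>i\<in>A. d i)" using big LA by simp
  note low = ln_card_realisations_lower[OF fin disj total a mb big']
  note up = ln_card_realisations_upper[OF fin disj total low(2)]
  have sumV: "(\<Sum>i\<in>V. d i) = 2 * L" unfolding V_def using fin disj LA LB by (simp add: sum.union_disjoint)
  have gL: "gfun L = ln (fact L) - xlnx (real L) + real L" by (rule gfun_eq)
  \<comment> \<open>The value for \<open>L = 0\<close> only has to be positive with
    \<open>ln c * L = 0\<close>; all degrees vanish in that case.\<close>
  define c where "c = (if L = 0 then 1 else 1 / real L)"
  have c: "c > 0" by (auto simp: c_def)
  have lnc: "- ln c * real L = xlnx (real L)" by (auto simp: c_def xlnx_def ln_div)
  have cL: "c * real L * real L = real L" "c * real L \<le> 1" by (auto simp: c_def)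
  have half: "real (\<Sum>i\<in>V. d i) / 2 = real L" by (simp add: sumV)
  have cross: "(\<Sum>g\<in>E. \<Prod>i\<in>g. F i) = (\<Sum>x\<in>B. F x) * (\<Sum>y\<in>A. F y)" for F :: "'v \<Rightarrow> real"
  proof -
    have "(\<Sum>g\<in>E. \<Prod>i\<in>g. F i) = (\<Sum>x\<in>B. \<Sum>y\<in>A. \<Prod>i\<in>{x, y}. F i)"
      unfolding E_def by (rule sum_cross_links[OF disj])
    also have "\<dots> = (\<Sum>x\<in>B. \<Sum>y\<in>A. F x * F y)"
    proof (intro sum.cong refl)
      fix x y assume "x \<in> B" "y \<in> A"
      then have "x \<noteq> y" using disj by auto
      then show "(\<Prod>i\<in>{x, y}. F i) = F x * F y" by simp
    qed
    finally show ?thesis by (simp add: sum_product)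
  qed
  have rL: "(\<Sum>i\<in>A. real (d i)) = real L" "(\<Sum>i\<in>B. real (d i)) = real L"
    using LA LB by (simp_all flip: of_nat_sum)
  have gap_le: "entropy_gap E V d p \<le> (\<Sum>i\<in>V. gfun (d i)) + 20 * real (a * b)"
    if p: "feasible_odds E V d p" for p
  proof -
    have "total_entropy E p \<le> xlnx (real L) - (\<Sum>i\<in>V. xlnx (real (d i))) + real L"
      using entropy_upper[OF p c] unfolding half lnc cross rL by (simp add: cL mult.assoc[symmetric])
    moreover have "ln (fact L) - (\<Sum>i\<in>V. ln (fact (d i))) - 20 * real (a * b) \<le> ln (real (card ?G))"
      using low(1) unfolding G unfolding V_def LA by simp
    ultimately show ?thesis using sum_gfun[of d V] gL gfun_nonneg[of L] unfolding sumV by simp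
  qed
  \<comment> \<open>The reference itself: both sides have degree total \<open>L\<close>, so its
    degree sums are exact, and \<open>a * b \<le> L\<close> keeps it below 1.\<close>
  define p where "p g = c * (\<Prod>i\<in>g. real (d i))" for g
  have feas: "feasible_odds E V d p"
    unfolding feasible_odds_def
  proof (intro conjI ballI)
    fix g assume "g \<in> E"
    then obtain x y where xy: "g = {x, y}" "x \<in> B" "y \<in> A" by (auto simp: E_def cross_links_def)
    moreover from this have "x \<noteq> y" using disj by auto
    ultimately have pg: "p g = c * (real (d x) * real (d y))" by (simp add: p_def)
    show "0 \<le> p g" using c unfolding pg by simp
    have "d x * d y \<le> b * a" using a b xy by (intro mult_mono) auto
    also have "\<dots> \<le> L" using big by (simp add: mult.commute)
    finally have "real (d x) * real (d y) \<le> real L" by (metis of_nat_le_iff of_nat_mult)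
    then have "p g \<le> c * real L" unfolding pg using c by simp
    then show "p g \<le> 1" using cL(2) by simp
  next
    fix i assume i: "i \<in> V"
    have eq: "(\<Sum>g\<in>E. p g * of_bool (i \<in> g)) = (\<Sum>x\<in>B. \<Sum>y\<in>A. c * (real (d x) * real (d y)) * of_bool (i = x \<or> i = y))"
      unfolding E_def sum_cross_links[OF disj] p_def
    proof (intro sum.cong refl)
      fix x y assume "x \<in> B" "y \<in> A"
      then have "x \<noteq> y" using disj by auto
      then show "c * (\<Prod>i\<in>{x, y}. real (d i)) * of_bool (i \<in> {x, y}) = c * (real (d x) * real (d y)) * of_bool (i = x \<or> i = y)" by simp
    qed
    have dL: "c * real (d i) * real L = real (d i)"
    proof (cases "L = 0")
      case True
      then have "d i = 0" using sumV i finV by simp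
      then show ?thesis by simp
    qed (simp add: c_def)
    show "(\<Sum>g\<in>E. p g * of_bool (i \<in> g)) = real (d i)"
    proof (cases "i \<in> A")
      case True
      then have "i \<notin> B" using disj by auto
      then have "(\<Sum>g\<in>E. p g * of_bool (i \<in> g)) = (\<Sum>x\<in>B. \<Sum>y\<in>A. if y = i then c * (real (d x) * real (d y)) else 0)"
        unfolding eq by (intro sum.cong refl) auto
      also have "\<dots> = (\<Sum>x\<in>B. c * real (d i) * real (d x))" using True fin by (simp add: mult_ac)
      also have "\<dots> = c * real (d i) * real L" unfolding sum_distrib_left[symmetric] rL ..
      finally show ?thesis using dL by simp
    next
      case False
      then have "i \<in> B" using i by (simp add: V_def)
      have "(\<Sum>g\<in>E. p g * of_bool (i \<in> g)) = (\<Sum>x\<in>B. \<Sum>y\<in>A. if x = i then c * (real (d x) * real (d y)) else 0)"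
        unfolding eq using False by (intro sum.cong refl) auto
      also have "\<dots> = (\<Sum>x\<in>B. if x = i then (\<Sum>y\<in>A. c * real (d i) * real (d y)) else 0)"
        by (intro sum.cong refl) (auto simp: mult_ac)
      also have "\<dots> = (\<Sum>y\<in>A. c * real (d i) * real (d y))" using \<open>i \<in> B\<close> fin by simp
      also have "\<dots> = c * real (d i) * real L" unfolding sum_distrib_left[symmetric] rL ..
      finally show ?thesis using dL by simp
    qed
  qed
  have "(\<Sum>i\<in>B. real (d i) ^ 2) \<le> (\<Sum>i\<in>B. real b * real (d i))"
    using b by (intro sum_mono) (auto simp: power2_eq_square intro!: mult_right_mono)
  also have "\<dots> = real b * real L" unfolding sum_distrib_left[symmetric] rL ..
  finally have B2: "(\<Sum>i\<in>B. real (d i) ^ 2) \<le> real b * real L" .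
  have "(\<Sum>i\<in>A. real (d i) ^ 2) \<le> (\<Sum>i\<in>A. real a * real (d i))"
    using a by (intro sum_mono) (auto simp: power2_eq_square intro!: mult_right_mono)
  also have "\<dots> = real a * real L" unfolding sum_distrib_left[symmetric] rL ..
  finally have A2: "(\<Sum>i\<in>A. real (d i) ^ 2) \<le> real a * real L" .
  have "c ^ 2 * ((\<Sum>i\<in>B. real (d i) ^ 2) * (\<Sum>i\<in>A. real (d i) ^ 2)) \<le> c ^ 2 * ((real b * real L) * (real a * real L))"
    by (intro mult_left_mono mult_mono A2 B2 sum_nonneg) auto
  also have "\<dots> = real (a * b) * (c * real L) ^ 2" by (simp add: power2_eq_square mult_ac)
  also have "\<dots> \<le> real (a * b) * 1" using cL(2) c by (intro mult_left_mono power_le_one) auto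
  finally have sq: "c ^ 2 * ((\<Sum>i\<in>B. real (d i) ^ 2) * (\<Sum>i\<in>A. real (d i) ^ 2)) \<le> real (a * b)" by simp
  have "xlnx (real L) - (\<Sum>i\<in>V. xlnx (real (d i))) + real L - real (a * b) \<le> total_entropy E p"
    using entropy_lower[OF feas c] sq unfolding half lnc cross p_def by linarith
  moreover have "ln (real (card ?G)) \<le> ln (fact L) - (\<Sum>i\<in>V. ln (fact (d i)))"
    using up unfolding G unfolding V_def LA by simp
  ultimately have "(\<Sum>i\<in>V. gfun (d i)) - gfun L - real (a * b) \<le> entropy_gap E V d p"
    using sum_gfun[of d V] gL unfolding sumV by simp
  moreover have "real (a * b) \<le> 20 * real (a * b)" by simp
  ultimately have "(\<Sum>i\<in>V. gfun (d i)) - (20 * real (a * b) + gfun L) \<le> entropy_gap E V d p" by linarith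
  with feas gap_le gfun_nonneg[of L] show ?thesis unfolding gap_within_def by fastforce
qed

lemma bipartite_gap:
  fixes d :: "'v \<Rightarrow> nat"
  assumes fin: "finite A" "finite B" and disj: "A \<inter> B = {}" and LA: "(\<Sum>i\<in>A. d i) = L" and LB: "(\<Sum>i\<in>B. d i) = L"
    and a: "\<And>i. i \<in> A \<Longrightarrow> d i \<le> a" and b: "\<And>i. i \<in> B \<Longrightarrow> d i \<le> b" and big: "320 * (a * b) \<le> L"
  shows "gap_within (cross_links A B) (A \<union> B) d (20 * real (a * b) + gfun L)"
proof (cases "a \<le> b")
  case True
  show ?thesis by (rule bipartite_gap_ordered[OF fin disj LA LB a b True big])
next
  case False
  then have "b \<le> a" by simp
  moreover have "B \<inter> A = {}" "320 * (b * a) \<le> L" using disj big by (auto simp: mult.commute)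
  ultimately have "gap_within (cross_links B A) (B \<union> A) d (20 * real (b * a) + gfun L)"
    by (intro bipartite_gap_ordered fin LA LB a b)
  then show ?thesis by (simp only: cross_links_commute[of A B] Un_commute[of A B] mult.commute[of a b])
qed

section \<open>A single layer\<close>

lemma links_single: "links V {} = {{x, y} | x y. x \<in> V \<and> y \<in> V \<and> x \<noteq> y}"
  by (simp add: links_def)

lemma degree_problem_links:
  assumes "finite V"
  shows "degree_problem (links V {}) V"
proof
  fix g assume "g \<in> links V {}"
  then obtain x y where "g = {x, y}" "x \<in> V" "y \<in> V" "x \<noteq> y" unfolding links_single by blast
  then show "g \<subseteq> V \<and> card g = 2" by auto
qed (use assms in simp)

lemma sum_links:
  fixes f :: "'v set \<Rightarrow> real"
  assumes fin: "finite V"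
  shows "2 * (\<Sum>g\<in>links V {}. f g) = (\<Sum>x\<in>V. \<Sum>y\<in>V - {x}. f {x, y})"
proof -
  let ?S = "SIGMA x:V. V - {x}"
  have finS: "finite ?S" using fin by auto
  have finL: "finite (links V {})"
    using degree_problem.finE[OF degree_problem_links[OF fin]] .
  have "(\<Sum>x\<in>V. \<Sum>y\<in>V - {x}. f {x, y}) = (\<Sum>p\<in>?S. f (edge p))"
    using fin by (simp add: sum.Sigma edge_def case_prod_unfold)
  also have "\<dots> = (\<Sum>g\<in>links V {}. \<Sum>p\<in>{p\<in>?S. edge p = g}. f (edge p))"
    by (rule sum.group[symmetric, OF finS finL]) (clarsimp simp: edge_def links_single, blast)
  also have "\<dots> = (\<Sum>g\<in>links V {}. 2 * f g)"
  proof (rule sum.cong[OF refl])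
    fix g assume "g \<in> links V {}"
    then obtain x y where xy: "g = {x, y}" "x \<in> V" "y \<in> V" "x \<noteq> y" unfolding links_single by blast
    then have "{p\<in>?S. edge p = g} = {(x, y), (y, x)}" by (auto simp: edge_def doubleton_eq_iff)
    then show "(\<Sum>p\<in>{p\<in>?S. edge p = g}. f (edge p)) = 2 * f g"
      using xy by (simp add: edge_def insert_commute)
  qed
  finally show ?thesis by (simp add: sum_distrib_left)
qed

lemma sum_links_prod_le:
  fixes F :: "'v \<Rightarrow> real"
  assumes fin: "finite V" and F: "\<And>i. i \<in> V \<Longrightarrow> 0 \<le> F i"
  shows "2 * (\<Sum>g\<in>links V {}. \<Prod>i\<in>g. F i) \<le> (\<Sum>i\<in>V. F i) ^ 2"
proof -
  have "2 * (\<Sum>g\<in>links V {}. \<Prod>i\<in>g. F i) = (\<Sum>x\<in>V. \<Sum>y\<in>V - {x}. F x * F y)"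
    unfolding sum_links[OF fin] by (intro sum.cong refl) auto
  also have "\<dots> \<le> (\<Sum>x\<in>V. \<Sum>y\<in>V. F x * F y)"
    using fin F by (intro sum_mono sum_mono2) auto
  also have "\<dots> = (\<Sum>i\<in>V. F i) ^ 2" by (simp add: sum_product power2_eq_square)
  finally show ?thesis .
qed

lemma handshake:
  assumes fin: "finite A" "finite B" and disj: "A \<inter> B = {}" and G: "G \<subseteq> links A B"
  shows "(\<Sum>i\<in>A. card {g\<in>G. i \<in> g}) = 2 * card (G \<inter> Pow A) + (\<Sum>i\<in>B. card {g\<in>G. i \<in> g})"
proof -
  have "links A B \<subseteq> Pow (A \<union> B)" by (auto simp: links_def)
  then have finG: "finite G" using fin G by (meson finite_Pow_iff finite_UnI finite_subset)
  have count: "(\<Sum>i\<in>S. card {g\<in>G. i \<in> g}) = (\<Sum>g\<in>G. card (g \<inter> S))" if "finite S" for S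
  proof -
    have "(\<Sum>i\<in>S. card {g\<in>G. i \<in> g}) = (\<Sum>i\<in>S. \<Sum>g\<in>G. of_bool (i \<in> g))"
      using finG by (simp add: Int_def)
    also have "\<dots> = (\<Sum>g\<in>G. \<Sum>i\<in>S. of_bool (i \<in> g))" by (rule sum.swap)
    also have "\<dots> = (\<Sum>g\<in>G. card (g \<inter> S))" using that by (simp add: Int_commute)
    finally show ?thesis .
  qed
  have "card (g \<inter> A) = 2 * of_bool (g \<in> Pow A) + card (g \<inter> B)" if g: "g \<in> G" for g
  proof -
    obtain x y where xy: "g = {x, y}" "x \<in> A \<union> B" "y \<in> A" "x \<noteq> y" using g G unfolding links_def by blast
    show ?thesis
    proof (cases "x \<in> A")
      case True
      then have "g \<inter> A = {x, y}" "g \<inter> B = {}" "g \<in> Pow A" using xy disj by auto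
      then show ?thesis using xy by simp
    next
      case False
      then have "g \<inter> A = {y}" "g \<inter> B = {x}" "g \<notin> Pow A" using xy disj by auto
      then show ?thesis by simp
    qed
  qed
  then have "(\<Sum>g\<in>G. card (g \<inter> A)) = (\<Sum>g\<in>G. 2 * of_bool (g \<in> Pow A) + card (g \<inter> B))" by simp
  also have "\<dots> = 2 * card (G \<inter> Pow A) + (\<Sum>g\<in>G. card (g \<inter> B))"
    using finG by (simp add: sum.distrib sum_distrib_left[symmetric] Pow_def)
  finally show ?thesis by (simp add: count fin)
qed

lemma realisations_single: "realisations V {} d = graphs_with_degrees (links V {}) V d"
  by (simp add: realisations_def graphs_with_degrees_def)

text \<open>The plain product \<open>d x * d y / L\<close> gives node \<open>i\<close> the sum
  \<open>d i * (L - d i) / L\<close>, since the diagonal is missing. With weights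
  \<open>r x + r y\<close> the sum over \<open>y \<noteq> i\<close> is
  \<open>d i * (r i * (L - 2 * d i) + T)\<close>, and \<open>r i = 1 / (L - 2 * d i)\<close> makes
  it \<open>d i * (1 + T)\<close> for every \<open>i\<close>. Dividing by \<open>1 + T\<close> gives
  feasibility.\<close>

lemma exists_near_product_odds:
  fixes d :: "'v \<Rightarrow> nat"
  assumes fin: "finite V" and m: "\<And>i. i \<in> V \<Longrightarrow> d i \<le> m" and L: "(\<Sum>i\<in>V. d i) = L"
    and m1: "m \<ge> 1" and big: "m ^ 2 + 2 * m \<le> L"
  shows "\<exists>p. feasible_odds (links V {}) V d p \<and>
     (\<forall>g\<in>links V {}. p g \<le> 1 / (real L - 2 * real m) * (\<Prod>i\<in>g. real (d i)))"
proof -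
  have "m ^ 2 \<ge> 1" using m1 by simp
  then have Lm: "real L - 2 * real m > 0" using big by linarith
  have rL: "(\<Sum>i\<in>V. real (d i)) = real L" using L by (simp flip: of_nat_sum)
  define r where "r i = 1 / (real L - 2 * real (d i))" for i
  have den: "real L - 2 * real (d i) \<ge> real L - 2 * real m" if "i \<in> V" for i using m[OF that] by simp
  have r0: "0 \<le> r i" and rm: "r i \<le> 1 / (real L - 2 * real m)" and rL1: "1 / real L \<le> r i"
    and rd: "r i * (real L - 2 * real (d i)) = 1" if "i \<in> V" for i
    using den[OF that] Lm by (auto simp: r_def intro!: divide_left_mono mult_pos_pos)
  define T where "T = (\<Sum>i\<in>V. real (d i) * r i)"
  have "(\<Sum>i\<in>V. real (d i) * (1 / real L)) \<le> T"
    unfolding T_def by (intro sum_mono mult_left_mono rL1) auto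
  moreover have "(\<Sum>i\<in>V. real (d i) * (1 / real L)) = 1"
    unfolding sum_distrib_right[symmetric] rL using Lm by simp
  ultimately have T1: "T \<ge> 1" by simp
  define p where "p g = (\<Prod>i\<in>g. real (d i)) * (\<Sum>i\<in>g. r i) / (1 + T)" for g
  have pxy: "p {x, y} = real (d x) * real (d y) * (r x + r y) / (1 + T)" if "x \<noteq> y" for x y
    using that by (simp add: p_def)
  have le: "p g \<le> 1 / (real L - 2 * real m) * (\<Prod>i\<in>g. real (d i))" and p0: "0 \<le> p g" and p1: "p g \<le> 1"
    if g: "g \<in> links V {}" for g
  proof -
    obtain x y where xy: "g = {x, y}" "x \<in> V" "y \<in> V" "x \<noteq> y" using g unfolding links_single by blast
    \<comment> \<open>\<open>T \<ge> 1\<close> bounds the weight by the average of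
      \<open>r x\<close> and \<open>r y\<close>, so the upper bound on the probability has no extra
      factor 2.\<close>
    have "(r x + r y) / (1 + T) \<le> (r x + r y) / 2"
      using T1 r0[OF xy(2)] r0[OF xy(3)] by (intro divide_left_mono) auto
    also have "\<dots> \<le> 1 / (real L - 2 * real m)" using add_mono[OF rm[OF xy(2)] rm[OF xy(3)]] by simp
    finally have q: "(r x + r y) / (1 + T) \<le> 1 / (real L - 2 * real m)" .
    have "p g = real (d x) * real (d y) * ((r x + r y) / (1 + T))" using pxy[OF xy(4)] xy(1) by simp
    also have "\<dots> \<le> real (d x) * real (d y) * (1 / (real L - 2 * real m))"
      using q by (intro mult_left_mono) auto
    finally show le: "p g \<le> 1 / (real L - 2 * real m) * (\<Prod>i\<in>g. real (d i))" using xy by (simp add: mult.commute)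
    show "0 \<le> p g" unfolding xy(1) pxy[OF xy(4)] using r0[OF xy(2)] r0[OF xy(3)] T1 by simp
    have "d x * d y \<le> m * m" using m xy by (intro mult_mono) auto
    then have "real (d x) * real (d y) \<le> real m * real m" by (metis of_nat_le_iff of_nat_mult)
    also have "\<dots> \<le> real L - 2 * real m"
    proof -
      have "real (m ^ 2 + 2 * m) \<le> real L" using big by (rule of_nat_mono)
      then show ?thesis by (simp add: power2_eq_square)
    qed
    finally have "1 / (real L - 2 * real m) * (\<Prod>i\<in>g. real (d i)) \<le> 1" using xy Lm by (simp add: divide_simps)
    with le show "p g \<le> 1" by linarith
  qed
  have "(\<Sum>g\<in>links V {}. p g * of_bool (i \<in> g)) = real (d i)" if i: "i \<in> V" for i
  proof -
    have "2 * (\<Sum>g\<in>links V {}. p g * of_bool (i \<in> g)) =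
       (\<Sum>x\<in>V. \<Sum>y\<in>V - {x}. p {x, y} * of_bool (i \<in> {x, y}))"
      by (rule sum_links[OF fin])
    also have "\<dots> = (\<Sum>x\<in>V. \<Sum>y\<in>V - {x}. (if x = i then p {i, y} else 0) + (if y = i then p {i, x} else 0))"
      by (intro sum.cong refl) (auto simp: insert_commute)
    also have "\<dots> = (\<Sum>x\<in>V. (if x = i then (\<Sum>y\<in>V - {i}. p {i, y}) else 0) + (if x \<noteq> i then p {i, x} else 0))"
    proof (intro sum.cong refl)
      fix x assume "x \<in> V"
      have "(\<Sum>y\<in>V - {x}. if y = i then p {i, x} else 0) = (if x \<noteq> i then p {i, x} else 0)"
        using fin i by (simp add: sum.delta)
      moreover have "(\<Sum>y\<in>V - {x}. if x = i then p {i, y} else 0) = (if x = i then (\<Sum>y\<in>V - {i}. p {i, y}) else 0)" by simp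
      ultimately show "(\<Sum>y\<in>V - {x}. (if x = i then p {i, y} else 0) + (if y = i then p {i, x} else 0)) =
         (if x = i then (\<Sum>y\<in>V - {i}. p {i, y}) else 0) + (if x \<noteq> i then p {i, x} else 0)"
        by (simp only: sum.distrib)
    qed
    also have "\<dots> = 2 * (\<Sum>y\<in>V - {i}. p {i, y})"
    proof -
      have "(\<Sum>x\<in>V. if x \<noteq> i then p {i, x} else 0) = (\<Sum>y\<in>V - {i}. p {i, y})"
        by (rule sum.mono_neutral_cong_right) (use fin in auto)
      then show ?thesis using fin i by (simp only: sum.distrib) (simp add: sum.delta)
    qed
    finally have "(\<Sum>g\<in>links V {}. p g * of_bool (i \<in> g)) = (\<Sum>y\<in>V - {i}. p {i, y})" by simp
    also have "\<dots> = (\<Sum>y\<in>V - {i}. real (d i) * (real (d y) * r i + real (d y) * r y) / (1 + T))"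
      by (intro sum.cong refl) (auto simp: pxy algebra_simps)
    also have "\<dots> = real (d i) * (r i * (\<Sum>y\<in>V - {i}. real (d y)) + (\<Sum>y\<in>V - {i}. real (d y) * r y)) / (1 + T)"
      by (simp add: sum_divide_distrib[symmetric] sum_distrib_left[symmetric] sum.distrib sum_distrib_right[symmetric] mult.commute)
    also have "(\<Sum>y\<in>V - {i}. real (d y)) = real L - real (d i)" using fin i rL by (simp add: sum_diff1)
    also have "(\<Sum>y\<in>V - {i}. real (d y) * r y) = T - real (d i) * r i" using fin i by (simp add: sum_diff1 T_def)
    also have "r i * (real L - real (d i)) + (T - real (d i) * r i) = r i * (real L - 2 * real (d i)) + T"
      by (simp add: algebra_simps)
    finally show ?thesis using rd[OF i] T1 by simp
  qed
  then have "feasible_odds (links V {}) V d p" using p0 p1 by (simp add: feasible_odds_def)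
  with le show ?thesis by blast
qed

lemma gfun_le_ln_Suc: "gfun k \<le> 1 + ln (1 + real k)"
proof (cases "k = 0")
  case False
  then have "gfun k \<le> 1 + ln (real k)" by (intro gfun_le_ln) simp
  also have "ln (real k) \<le> ln (1 + real k)" using False by simp
  finally show ?thesis by simp
qed simp

section \<open>Counting with frozen links between nodes of large degree\<close>

text \<open>Summation by levels: \<open>ln (m / d i)\<close> is at most the sum of
  \<open>1 / j\<close> over \<open>d i \<le> j < m\<close>. After exchanging the sums, level
  \<open>j\<close> contributes at most \<open>C * j * m / j = C * m\<close>, and there are fewer
  than \<open>m\<close> levels.\<close>

lemma sum_log_ratio_le:
  fixes d :: "'v \<Rightarrow> nat"
  assumes fin: "finite B" and d: "\<And>i. i \<in> B \<Longrightarrow> 1 \<le> d i \<and> d i \<le> m"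
    and sparse: "\<And>j. 1 \<le> j \<Longrightarrow> j \<le> m \<Longrightarrow> real (\<Sum>i\<in>{i\<in>B. d i \<le> j}. d i) \<le> C * (real j * real m)"
  shows "(\<Sum>i\<in>B. real (d i) * (ln (real m) - ln (real (d i)))) \<le> C * real m ^ 2"
proof (cases "m = 0")
  case True
  then have "B = {}" using d by force
  then show ?thesis using True by simp
next
  case False
  have tele: "ln (real m) - ln (real k) \<le> (\<Sum>j\<in>{k..<m}. 1 / real j)" if "1 \<le> k" "k \<le> m" for k
    using that(2,1)
  proof (induction m rule: dec_induct)
    case (step n)
    then have n: "real n > 0" by simp
    have "ln (real (Suc n)) - ln (real n) = ln (real (Suc n) / real n)" using n by (subst ln_div) auto
    also have "\<dots> \<le> real (Suc n) / real n - 1" using n by (intro ln_le_minus_one) simp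
    also have "\<dots> = 1 / real n" using n by (simp add: field_simps)
    finally show ?case using step by simp
  qed simp
  have "(\<Sum>i\<in>B. real (d i) * (ln (real m) - ln (real (d i)))) \<le> (\<Sum>i\<in>B. real (d i) * (\<Sum>j\<in>{d i..<m}. 1 / real j))"
    using d by (intro sum_mono mult_left_mono tele) auto
  also have "\<dots> = (\<Sum>i\<in>B. \<Sum>j\<in>{1..<m}. of_bool (d i \<le> j) * real (d i) * (1 / real j))"
  proof (rule sum.cong[OF refl])
    fix i assume i: "i \<in> B"
    have "(\<Sum>j\<in>{d i..<m}. real (d i) * (1 / real j)) = (\<Sum>j\<in>{1..<m}. of_bool (d i \<le> j) * real (d i) * (1 / real j))"
      by (rule sum.mono_neutral_cong_left) (use d[OF i] in auto)
    then show "real (d i) * (\<Sum>j\<in>{d i..<m}. 1 / real j) = (\<Sum>j\<in>{1..<m}. of_bool (d i \<le> j) * real (d i) * (1 / real j))"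
      by (simp add: sum_distrib_left)
  qed
  also have "\<dots> = (\<Sum>j\<in>{1..<m}. \<Sum>i\<in>B. of_bool (d i \<le> j) * real (d i) * (1 / real j))" by (rule sum.swap)
  also have "\<dots> \<le> (\<Sum>j\<in>{1..<m}. C * real m)"
  proof (rule sum_mono)
    fix j assume j: "j \<in> {1..<m}"
    have "(\<Sum>i\<in>B. of_bool (d i \<le> j) * real (d i)) = (\<Sum>i\<in>{i\<in>B. d i \<le> j}. real (d i))"
      by (rule sum.mono_neutral_cong_right) (use fin in auto)
    also have "\<dots> \<le> C * (real j * real m)" using sparse[of j] j by simp
    finally have "(\<Sum>i\<in>B. of_bool (d i \<le> j) * real (d i)) * (1 / real j) \<le> C * (real j * real m) * (1 / real j)"
      by (rule mult_right_mono) simp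
    then show "(\<Sum>i\<in>B. of_bool (d i \<le> j) * real (d i) * (1 / real j)) \<le> C * real m"
      unfolding sum_distrib_right[symmetric] using j by simp
  qed
  also have "\<dots> \<le> C * real m ^ 2"
  proof -
    have "0 \<le> real (\<Sum>i\<in>{i\<in>B. d i \<le> m}. d i)" by (rule of_nat_0_le_iff)
    then have "0 \<le> C * (real m * real m)" using sparse[of m] False by linarith
    moreover have "0 < real m * real m" using False by simp
    ultimately have "C \<ge> 0" by (simp only: zero_le_mult_iff) linarith
    moreover have "real (m - 1) \<le> real m" by simp
    ultimately have "real (m - 1) * (C * real m) \<le> real m * (C * real m)" by (intro mult_right_mono) auto
    then show ?thesis by (simp add: power2_eq_square mult_ac)
  qed
  finally show ?thesis .
qed

text \<open>Links inside the set of nodes of degree above the threshold \<open>\<theta>\<close> are kept, all others are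
  counted afresh.\<close>

lemma card_graphs_ge_split:
  fixes d :: "'v \<Rightarrow> nat" and \<theta> m :: nat
  assumes fin: "finite V" and m: "\<And>i. i \<in> V \<Longrightarrow> d i \<le> m"
    and ne: "graphs_with_degrees (links V {}) V d \<noteq> {}"
  defines "A \<equiv> {i\<in>V. d i \<le> \<theta>}" and "B \<equiv> {i\<in>V. \<not> d i \<le> \<theta>}"
  assumes big: "320 * (\<theta> * m) \<le> (\<Sum>i\<in>A. d i)"
  shows "\<exists>e l :: nat. (\<Sum>i\<in>A. d i) = 2 * e + l \<and> l \<le> (\<Sum>i\<in>B. d i) \<and>
    ln (fact (\<Sum>i\<in>A. d i)) - ln (fact e) - real e * ln 2 - (\<Sum>i\<in>A. ln (fact (d i))) - real l * ln (real m) - 20 * real (\<theta> * m)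
      \<le> ln (real (card (graphs_with_degrees (links V {}) V d)))"
proof -
  obtain G0 where G0: "G0 \<subseteq> links V {}" and deg: "\<And>i. i \<in> V \<Longrightarrow> card {g\<in>G0. i \<in> g} = d i"
    using ne by (auto simp: graphs_with_degrees_def)
  interpret degree_problem "links V {}" V d by (rule degree_problem_links[OF fin])
  have finG0: "finite G0" using G0 finE finite_subset by blast
  have finAB: "finite A" "finite B" "A \<inter> B = {}" and V: "V = A \<union> B" using fin by (auto simp: A_def B_def)
  define K where "K = {g\<in>G0. g \<subseteq> B}"
  define G1 where "G1 = G0 - K"
  define b where "b i = card {g\<in>G1. i \<in> g}" for i
  have bA: "b i = d i" if "i \<in> A" for i
  proof -
    have "{g\<in>G1. i \<in> g} = {g\<in>G0. i \<in> g}" using that finAB(3) by (auto simp: G1_def K_def)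
    then show ?thesis using deg[of i] that V by (simp add: b_def)
  qed
  have bK: "b i + card {g\<in>K. i \<in> g} = d i" if "i \<in> V" for i
  proof -
    have "{g\<in>G0. i \<in> g} = {g\<in>G1. i \<in> g} \<union> {g\<in>K. i \<in> g}" by (auto simp: G1_def K_def)
    moreover have "card ({g\<in>G1. i \<in> g} \<union> {g\<in>K. i \<in> g}) = card {g\<in>G1. i \<in> g} + card {g\<in>K. i \<in> g}"
      using finG0 by (intro card_Un_disjoint) (auto simp: G1_def K_def)
    ultimately show ?thesis using deg[OF that] by (simp add: b_def)
  qed
  have G1L: "G1 \<subseteq> links A B"
  proof
    fix g assume g: "g \<in> G1"
    then obtain x y where xy: "g = {x, y}" "x \<in> V" "y \<in> V" "x \<noteq> y"
      using G0 unfolding G1_def links_single by blast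
    have "\<not> g \<subseteq> B" using g by (auto simp: G1_def K_def)
    then have "x \<in> A \<or> y \<in> A" using xy V by auto
    moreover have "g = {y, x}" using xy by blast
    ultimately show "g \<in> links A B" using xy V unfolding links_def by blast
  qed
  have total: "(\<Sum>i\<in>A. b i) = 2 * card (G1 \<inter> Pow A) + (\<Sum>i\<in>B. b i)"
    unfolding b_def by (rule handshake[OF finAB G1L])
  have sumA: "(\<Sum>i\<in>A. b i) = (\<Sum>i\<in>A. d i)" by (intro sum.cong bA) auto
  have bd: "b i \<le> d i" if "i \<in> V" for i using bK[OF that] by simp
  have b\<theta>: "b i \<le> \<theta>" if "i \<in> A" for i using bA[OF that] that by (simp add: A_def)
  have bm: "b i \<le> m" if "i \<in> A \<union> B" for i using bd[of i] m[of i] that V by simp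
  have big': "320 * (\<theta> * m) \<le> (\<Sum>i\<in>A. b i)" using big sumA by simp
  note low = ln_card_realisations_lower(1)[OF finAB total b\<theta> bm big']
    and pos = ln_card_realisations_lower(2)[OF finAB total b\<theta> bm big']
  \<comment> \<open>No link of \<open>links A B\<close> lies inside \<open>B\<close>, so
    \<open>D\<close> is recovered from \<open>D \<union> K\<close> by removing
    \<open>K\<close>.\<close>
  have "inj_on (\<lambda>D. D \<union> K) (realisations A B b)"
  proof (rule inj_onI)
    fix D D' assume D: "D \<in> realisations A B b" "D' \<in> realisations A B b" and eq: "D \<union> K = D' \<union> K"
    have "\<not> g \<subseteq> B" if "g \<in> links A B" for g using that finAB(3) unfolding links_def by blast
    then have "D \<inter> K = {}" "D' \<inter> K = {}" using D by (auto simp: realisations_def K_def)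
    then show "D = D'" using eq by blast
  qed
  moreover have "(\<lambda>D. D \<union> K) ` realisations A B b \<subseteq> graphs_with_degrees (links V {}) V d"
  proof clarify
    fix D assume D: "D \<in> realisations A B b"
    have "links A B \<subseteq> links V {}" unfolding links_def V by blast
    then have sub: "D \<union> K \<subseteq> links V {}" using D G0 by (auto simp: realisations_def K_def)
    then have finD: "finite D" using finE finite_subset by blast
    have nB: "\<not> g \<subseteq> B" if "g \<in> D" for g
      using that D finAB(3) unfolding links_def realisations_def by blast
    have "card {g \<in> D \<union> K. i \<in> g} = d i" if i: "i \<in> V" for i
    proof -
      have "{g \<in> D \<union> K. i \<in> g} = {g\<in>D. i \<in> g} \<union> {g\<in>K. i \<in> g}" by auto
      moreover have "card ({g\<in>D. i \<in> g} \<union> {g\<in>K. i \<in> g}) = card {g\<in>D. i \<in> g} + card {g\<in>K. i \<in> g}"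
        using finD finG0 nB by (intro card_Un_disjoint) (auto simp: K_def)
      moreover have "card {g\<in>D. i \<in> g} = b i" using D i V by (simp add: realisations_def)
      ultimately show ?thesis using bK[OF i] by simp
    qed
    then show "D \<union> K \<in> graphs_with_degrees (links V {}) V d" using sub by (simp add: graphs_with_degrees_def)
  qed
  ultimately have "card (realisations A B b) \<le> card (graphs_with_degrees (links V {}) V d)"
    using finite_graphs by (metis card_image card_mono)
  then have "ln (real (card (realisations A B b))) \<le> ln (real (card (graphs_with_degrees (links V {}) V d)))"
    using pos by simp
  \<comment> \<open>The residual degrees on \<open>B\<close> depend on the chosen realisation, so
    their factorials are estimated by powers of \<open>m\<close>, leaving only the total
    \<open>l\<close> in the bound.\<close>
  moreover have "(\<Sum>i\<in>A \<union> B. ln (fact (b i))) \<le> (\<Sum>i\<in>A. ln (fact (d i))) + real (\<Sum>i\<in>B. b i) * ln (real m)"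
  proof -
    have "(\<Sum>i\<in>B. ln (fact (b i))) \<le> (\<Sum>i\<in>B. real (b i) * ln (real m))"
    proof (rule sum_mono)
      fix i assume "i \<in> B"
      then have bm: "b i \<le> m" using bd[of i] m[of i] V by simp
      have "ln (fact (b i)) \<le> xlnx (real (b i))" using gfun_le[of "b i"] by (simp add: gfun_eq)
      also have "\<dots> \<le> real (b i) * ln (real m)"
        unfolding xlnx_def using bm by (cases "b i = 0") (auto intro!: mult_left_mono)
      finally show "ln (fact (b i)) \<le> real (b i) * ln (real m)" .
    qed
    moreover have "(\<Sum>i\<in>A. ln (fact (b i) :: real)) = (\<Sum>i\<in>A. ln (fact (d i)))" by (intro sum.cong refl) (simp add: bA)
    ultimately show ?thesis using finAB by (simp add: sum.union_disjoint sum_distrib_right)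
  qed
  moreover have "(\<Sum>i\<in>B. b i) \<le> (\<Sum>i\<in>B. d i)" using bd V by (intro sum_mono) auto
  ultimately show ?thesis using low total unfolding sumA
    by (intro exI[of _ "card (G1 \<inter> Pow A)"] exI[of _ "\<Sum>i\<in>B. b i"]) auto
qed

lemma unipartite_upper:
  fixes d :: "'v \<Rightarrow> nat"
  assumes fin: "finite V" and m: "\<And>i. i \<in> V \<Longrightarrow> d i \<le> m"
    and ne: "graphs_with_degrees (links V {}) V d \<noteq> {}" and p: "feasible_odds (links V {}) V d p"
  defines "L \<equiv> \<Sum>i\<in>V. d i"
  shows "entropy_gap (links V {}) V d p
     \<le> (\<Sum>i\<in>V. gfun (d i)) + 110000 * real m ^ 2 + (1 + ln (1 + real L))"
proof (cases "m = 0")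
  case True
  interpret degree_problem "links V {}" V d by (rule degree_problem_links[OF fin])
  have "p g = 0" if g: "g \<in> links V {}" for g
  proof (rule ccontr)
    assume "p g \<noteq> 0"
    then have "p g > 0" using p g by (force simp: feasible_odds_def)
    moreover obtain x y where "g = {x, y}" "x \<in> V" using g unfolding links_single by blast
    ultimately have "d x > 0" "x \<in> V" using link_positive[OF p g, of x] by auto
    then show False using m[of x] True by simp
  qed
  then have "total_entropy (links V {}) p = 0" by (simp add: bernoulli_entropy_def)
  moreover have "card (graphs_with_degrees (links V {}) V d) > 0" using ne finite_graphs by (simp add: card_gt_0_iff)
  then have "0 \<le> ln (real (card (graphs_with_degrees (links V {}) V d)))" by simp
  moreover have "0 \<le> (\<Sum>i\<in>V. gfun (d i))" by (intro sum_nonneg gfun_nonneg)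
  moreover have "0 \<le> ln (1 + real L)" by simp
  moreover have "0 \<le> 110000 * real m ^ 2" by simp
  ultimately show ?thesis by linarith
next
  case False
  then have m1: "1 \<le> m" by simp
  interpret degree_problem "links V {}" V d by (rule degree_problem_links[OF fin])
  \<comment> \<open>\<open>good j\<close> is the size condition of the split count at threshold
    \<open>j\<close>. It holds at 0, and its failure at every \<open>j\<close> above the largest
    good one is the sparsity condition of \<open>sum_log_ratio_le\<close>.\<close>
  define good where "good j \<longleftrightarrow> 320 * (j * m) \<le> (\<Sum>i\<in>{i\<in>V. d i \<le> j}. d i)" for j
  define \<theta> where "\<theta> = Max {j. j \<le> m \<and> good j}"
  have fing: "finite {j. j \<le> m \<and> good j}" by simp
  have "0 \<in> {j. j \<le> m \<and> good j}" by (simp add: good_def)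
  then have "\<theta> \<in> {j. j \<le> m \<and> good j}" unfolding \<theta>_def using fing by (intro Max_in) auto
  then have \<theta>: "\<theta> \<le> m" "good \<theta>" by auto
  have above: "\<not> good j" if "\<theta> < j" "j \<le> m" for j
  proof
    assume "good j"
    then have "j \<le> \<theta>" unfolding \<theta>_def using that fing by (intro Max_ge) auto
    with that show False by simp
  qed
  define A where "A = {i\<in>V. d i \<le> \<theta>}"
  define B where "B = {i\<in>V. \<not> d i \<le> \<theta>}"
  have finAB: "finite A" "finite B" "A \<inter> B = {}" and V: "V = A \<union> B" using fin by (auto simp: A_def B_def)
  obtain e l where el: "(\<Sum>i\<in>A. d i) = 2 * e + l" "l \<le> (\<Sum>i\<in>B. d i)" and
    low: "ln (fact (\<Sum>i\<in>A. d i)) - ln (fact e) - real e * ln 2 - (\<Sum>i\<in>A. ln (fact (d i))) - real l * ln (real m) - 20 * real (\<theta> * m)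
      \<le> ln (real (card (graphs_with_degrees (links V {}) V d)))"
    using card_graphs_ge_split[OF fin m ne, of \<theta>] \<theta>(2) unfolding good_def A_def B_def by blast
  define LA where "LA = (\<Sum>i\<in>A. d i)"
  define LB where "LB = (\<Sum>i\<in>B. d i)"
  have L: "L = LA + LB" unfolding L_def LA_def LB_def V by (rule sum.union_disjoint[OF finAB])
  \<comment> \<open>If \<theta> equals \<open>m\<close> then \<open>B\<close> is empty. Otherwise
    \<open>m\<close> itself fails to be good, so \<open>L < 320 * m^2\<close>, and
    \<open>sum_log_ratio_le\<close> applies with \<open>C = 320\<close>. The constant is
    \<open>320 * 320 + 640\<close>, rounded up.\<close>
  have LBm: "real LB \<le> 320 * real m ^ 2" and Q3: "real LB * ln (real L) - 2 * (\<Sum>i\<in>B. xlnx (real (d i))) \<le> 104000 * real m ^ 2"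
  proof -
    have "real LB \<le> 320 * real m ^ 2 \<and> real LB * ln (real L) - 2 * (\<Sum>i\<in>B. xlnx (real (d i))) \<le> 104000 * real m ^ 2"
    proof (cases "\<theta> = m")
      case True
      then have "B = {}" using m by (auto simp: B_def)
      then show ?thesis by (simp add: LB_def)
    next
      case False
      then have tm: "\<theta> < m" using \<theta> by simp
      have "{i\<in>V. d i \<le> m} = V" using m by auto
      then have "L < 320 * (m * m)" using above[OF tm] by (simp add: good_def L_def)
      then have "real L \<le> real (320 * (m * m))" by (intro of_nat_mono) simp
      then have Lm: "real L \<le> 320 * real m ^ 2" by (simp add: power2_eq_square)
      then have LBm: "real LB \<le> 320 * real m ^ 2" using L by simp
      have mp: "real m > 0" using m1 by simp
      have lnm: "ln (real L) \<le> 320 + 2 * ln (real m)"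
      proof (cases "L = 0")
        case False
        then have "ln (real L) \<le> ln (320 * real m ^ 2)" using Lm by (intro ln_mono) auto
        also have "\<dots> = ln 320 + 2 * ln (real m)" using mp by (simp add: ln_mult_pos ln_realpow)
        also have "ln (320 :: real) \<le> 320 - 1" by (rule ln_le_minus_one) simp
        finally show ?thesis by simp
      qed (use m1 in simp)
      have "(\<Sum>i\<in>B. real (d i) * (ln (real m) - ln (real (d i)))) \<le> 320 * real m ^ 2"
      proof (rule sum_log_ratio_le[OF finAB(2)])
        show "1 \<le> d i \<and> d i \<le> m" if "i \<in> B" for i using that m by (auto simp: B_def)
        show "real (\<Sum>i\<in>{i\<in>B. d i \<le> j}. d i) \<le> 320 * (real j * real m)" if j: "1 \<le> j" "j \<le> m" for j
        proof (cases "j \<le> \<theta>")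
          case True
          then have "{i\<in>B. d i \<le> j} = {}" by (auto simp: B_def)
          then show ?thesis by (simp only: sum.empty) simp
        next
          case False
          have "(\<Sum>i\<in>{i\<in>B. d i \<le> j}. d i) \<le> (\<Sum>i\<in>{i\<in>V. d i \<le> j}. d i)"
            using fin by (intro sum_mono2) (auto simp: B_def)
          also have "\<dots> \<le> 320 * (j * m)" using above[of j] False j by (simp add: good_def)
          finally show ?thesis using of_nat_mono by fastforce
        qed
      qed
      moreover have "(\<Sum>i\<in>B. real (d i) * (ln (real m) - ln (real (d i)))) = real LB * ln (real m) - (\<Sum>i\<in>B. xlnx (real (d i)))"
        by (simp add: right_diff_distrib sum_subtractf xlnx_def LB_def sum_distrib_right)
      moreover have "real LB * ln (real L) \<le> real LB * (320 + 2 * ln (real m))"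
        by (rule mult_left_mono[OF lnm]) simp
      ultimately have "real LB * ln (real L) - 2 * (\<Sum>i\<in>B. xlnx (real (d i))) \<le> 320 * real LB + 640 * real m ^ 2"
        by (simp add: algebra_simps)
      then show ?thesis using LBm by simp
    qed
    then show "real LB \<le> 320 * real m ^ 2" "real LB * ln (real L) - 2 * (\<Sum>i\<in>B. xlnx (real (d i))) \<le> 104000 * real m ^ 2" by auto
  qed
  \<comment> \<open>\<open>Q1\<close>, \<open>Q2\<close> and \<open>Q4\<close> replace
    \<open>ln L\<close>, \<open>2 * ln m\<close> and \<open>ln (2 * e)\<close> by
    \<open>ln LA\<close> at the cost of \<open>LB\<close>, \<open>m^2\<close> and
    \<open>gfun e\<close>; by \<open>ring\<close> the terms with \<open>ln LA\<close> then
    cancel.\<close>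
  have Q1: "real LA * ln (real L) - real LA * ln (real LA) \<le> real LB"
  proof (cases "LA = 0")
    case False
    then have pos: "real LA > 0" "real L > 0" using L by auto
    then have "real LA * ln (real L / real LA) \<le> real LA * (real L / real LA - 1)"
      by (intro mult_left_mono ln_le_minus_one) auto
    also have "\<dots> = real L - real LA" using pos by (simp add: right_diff_distrib)
    also have "\<dots> = real LB" by (simp add: L)
    finally show ?thesis using pos by (simp add: ln_div right_diff_distrib)
  qed simp
  have Q2: "2 * (real l * ln (real m)) - real l * ln (real LA) \<le> real m ^ 2"
  proof (cases "l = 0")
    case False
    then have LAl: "real l \<le> real LA" and pos: "real LA > 0" using el by (auto simp: LA_def)
    have "ln (real m ^ 2 / real LA) \<le> real m ^ 2 / real LA - 1" using m1 pos by (intro ln_le_minus_one) simp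
    then have "real l * ln (real m ^ 2 / real LA) \<le> real l * (real m ^ 2 / real LA)" by (intro mult_left_mono) auto
    also have "\<dots> \<le> real LA * (real m ^ 2 / real LA)" using LAl by (intro mult_right_mono) auto
    also have "\<dots> = real m ^ 2" using pos by simp
    also have "ln (real m ^ 2 / real LA) = 2 * ln (real m) - ln (real LA)"
      using m1 pos by (simp add: ln_div ln_realpow)
    finally show ?thesis by (simp add: algebra_simps)
  qed simp
  have Q4: "ln (fact e) + real e * ln 2 \<le> real e * ln (real LA) - real e + gfun e"
  proof (cases "e = 0")
    case False
    have "ln (real (2 * e)) \<le> ln (real LA)" using el False by (subst ln_le_cancel_iff) (auto simp: LA_def)
    then have "real e * (ln 2 + ln (real e)) \<le> real e * ln (real LA)"
      using False by (intro mult_left_mono) (auto simp: ln_mult_pos)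
    then show ?thesis using gfun_eq[of e] by (simp add: xlnx_def algebra_simps)
  qed simp
  have ring: "real LA * ln (real LA) = 2 * (real e * ln (real LA)) + real l * ln (real LA)"
    using el(1) by (simp add: LA_def algebra_simps)
  have Ale: "ln (fact LA) \<ge> real LA * ln (real LA) - real LA" using gfun_nonneg[of LA] by (simp add: gfun_eq xlnx_def)
  define c where "c = (if L = 0 then 1 else 1 / real L)"
  have c: "c > 0" by (auto simp: c_def)
  have lnc: "- ln c * (real L / 2) = xlnx (real L) / 2" by (auto simp: c_def xlnx_def ln_div)
  have rL: "(\<Sum>i\<in>V. real (d i)) = real L" by (simp add: L_def)
  have "2 * (c * (\<Sum>g\<in>links V {}. \<Prod>i\<in>g. real (d i))) \<le> c * real L ^ 2"
    using sum_links_prod_le[OF fin, of "\<lambda>i. real (d i)"] c unfolding rL by simp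
  also have "\<dots> = real L" by (simp add: c_def power2_eq_square)
  finally have "total_entropy (links V {}) p \<le> xlnx (real L) / 2 - (\<Sum>i\<in>V. xlnx (real (d i))) + real L / 2"
    using entropy_upper[OF p c] unfolding L_def[symmetric] lnc by simp
  moreover have "xlnx (real L) = real LA * ln (real L) + real LB * ln (real L)" by (simp add: xlnx_def L distrib_right)
  moreover have "(\<Sum>i\<in>V. xlnx (real (d i))) = (\<Sum>i\<in>A. xlnx (real (d i))) + (\<Sum>i\<in>B. xlnx (real (d i)))"
    unfolding V by (rule sum.union_disjoint[OF finAB])
  moreover have "(\<Sum>i\<in>A. gfun (d i)) \<le> (\<Sum>i\<in>V. gfun (d i))"
    using fin V by (intro sum_mono2 gfun_nonneg) auto
  moreover have "gfun e \<le> 1 + ln (1 + real L)"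
  proof -
    have "ln (1 + real e) \<le> ln (1 + real L)" using el L by (simp add: LA_def)
    then show ?thesis using gfun_le_ln_Suc[of e] by linarith
  qed
  moreover have "real (\<theta> * m) \<le> real m ^ 2" using \<theta> by (simp add: power2_eq_square mult_right_mono)
  moreover have "real L = real LA + real LB" "real LA = 2 * real e + real l"
    using L el by (simp_all add: LA_def)
  moreover have "real l \<le> real LB" using el(2) unfolding LB_def by (rule of_nat_mono)
  ultimately show ?thesis
    using low Q1 Q2 Q3 Q4 LBm ring Ale sum_gfun[of d A] unfolding LA_def[symmetric] by linarith
qed

text \<open>For \<open>L < 320 * m^2\<close> the whole sum of \<open>gfun\<close> is at most
  \<open>L\<close>, hence already an admissible error, and a nonnegative gap suffices. Otherwise the
  near-product probabilities are close enough to the reference with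
  \<open>c = 1 / (L - 2 * m)\<close>.\<close>

lemma unipartite_lower:
  fixes d :: "'v \<Rightarrow> nat"
  assumes fin: "finite V" and m: "\<And>i. i \<in> V \<Longrightarrow> d i \<le> m"
    and ne: "graphs_with_degrees (links V {}) V d \<noteq> {}"
  defines "L \<equiv> \<Sum>i\<in>V. d i"
  shows "\<exists>p. feasible_odds (links V {}) V d p \<and>
     (\<Sum>i\<in>V. gfun (d i)) - 110000 * real m ^ 2 - gfun L \<le>
     entropy_gap (links V {}) V d p"
proof (cases "L < 320 * (m * m) \<or> m = 0")
  case True
  interpret degree_problem "links V {}" V d by (rule degree_problem_links[OF fin])
  let ?S = "graphs_with_degrees (links V {}) V d"
  let ?p = "\<lambda>g. real (card {G\<in>?S. g \<in> G}) / real (card ?S)"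
  have "?S \<subseteq> Pow (links V {})" by (auto simp: graphs_with_degrees_def)
  then have "ln (real (card ?S)) \<le> total_entropy (links V {}) ?p"
    using ne by (intro ln_card_le_marginal_entropies finE)
  moreover have "(\<Sum>i\<in>V. gfun (d i)) \<le> 110000 * real m ^ 2"
  proof (cases "m = 0")
    case True
    then have "d i = 0" if "i \<in> V" for i using m[OF that] by simp
    then show ?thesis by simp
  next
    case False
    have "(\<Sum>i\<in>V. gfun (d i)) \<le> (\<Sum>i\<in>V. real (d i))" by (intro sum_mono gfun_le)
    also have "\<dots> = real L" by (simp add: L_def)
    also have "\<dots> \<le> real (320 * (m * m))" using True False by (intro of_nat_mono) simp
    also have "\<dots> = 320 * real m ^ 2" by (simp add: power2_eq_square)
    also have "\<dots> \<le> 110000 * real m ^ 2" by (intro mult_right_mono) auto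
    finally show ?thesis .
  qed
  ultimately have "(\<Sum>i\<in>V. gfun (d i)) - 110000 * real m ^ 2 - gfun L \<le>
     entropy_gap (links V {}) V d ?p" using gfun_nonneg[of L] by linarith
  with feasible_odds_uniform[OF ne] show ?thesis by blast
next
  case False
  then have big: "320 * (m * m) \<le> L" and m1: "1 \<le> m" by auto
  interpret degree_problem "links V {}" V d by (rule degree_problem_links[OF fin])
  have mm: "m \<le> m * m" using m1 by simp
  have "m ^ 2 + 2 * m \<le> L" using big mm unfolding power2_eq_square by linarith
  moreover have "(\<Sum>i\<in>V. d i) = L" by (simp add: L_def)
  ultimately obtain p where p: "feasible_odds (links V {}) V d p"
    and ple: "\<And>g. g \<in> links V {} \<Longrightarrow> p g \<le> 1 / (real L - 2 * real m) * (\<Prod>i\<in>g. real (d i))"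
    using exists_near_product_odds[where d = d, OF fin m _ m1] by blast
  have "320 * m \<le> L" using big mm by linarith
  then have Lm: "320 * real m \<le> real L" using of_nat_mono by fastforce
  have mp: "real m \<ge> 1" using m1 by simp
  have Lpos: "real L > 0" using Lm mp by linarith
  define c where "c = 1 / (real L - 2 * real m)"
  have den: "real L - 2 * real m > 0" "real L / 2 \<le> real L - 2 * real m" using Lm mp by linarith+
  have c: "c > 0" using den by (simp add: c_def)
  have rL: "(\<Sum>i\<in>V. real (d i)) = real L" by (simp add: L_def)
  have "(\<Sum>i\<in>V. real (d i) ^ 2) \<le> (\<Sum>i\<in>V. real m * real (d i))"
    using m by (intro sum_mono) (auto simp: power2_eq_square intro!: mult_right_mono)
  also have "\<dots> = real m * real L" unfolding sum_distrib_left[symmetric] rL ..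
  finally have "(\<Sum>i\<in>V. real (d i) ^ 2) ^ 2 \<le> (real m * real L) ^ 2" by (intro power_mono sum_nonneg) auto
  then have "2 * (\<Sum>g\<in>links V {}. \<Prod>i\<in>g. real (d i) ^ 2) \<le> (real m * real L) ^ 2"
    by (rule order_trans[OF sum_links_prod_le[OF fin], rotated]) simp
  then have "c ^ 2 * (2 * (\<Sum>g\<in>links V {}. \<Prod>i\<in>g. real (d i) ^ 2)) \<le> c ^ 2 * (real m * real L) ^ 2"
    by (intro mult_left_mono) auto
  also have "\<dots> = (c * real L) ^ 2 * real m ^ 2" by (simp add: power_mult_distrib)
  also have "\<dots> \<le> 2 ^ 2 * real m ^ 2"
  proof (intro mult_right_mono power_mono)
    show "c * real L \<le> 2" using den by (simp add: c_def divide_simps)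
  qed (use c in auto)
  finally have sq: "c ^ 2 * (\<Sum>g\<in>links V {}. \<Prod>i\<in>g. real (d i) ^ 2) \<le> 2 * real m ^ 2" by simp
  \<comment> \<open>The price of \<open>L - 2 * m\<close> in place of \<open>L\<close>: with
    \<open>x = 2 * m / L\<close> the logarithm drops by at most \<open>2 * x\<close>, and
    \<open>2 * x * (L / 2) = 2 * m\<close>.\<close>
  have lnc: "xlnx (real L) / 2 - 2 * real m \<le> - ln c * (real L / 2)"
  proof -
    define x where "x = 2 * real m / real L"
    have x: "0 \<le> x" "x \<le> 1/2" using Lm mp Lpos by (auto simp: x_def divide_simps)
    have "- x - 2 * x\<^sup>2 \<le> ln (1 - x)" using x by (rule ln_one_minus_pos_lower_bound)
    moreover have "2 * x\<^sup>2 \<le> x" using mult_left_mono[OF x(2) x(1)] by (simp add: power2_eq_square)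
    ultimately have "- 2 * x \<le> ln (1 - x)" by linarith
    moreover have "- ln c = ln (real L * (1 - x))"
      using den Lpos by (simp add: c_def ln_div x_def algebra_simps)
    moreover have "ln (real L * (1 - x)) = ln (real L) + ln (1 - x)" using Lpos x by (intro ln_mult_pos) auto
    ultimately have "ln (real L) - 2 * x \<le> - ln c" by linarith
    then have "(ln (real L) - 2 * x) * (real L / 2) \<le> - ln c * (real L / 2)" by (intro mult_right_mono) auto
    moreover have "x * real L = 2 * real m" using Lpos by (simp add: x_def)
    ultimately show ?thesis by (simp add: xlnx_def algebra_simps)
  qed
  have ent: "xlnx (real L) / 2 - 2 * real m - (\<Sum>i\<in>V. xlnx (real (d i))) + real L / 2 - 2 * real m ^ 2
      \<le> total_entropy (links V {}) p"
    using entropy_lower[OF p c] ple lnc sq unfolding L_def[symmetric] c_def[symmetric] by fastforce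
  obtain G0 where G0: "G0 \<in> graphs_with_degrees (links V {}) V d" using ne by blast
  define e where "e = card (G0 \<inter> Pow V)"
  have Le: "L = 2 * e"
    using handshake[of V "{}" G0] G0 fin by (simp add: L_def e_def graphs_with_degrees_def)
  have pos: "card (graphs_with_degrees (links V {}) V d) > 0" using ne finite_graphs by (simp add: card_gt_0_iff)
  have "ln (real (card (graphs_with_degrees (links V {}) V d))) \<le>
      ln (fact L) - ln (fact e) - real e * ln 2 - (\<Sum>i\<in>V. ln (fact (d i)))"
    using ln_card_realisations_upper[of V "{}" d e] fin pos Le unfolding realisations_single L_def[symmetric] by simp
  moreover have "xlnx (real L) = 2 * (real e * ln 2) + 2 * xlnx (real e)"
    using Lpos by (cases "e = 0") (auto simp: xlnx_def Le ln_mult_pos algebra_simps)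
  moreover have "real m \<le> real m ^ 2" using mp by (simp add: power2_eq_square)
  moreover have "real L = 2 * real e" by (simp add: Le)
  moreover have "0 \<le> real m ^ 2" by simp
  ultimately have "(\<Sum>i\<in>V. gfun (d i)) - 110000 * real m ^ 2 - gfun L \<le>
     entropy_gap (links V {}) V d p"
    using ent sum_gfun[of d V] gfun_eq[of L] gfun_eq[of e] gfun_nonneg[of e]
    unfolding L_def[symmetric] by linarith
  with p show ?thesis by blast
qed

lemma unipartite_gap:
  fixes d :: "'v \<Rightarrow> nat"
  assumes "finite V" and "\<And>i. i \<in> V \<Longrightarrow> d i \<le> m" and "graphs_with_degrees (links V {}) V d \<noteq> {}"
  shows "gap_within (links V {}) V d (110000 * real m ^ 2 + (1 + ln (1 + real (\<Sum>i\<in>V. d i))))"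
  unfolding gap_within_def
proof (intro conjI allI impI)
  fix p assume "feasible_odds (links V {}) V d p"
  from unipartite_upper[OF assms this]
  show "entropy_gap (links V {}) V d p \<le> (\<Sum>i\<in>V. gfun (d i)) + (110000 * real m ^ 2 + (1 + ln (1 + real (\<Sum>i\<in>V. d i))))"
    by (simp only: add.assoc)
next
  obtain p where "feasible_odds (links V {}) V d p"
    "(\<Sum>i\<in>V. gfun (d i)) - 110000 * real m ^ 2 - gfun (\<Sum>i\<in>V. d i) \<le> entropy_gap (links V {}) V d p"
    using unipartite_lower[OF assms] by blast
  moreover from this(2) have "(\<Sum>i\<in>V. gfun (d i)) - (110000 * real m ^ 2 + (1 + ln (1 + real (\<Sum>i\<in>V. d i)))) \<le> entropy_gap (links V {}) V d p"
    using gfun_le_ln_Suc[of "\<Sum>i\<in>V. d i"] by linarith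
  ultimately show "\<exists>p. feasible_odds (links V {}) V d p \<and>
      (\<Sum>i\<in>V. gfun (d i)) - (110000 * real m ^ 2 + (1 + ln (1 + real (\<Sum>i\<in>V. d i)))) \<le> entropy_gap (links V {}) V d p" by blast
qed

section \<open>Decomposition into pairs of layers\<close>

locale multilayer =
  fixes M :: nat and \<Gamma> :: "nat set set" and n :: "nat \<Rightarrow> nat" and k :: "node \<Rightarrow> nat \<Rightarrow> nat"
  assumes realised: "realised M n \<Gamma> k"
begin

definition linked :: "(nat \<times> nat) set" where
  "linked = {(s, t). s \<in> {1..M} \<and> t \<in> {1..M} \<and> adj \<Gamma> s t = 1}"

text \<open>Ordering the two layers lists each unordered pair once, so every link belongs to exactly
  one \<open>pair_links q\<close>.\<close>

definition layer_pairs :: "(nat \<times> nat) set" where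
  "layer_pairs = {(s, t) \<in> linked. s \<le> t}"

fun pair_links :: "nat \<times> nat \<Rightarrow> node set set" where
  "pair_links (s, t) = (if s = t then links (layer n s) {} else cross_links (layer n s) (layer n t))"

fun pair_nodes :: "nat \<times> nat \<Rightarrow> node set" where
  "pair_nodes (s, t) = layer n s \<union> layer n t"

fun pair_degree :: "nat \<times> nat \<Rightarrow> node \<Rightarrow> nat" where
  "pair_degree (s, t) i = (if fst i = s then k i t else k i s)"

abbreviation "pair_graphs q \<equiv> graphs_with_degrees (pair_links q) (pair_nodes q) (pair_degree q)"
abbreviation "pair_feasible q p \<equiv> feasible_odds (pair_links q) (pair_nodes q) (pair_degree q) p"

abbreviation "pair_gap q p \<equiv> entropy_gap (pair_links q) (pair_nodes q) (pair_degree q) p"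

definition all_links :: "node set set" where
  "all_links = (\<Union>q\<in>layer_pairs. pair_links q)"

definition sort_pair :: "nat \<Rightarrow> nat \<Rightarrow> nat \<times> nat" where
  "sort_pair s t = (min s t, max s t)"

lemma adj_commute: "adj G i j = adj G j i"
  by (simp add: adj_def insert_commute)

lemma mem_layer: "i \<in> layer n s \<longleftrightarrow> fst i = s \<and> snd i < n s"
  by (cases i) (auto simp: layer_def)

lemma finite_layer [simp]: "finite (layer n s)" and card_layer: "card (layer n s) = n s"
  by (simp_all add: layer_def card_cartesian_product)

lemma layer_disjoint: "s \<noteq> t \<Longrightarrow> layer n s \<inter> layer n t = {}"
  by (auto simp: mem_layer)

lemma finite_linked: "finite linked"
  by (rule finite_subset[of _ "{1..M} \<times> {1..M}"]) (auto simp: linked_def)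

lemma finite_layer_pairs: "finite layer_pairs"
  by (rule finite_subset[OF _ finite_linked]) (auto simp: layer_pairs_def)

lemma sort_pair_mem: "(s, t) \<in> linked \<Longrightarrow> sort_pair s t \<in> layer_pairs"
  by (auto simp: sort_pair_def layer_pairs_def linked_def min_def max_def adj_commute)

lemma pair_problem: "degree_problem (pair_links q) (pair_nodes q)"
proof (cases q)
  case (Pair s t)
  then show ?thesis
    using degree_problem_links[of "layer n s"] degree_problem_cross_links[of "layer n s" "layer n t"] layer_disjoint[of s t]
    by auto
qed

lemma finite_pair_links: "finite (pair_links q)"
  by (rule degree_problem.finE[OF pair_problem])

lemma finite_all_links: "finite all_links"
  using finite_layer_pairs finite_pair_links by (simp add: all_links_def)

lemma mem_pair_links:
  "{i, j} \<in> pair_links (sort_pair s t)" if "i \<in> layer n s" "j \<in> layer n t" "i \<noteq> j"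
proof -
  have c: "{i, j} = {j, i}" by auto
  consider "s = t" | "s < t" | "t < s" by linarith
  then show ?thesis
  proof cases
    case 1
    have "{i, j} \<in> links (layer n t) {}" unfolding links_single using that 1 by blast
    then show ?thesis by (simp add: sort_pair_def 1)
  next
    case 2
    have "{j, i} \<in> cross_links (layer n s) (layer n t)" unfolding cross_links_def using that by blast
    then show ?thesis using 2 by (subst c) (simp add: sort_pair_def)
  next
    case 3
    have "{i, j} \<in> cross_links (layer n t) (layer n s)" unfolding cross_links_def using that by blast
    then show ?thesis using 3 by (simp add: sort_pair_def)
  qed
qed

lemma pair_links_ends:
  assumes "g \<in> pair_links q"
  shows "fst ` g = {fst q, snd q}" "\<exists>i j. g = {i, j} \<and> i \<noteq> j \<and> i \<in> layer n (fst q) \<and> j \<in> layer n (snd q)"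
proof -
  obtain s t where q: "q = (s, t)" by (cases q)
  have "\<exists>i j. g = {i, j} \<and> i \<noteq> j \<and> i \<in> layer n s \<and> j \<in> layer n t"
  proof (cases "s = t")
    case True
    then show ?thesis using assms unfolding q by (auto simp: links_single)
  next
    case False
    then obtain x y where "g = {x, y}" "x \<in> layer n t" "y \<in> layer n s"
      using assms unfolding q by (auto simp: cross_links_def)
    moreover from this False have "x \<noteq> y" by (auto simp: mem_layer)
    ultimately show ?thesis by (intro exI[of _ y] exI[of _ x]) auto
  qed
  then show "\<exists>i j. g = {i, j} \<and> i \<noteq> j \<and> i \<in> layer n (fst q) \<and> j \<in> layer n (snd q)" by (simp add: q)
  then show "fst ` g = {fst q, snd q}" by (auto simp: mem_layer)
qed

lemma pair_links_unique:
  assumes "q \<in> layer_pairs" "q' \<in> layer_pairs" "g \<in> pair_links q" "g \<in> pair_links q'"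
  shows "q = q'"
proof -
  have "{fst q, snd q} = {fst q', snd q'}" using pair_links_ends(1)[OF assms(3)] pair_links_ends(1)[OF assms(4)] by simp
  then show ?thesis using assms(1,2) by (auto simp: layer_pairs_def doubleton_eq_iff prod_eq_iff)
qed

lemma multilayer_graphs_eq: "multilayer_graphs M n \<Gamma> = Pow all_links"
proof -
  have "{{i, j} | i j s t. s \<in> {1..M} \<and> t \<in> {1..M} \<and> adj \<Gamma> s t = 1 \<and> i \<in> layer n s \<and> j \<in> layer n t \<and> i \<noteq> j} = all_links"
  proof (intro equalityI subsetI)
    fix g assume "g \<in> {{i, j} | i j s t. s \<in> {1..M} \<and> t \<in> {1..M} \<and> adj \<Gamma> s t = 1 \<and> i \<in> layer n s \<and> j \<in> layer n t \<and> i \<noteq> j}"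
    then obtain i j s t where g: "g = {i, j}" "(s, t) \<in> linked" "i \<in> layer n s" "j \<in> layer n t" "i \<noteq> j"
      by (auto simp: linked_def)
    then show "g \<in> all_links" using mem_pair_links[OF g(3-5)] sort_pair_mem[OF g(2)] by (auto simp: all_links_def)
  next
    fix g assume "g \<in> all_links"
    then obtain q where q: "q \<in> layer_pairs" "g \<in> pair_links q" by (auto simp: all_links_def)
    obtain i j where "g = {i, j}" "i \<noteq> j" "i \<in> layer n (fst q)" "j \<in> layer n (snd q)"
      using pair_links_ends(2)[OF q(2)] by blast
    moreover have "fst q \<in> {1..M}" "snd q \<in> {1..M}" "adj \<Gamma> (fst q) (snd q) = 1"
      using q(1) by (auto simp: layer_pairs_def linked_def)
    ultimately show "g \<in> {{i, j} | i j s t. s \<in> {1..M} \<and> t \<in> {1..M} \<and> adj \<Gamma> s t = 1 \<and> i \<in> layer n s \<and> j \<in> layer n t \<and> i \<noteq> j}" by blast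
  qed
  then show ?thesis by (simp add: multilayer_graphs_def)
qed

text \<open>This writes a targeted degree as a sum of indicators over links, the additive form that
  \<open>canonical_entropy_as_bernoulli\<close> requires.\<close>

definition incident :: "node set \<Rightarrow> node \<times> nat \<Rightarrow> bool" where
  "incident g = (\<lambda>(i, t). g \<in> pair_links (sort_pair (fst i) t) \<and> i \<in> g)"

lemma incident_iff:
  assumes "i \<in> layer n s" "g \<in> all_links"
  shows "incident g (i, t) \<longleftrightarrow> (\<exists>j\<in>layer n t. g = {i, j})"
proof
  assume "incident g (i, t)"
  then have g: "g \<in> pair_links (sort_pair s t)" "i \<in> g" using assms(1) by (auto simp: incident_def mem_layer)
  obtain x y where xy: "g = {x, y}" "x \<noteq> y" "x \<in> layer n (min s t)" "y \<in> layer n (max s t)"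
    using pair_links_ends(2)[OF g(1)] by (auto simp: sort_pair_def)
  have fs: "fst i = s" using assms(1) by (simp add: mem_layer)
  show "\<exists>j\<in>layer n t. g = {i, j}"
  proof (cases "i = x")
    case True
    then have "min s t = s" using xy(3) fs by (simp add: mem_layer)
    then have "max s t = t" by (auto simp: min_def max_def split: if_splits)
    then show ?thesis using xy True by auto
  next
    case False
    then have "i = y" using g(2) xy(1) by simp
    then have "max s t = s" using xy(4) fs by (simp add: mem_layer)
    then have "min s t = t" by (auto simp: min_def max_def split: if_splits)
    then show ?thesis using xy \<open>i = y\<close> by auto
  qed
next
  assume "\<exists>j\<in>layer n t. g = {i, j}"
  then obtain j where j: "j \<in> layer n t" "g = {i, j}" by blast
  obtain q where "g \<in> pair_links q" using assms(2) by (auto simp: all_links_def)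
  then have "i \<noteq> j" using pair_links_ends(2)[of g q] j by (auto simp: doubleton_eq_iff)
  then show "incident g (i, t)"
    using mem_pair_links[OF assms(1) j(1)] assms(1) j by (auto simp: incident_def mem_layer)
qed

lemma tdegree_eq:
  assumes "i \<in> layer n s" "G \<subseteq> all_links"
  shows "tdegree n G i t = card {g\<in>G. incident g (i, t)}"
proof -
  have "tdegree n G i t = card {j\<in>layer n t. {i, j} \<in> G}"
    by (simp add: tdegree_def adj_def sum.If_cases Int_def)
  also have "\<dots> = card ((\<lambda>j. {i, j}) ` {j\<in>layer n t. {i, j} \<in> G})"
    by (rule card_image[symmetric]) (auto simp: inj_on_def doubleton_eq_iff)
  also have "(\<lambda>j. {i, j}) ` {j\<in>layer n t. {i, j} \<in> G} = {g\<in>G. incident g (i, t)}"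
    using incident_iff[OF assms(1), of _ t] assms(2) by auto
  finally show ?thesis .
qed

lemma constraint_index_cases:
  "x \<in> constraint_index M n \<Gamma> \<longleftrightarrow> (\<exists>i t s. x = (i, t) \<and> (s, t) \<in> linked \<and> i \<in> layer n s)"
  by (auto simp: constraint_index_def linked_def)

text \<open>A change of index from (node, target layer) to (pair, node). It is stated for an
  arbitrary \<open>P\<close> because it is applied both to the degrees of a graph and to the mean
  degrees of link probabilities.\<close>

lemma constraints_iff_pairs:
  "(\<forall>(i, t)\<in>constraint_index M n \<Gamma>. P (sort_pair (fst i) t) i (k i t)) \<longleftrightarrow>
   (\<forall>q\<in>layer_pairs. \<forall>i\<in>pair_nodes q. P q i (pair_degree q i))"
proof (intro iffI ballI)
  fix q i assume A: "\<forall>(i, t)\<in>constraint_index M n \<Gamma>. P (sort_pair (fst i) t) i (k i t)" and q: "q \<in> layer_pairs" and i: "i \<in> pair_nodes q"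
  obtain s t where st: "q = (s, t)" by (cases q)
  have l: "(s, t) \<in> linked" "s \<le> t" "(t, s) \<in> linked"
    using q by (auto simp: st layer_pairs_def linked_def adj_commute)
  show "P q i (pair_degree q i)"
  proof (cases "fst i = s")
    case True
    then have "i \<in> layer n s" using i by (auto simp: st mem_layer)
    then have "(i, t) \<in> constraint_index M n \<Gamma>" using l constraint_index_cases by blast
    from bspec[OF A this] show ?thesis using True l by (simp add: st sort_pair_def min_def max_def)
  next
    case False
    then have "i \<in> layer n t" "fst i = t" using i by (auto simp: st mem_layer)
    then have "(i, s) \<in> constraint_index M n \<Gamma>" using l constraint_index_cases by blast
    from bspec[OF A this] show ?thesis using False \<open>fst i = t\<close> l by (simp add: st sort_pair_def min_def max_def)
  qed
next
  fix x assume A: "\<forall>q\<in>layer_pairs. \<forall>i\<in>pair_nodes q. P q i (pair_degree q i)" and "x \<in> constraint_index M n \<Gamma>"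
  then obtain i t s where x: "x = (i, t)" "(s, t) \<in> linked" "i \<in> layer n s" using constraint_index_cases by blast
  have fs: "fst i = s" using x(3) by (simp add: mem_layer)
  have "i \<in> pair_nodes (sort_pair s t)" using x(3) by (simp add: sort_pair_def min_def max_def)
  then have "P (sort_pair s t) i (pair_degree (sort_pair s t) i)" using A sort_pair_mem[OF x(2)] by blast
  moreover have "pair_degree (sort_pair s t) i = k i t" using fs by (auto simp: sort_pair_def min_def max_def)
  ultimately show "case x of (i, t) \<Rightarrow> P (sort_pair (fst i) t) i (k i t)" by (simp add: x fs)
qed

lemma all_links_Int: "G \<subseteq> all_links \<Longrightarrow> G = (\<Union>q\<in>layer_pairs. G \<inter> pair_links q)"
  by (auto simp: all_links_def)

lemma degree_constraints_iff:
  assumes "G \<subseteq> all_links"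
  shows "(\<forall>(i, t)\<in>constraint_index M n \<Gamma>. tdegree n G i t = k i t) \<longleftrightarrow> (\<forall>q\<in>layer_pairs. G \<inter> pair_links q \<in> pair_graphs q)"
proof -
  have "(\<forall>(i, t)\<in>constraint_index M n \<Gamma>. tdegree n G i t = k i t) \<longleftrightarrow>
     (\<forall>(i, t)\<in>constraint_index M n \<Gamma>. (\<lambda>q i d. card {g\<in>G \<inter> pair_links q. i \<in> g} = d) (sort_pair (fst i) t) i (k i t))"
  proof (rule ball_cong[OF refl])
    fix x assume "x \<in> constraint_index M n \<Gamma>"
    then obtain i t s where x: "x = (i, t)" "i \<in> layer n s" using constraint_index_cases by blast
    have "{g\<in>G. incident g (i, t)} = {g\<in>G \<inter> pair_links (sort_pair (fst i) t). i \<in> g}" by (auto simp: incident_def)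
    then show "(case x of (i, t) \<Rightarrow> tdegree n G i t = k i t) =
      (case x of (i, t) \<Rightarrow> (\<lambda>q i d. card {g\<in>G \<inter> pair_links q. i \<in> g} = d) (sort_pair (fst i) t) i (k i t))"
      using tdegree_eq[OF x(2) assms, of t] by (simp add: x)
  qed
  also have "\<dots> \<longleftrightarrow> (\<forall>q\<in>layer_pairs. \<forall>i\<in>pair_nodes q. card {g\<in>G \<inter> pair_links q. i \<in> g} = pair_degree q i)"
    by (rule constraints_iff_pairs)
  finally show ?thesis by (simp add: graphs_with_degrees_def)
qed

lemma feasible_iff_pairs:
  "(\<forall>g\<in>all_links. 0 \<le> p g \<and> p g \<le> (1::real)) \<and>
   (\<forall>x\<in>constraint_index M n \<Gamma>. (\<Sum>g\<in>all_links. p g * of_bool (incident g x)) = (\<lambda>(i, t). real (k i t)) x) \<longleftrightarrow>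
   (\<forall>q\<in>layer_pairs. pair_feasible q p)"
proof -
  have "(\<forall>x\<in>constraint_index M n \<Gamma>. (\<Sum>g\<in>all_links. p g * of_bool (incident g x)) = (\<lambda>(i, t). real (k i t)) x) \<longleftrightarrow>
     (\<forall>(i, t)\<in>constraint_index M n \<Gamma>. (\<lambda>q i d. (\<Sum>g\<in>pair_links q. p g * of_bool (i \<in> g)) = real d) (sort_pair (fst i) t) i (k i t))"
  proof (rule ball_cong[OF refl])
    fix x assume "x \<in> constraint_index M n \<Gamma>"
    then obtain i t s where x: "x = (i, t)" "(s, t) \<in> linked" "i \<in> layer n s" using constraint_index_cases by blast
    have "sort_pair (fst i) t \<in> layer_pairs" using sort_pair_mem[OF x(2)] x(3) by (simp add: mem_layer)
    then have "(\<Sum>g\<in>all_links. p g * of_bool (incident g (i, t))) = (\<Sum>g\<in>pair_links (sort_pair (fst i) t). p g * of_bool (i \<in> g))"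
      by (intro sum.mono_neutral_cong_right finite_all_links) (auto simp: incident_def all_links_def)
    then show "((\<Sum>g\<in>all_links. p g * of_bool (incident g x)) = (\<lambda>(i, t). real (k i t)) x) =
      (case x of (i, t) \<Rightarrow> (\<lambda>q i d. (\<Sum>g\<in>pair_links q. p g * of_bool (i \<in> g)) = real d) (sort_pair (fst i) t) i (k i t))"
      by (simp add: x)
  qed
  also have "\<dots> \<longleftrightarrow> (\<forall>q\<in>layer_pairs. \<forall>i\<in>pair_nodes q. (\<Sum>g\<in>pair_links q. p g * of_bool (i \<in> g)) = real (pair_degree q i))"
    by (rule constraints_iff_pairs)
  finally show ?thesis by (auto simp: feasible_odds_def all_links_def)
qed

section \<open>Factorisation over the pairs of layers\<close>

definition solutions :: "node set set set" where
  "solutions = {G. G \<subseteq> all_links \<and> (\<forall>q\<in>layer_pairs. G \<inter> pair_links q \<in> pair_graphs q)}"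

lemma solutions_nonempty: "solutions \<noteq> {}"
proof -
  obtain G where "G \<subseteq> all_links" "\<forall>(i, t)\<in>constraint_index M n \<Gamma>. tdegree n G i t = k i t"
    using realised unfolding realised_def multilayer_graphs_eq by blast
  then show ?thesis using degree_constraints_iff[of G] by (auto simp: solutions_def)
qed

lemma pair_graphs_nonempty: "q \<in> layer_pairs \<Longrightarrow> pair_graphs q \<noteq> {}"
  using solutions_nonempty by (auto simp: solutions_def)

text \<open>Restricting a graph to each pair is a bijection onto independent choices, since the link
  sets of different pairs are disjoint.\<close>

lemma ln_card_solutions: "ln (real (card solutions)) = (\<Sum>q\<in>layer_pairs. ln (real (card (pair_graphs q))))"
proof -
  have fin: "finite (pair_graphs q)" for q
    by (rule degree_problem.finite_graphs[OF pair_problem])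
  have "bij_betw (\<lambda>G. \<lambda>q\<in>layer_pairs. G \<inter> pair_links q) solutions (PiE layer_pairs pair_graphs)"
  proof (rule bij_betw_byWitness[where f' = "\<lambda>F. \<Union>q\<in>layer_pairs. F q"])
    show "\<forall>G\<in>solutions. (\<Union>q\<in>layer_pairs. (\<lambda>q\<in>layer_pairs. G \<inter> pair_links q) q) = G"
      using all_links_Int by (simp add: solutions_def cong: SUP_cong)
    have restr: "(\<Union>q'\<in>layer_pairs. F q') \<inter> pair_links q = F q"
      if F: "F \<in> PiE layer_pairs pair_graphs" and q: "q \<in> layer_pairs" for F q
    proof -
      have "F q' \<subseteq> pair_links q'" if "q' \<in> layer_pairs" for q'
        using PiE_mem[OF F that] by (simp add: graphs_with_degrees_def)
      then show ?thesis using q pair_links_unique[OF _ q] by blast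
    qed
    show "\<forall>F\<in>PiE layer_pairs pair_graphs. (\<lambda>q\<in>layer_pairs. (\<Union>q\<in>layer_pairs. F q) \<inter> pair_links q) = F"
    proof (intro ballI ext)
      fix F q assume F: "F \<in> PiE layer_pairs pair_graphs"
      show "(\<lambda>q\<in>layer_pairs. (\<Union>q\<in>layer_pairs. F q) \<inter> pair_links q) q = F q"
        using restr[OF F, of q] PiE_arb[OF F, of q] by (cases "q \<in> layer_pairs") simp_all
    qed
    show "(\<lambda>G. \<lambda>q\<in>layer_pairs. G \<inter> pair_links q) ` solutions \<subseteq> PiE layer_pairs pair_graphs"
      by (auto simp: solutions_def)
    show "(\<lambda>F. \<Union>q\<in>layer_pairs. F q) ` PiE layer_pairs pair_graphs \<subseteq> solutions"
    proof clarify
      fix F assume F: "F \<in> PiE layer_pairs pair_graphs"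
      then have "F q \<subseteq> pair_links q" if "q \<in> layer_pairs" for q
        using PiE_mem[OF F that] by (simp add: graphs_with_degrees_def)
      then have "(\<Union>q\<in>layer_pairs. F q) \<subseteq> all_links" by (auto simp: all_links_def)
      moreover have "(\<Union>q'\<in>layer_pairs. F q') \<inter> pair_links q \<in> pair_graphs q" if "q \<in> layer_pairs" for q
        using restr[OF F that] PiE_mem[OF F that] by simp
      ultimately show "(\<Union>q\<in>layer_pairs. F q) \<in> solutions" by (simp add: solutions_def)
    qed
  qed
  then have "card solutions = (\<Prod>q\<in>layer_pairs. card (pair_graphs q))"
    using card_PiE[OF finite_layer_pairs, of pair_graphs] by (simp add: bij_betw_same_card)
  moreover have "card (pair_graphs q) \<noteq> 0" if "q \<in> layer_pairs" for q
    using pair_graphs_nonempty[OF that] fin by simp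
  ultimately show ?thesis by (simp add: ln_prod finite_layer_pairs)
qed

lemma sum_all_links: "(\<Sum>g\<in>all_links. f g) = (\<Sum>q\<in>layer_pairs. \<Sum>g\<in>pair_links q. f g)"
  unfolding all_links_def
  by (rule sum.UNION_disjoint) (use finite_layer_pairs finite_pair_links pair_links_unique in blast)+

lemma relative_entropy_bounds:
  defines "S \<equiv> relative_entropy (multilayer_graphs M n \<Gamma>) (P_mic M n \<Gamma> k) (P_can M n \<Gamma> k)"
  shows "\<And>p. (\<And>q. q \<in> layer_pairs \<Longrightarrow> pair_feasible q p) \<Longrightarrow>
      (\<Sum>q\<in>layer_pairs. pair_gap q p) \<le> S"
    and "\<exists>p. (\<forall>q\<in>layer_pairs. pair_feasible q p) \<and>
      S \<le> (\<Sum>q\<in>layer_pairs. pair_gap q p)"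
proof -
  let ?I = "constraint_index M n \<Gamma>" and ?c = "\<lambda>(i, t). real (k i t)"
  have sol: "{G \<in> Pow all_links. \<forall>x\<in>?I. degree_constraint n G x = ?c x} = solutions"
  proof -
    have "(\<forall>x\<in>?I. degree_constraint n G x = ?c x) \<longleftrightarrow> (\<forall>(i, t)\<in>?I. tdegree n G i t = k i t)" for G
      by (auto simp: degree_constraint_def)
    then show ?thesis unfolding solutions_def Pow_iff
      by (intro Collect_cong conj_cong refl) (simp only: degree_constraints_iff)
  qed
  have finP: "finite (Pow all_links)" using finite_all_links by simp
  note rel = relative_entropy_microcanonical_canonical[OF finP, of ?I "degree_constraint n" ?c, unfolded sol, OF solutions_nonempty]
  have S: "S = shannon_entropy (Pow all_links) (canonical (Pow all_links) ?I (degree_constraint n) ?c)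
     - (\<Sum>q\<in>layer_pairs. ln (real (card (pair_graphs q))))"
    unfolding S_def P_mic_def P_can_def multilayer_graphs_eq rel(2) ln_card_solutions ..
  have C: "degree_constraint n G x = (\<Sum>g\<in>G. of_bool (incident g x))" if G: "G \<subseteq> all_links" and mem: "x \<in> ?I" for G x
  proof -
    obtain i t s where x: "x = (i, t)" "i \<in> layer n s" using mem constraint_index_cases by blast
    have "finite G" using G finite_all_links finite_subset by blast
    then show ?thesis using tdegree_eq[OF x(2) G, of t] by (simp add: degree_constraint_def x Int_def)
  qed
  have ne: "feasible_pmfs (Pow all_links) ?I (degree_constraint n) ?c \<noteq> {}" using rel(1) by blast
  note can = canonical_entropy_as_bernoulli[OF finite_all_links ne C, unfolded feasible_iff_pairs, unfolded sum_all_links]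
  show "(\<Sum>q\<in>layer_pairs. pair_gap q p) \<le> S"
    if "\<And>q. q \<in> layer_pairs \<Longrightarrow> pair_feasible q p" for p
    using can(1)[of p] that unfolding S sum_subtractf by simp
  show "\<exists>p. (\<forall>q\<in>layer_pairs. pair_feasible q p) \<and>
      S \<le> (\<Sum>q\<in>layer_pairs. pair_gap q p)"
    using can(2) unfolding S sum_subtractf by simp
qed

section \<open>Main term and error\<close>

text \<open>The main term runs over ordered pairs: two distinct layers occur twice, once with each
  of their degree sequences, as in the limit formula.\<close>

definition excess :: real where
  "excess = (\<Sum>(s, t)\<in>linked. \<Sum>i\<in>layer n s. gfun (k i t))"

text \<open>The single-layer error with \<open>m^2\<close> replaced by the product of the two
  maximal degrees. It also dominates the two-layer error, so one expression covers both
  cases.\<close>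

definition pair_error :: "nat \<times> nat \<Rightarrow> real" where
  "pair_error = (\<lambda>(s, t). 110000 * (real (max_degree n k s t) * real (max_degree n k t s)) + (1 + ln (1 + real (total_links n k s t))))"

lemma excess_eq: "excess = (\<Sum>q\<in>layer_pairs. \<Sum>i\<in>pair_nodes q. gfun (pair_degree q i))"
proof -
  define F where "F q = (\<Sum>i\<in>layer n (fst q). gfun (k i (snd q)))" for q
  define D where "D = {q\<in>layer_pairs. fst q \<noteq> snd q}"
  have finD: "finite D" using finite_layer_pairs by (simp add: D_def)
  have "linked = layer_pairs \<union> prod.swap ` D"
  proof (intro equalityI subsetI)
    fix q assume q: "q \<in> linked"
    show "q \<in> layer_pairs \<union> prod.swap ` D"
    proof (cases "fst q \<le> snd q")
      case False
      then have "prod.swap q \<in> D" using q by (auto simp: D_def layer_pairs_def linked_def adj_commute)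
      then show ?thesis by (metis UnI2 imageI swap_swap)
    qed (use q in \<open>auto simp: layer_pairs_def\<close>)
  qed (auto simp: layer_pairs_def linked_def D_def adj_commute)
  moreover have "layer_pairs \<inter> prod.swap ` D = {}" by (auto simp: layer_pairs_def D_def)
  ultimately have "(\<Sum>q\<in>linked. F q) = (\<Sum>q\<in>layer_pairs. F q) + (\<Sum>q\<in>prod.swap ` D. F q)"
    using finite_layer_pairs finD by (simp add: sum.union_disjoint)
  also have "(\<Sum>q\<in>prod.swap ` D. F q) = (\<Sum>q\<in>D. F (prod.swap q))"
    by (subst sum.reindex) (auto simp: inj_on_def)
  also have "\<dots> = (\<Sum>q\<in>layer_pairs. if fst q \<noteq> snd q then F (prod.swap q) else 0)"
    unfolding D_def by (rule sum.mono_neutral_cong_left) (use finite_layer_pairs in auto)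
  finally have "(\<Sum>q\<in>linked. F q) = (\<Sum>q\<in>layer_pairs. F q + (if fst q \<noteq> snd q then F (prod.swap q) else 0))"
    by (simp add: sum.distrib)
  also have "\<dots> = (\<Sum>q\<in>layer_pairs. \<Sum>i\<in>pair_nodes q. gfun (pair_degree q i))"
  proof (rule sum.cong[OF refl])
    fix q assume "q \<in> layer_pairs"
    obtain s t where q: "q = (s, t)" by (cases q)
    have 1: "(\<Sum>i\<in>layer n s. gfun (pair_degree q i)) = F (s, t)"
      unfolding F_def q by (rule sum.cong) (auto simp: mem_layer)
    show "F q + (if fst q \<noteq> snd q then F (prod.swap q) else 0) = (\<Sum>i\<in>pair_nodes q. gfun (pair_degree q i))"
    proof (cases "s = t")
      case False
      have "(\<Sum>i\<in>layer n t. gfun (pair_degree q i)) = F (t, s)"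
        unfolding F_def q by (rule sum.cong) (use False in \<open>auto simp: mem_layer\<close>)
      then show ?thesis using 1 False layer_disjoint[OF False] by (simp add: q sum.union_disjoint)
    qed (use 1 in \<open>simp add: q\<close>)
  qed
  finally show ?thesis by (simp add: excess_def F_def case_prod_unfold)
qed

lemma degree_le_max: "i \<in> layer n s \<Longrightarrow> k i t \<le> max_degree n k s t"
  unfolding max_degree_def by (rule Max_ge) auto

lemma total_links_commute:
  assumes "(s, t) \<in> linked"
  shows "total_links n k s t = total_links n k t s"
proof -
  have gen: "total_links n k s t = total_links n k t s" if q: "(s, t) \<in> layer_pairs" and ne: "s \<noteq> t" for s t
  proof -
    obtain G where G: "G \<in> pair_graphs (s, t)" using pair_graphs_nonempty[OF q] by blast
    have disj: "layer n s \<inter> layer n t = {}" by (rule layer_disjoint[OF ne])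
    have sub: "G \<subseteq> cross_links (layer n s) (layer n t)" using G ne by (simp add: graphs_with_degrees_def)
    have "cross_links (layer n s) (layer n t) \<subseteq> links (layer n s) (layer n t)"
      unfolding cross_links_def links_def using disj by blast
    with sub have "(\<Sum>i\<in>layer n s. card {g\<in>G. i \<in> g}) = 2 * card (G \<inter> Pow (layer n s)) + (\<Sum>i\<in>layer n t. card {g\<in>G. i \<in> g})"
      by (intro handshake disj) auto
    moreover have "G \<inter> Pow (layer n s) = {}" using sub disj unfolding cross_links_def by blast
    moreover have "(\<Sum>i\<in>layer n s. card {g\<in>G. i \<in> g}) = total_links n k s t"
      unfolding total_links_def using G by (intro sum.cong refl) (auto simp: graphs_with_degrees_def mem_layer)
    moreover have "(\<Sum>i\<in>layer n t. card {g\<in>G. i \<in> g}) = total_links n k t s"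
      unfolding total_links_def using G ne by (intro sum.cong refl) (auto simp: graphs_with_degrees_def mem_layer)
    ultimately show ?thesis by simp
  qed
  consider "s = t" | "s < t" | "t < s" by linarith
  then show ?thesis
  proof cases
    case 2
    then show ?thesis using gen[of s t] assms by (simp add: layer_pairs_def)
  next
    case 3
    then show ?thesis using gen[of t s] assms by (simp add: layer_pairs_def linked_def adj_commute)
  qed simp
qed

text \<open>The first bound is used to compare the product of the maximal degrees with the number of
  nodes, the second to make the logarithm of the number of links negligible.\<close>

lemma total_links_le:
  shows "total_links n k s t \<le> n s * max_degree n k s t"
    and "(s, t) \<in> linked \<Longrightarrow> total_links n k s t \<le> n s * n t"
proof -
  have "total_links n k s t \<le> (\<Sum>i\<in>layer n s. max_degree n k s t)"
    unfolding total_links_def by (intro sum_mono degree_le_max)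
  then show "total_links n k s t \<le> n s * max_degree n k s t" by (simp add: card_layer)
  assume st: "(s, t) \<in> linked"
  obtain G where G: "\<forall>(i, t)\<in>constraint_index M n \<Gamma>. tdegree n G i t = k i t"
    using realised unfolding realised_def by blast
  have "k i t \<le> n t" if "i \<in> layer n s" for i
  proof -
    have "(i, t) \<in> constraint_index M n \<Gamma>" using st that constraint_index_cases by blast
    from bspec[OF G this] have "k i t = tdegree n G i t" by simp
    also have "\<dots> \<le> (\<Sum>j\<in>layer n t. 1)" unfolding tdegree_def by (rule sum_mono) (simp add: adj_def)
    finally show ?thesis by (simp add: card_layer)
  qed
  then have "total_links n k s t \<le> (\<Sum>i\<in>layer n s. n t)" unfolding total_links_def by (intro sum_mono)
  then show "total_links n k s t \<le> n s * n t" by (simp add: card_layer)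
qed

lemma pair_gap_within:
  assumes q: "q \<in> layer_pairs"
    and sparse: "fst q \<noteq> snd q \<Longrightarrow> 320 * (max_degree n k (fst q) (snd q) * max_degree n k (snd q) (fst q)) \<le> total_links n k (fst q) (snd q)"
  shows "gap_within (pair_links q) (pair_nodes q) (pair_degree q) (pair_error q)"
proof -
  obtain s t where st: "q = (s, t)" by (cases q)
  have b: "pair_degree q i \<le> max_degree n k s t" if "i \<in> layer n s" for i
    using degree_le_max[OF that] that by (simp add: st mem_layer)
  have L: "(\<Sum>i\<in>layer n s. pair_degree q i) = total_links n k s t"
    unfolding total_links_def st by (intro sum.cong refl) (auto simp: mem_layer)
  show ?thesis
  proof (cases "s = t")
    case True
    have e: "pair_links q = links (layer n s) {}" "pair_nodes q = layer n s" by (simp_all add: st True)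
    have ne: "graphs_with_degrees (links (layer n s) {}) (layer n s) (pair_degree q) \<noteq> {}"
      using pair_graphs_nonempty[OF q] unfolding e .
    have "110000 * real (max_degree n k s t) ^ 2 + (1 + ln (1 + real (total_links n k s t))) = pair_error q"
      unfolding st pair_error_def prod.case using True by (simp add: power2_eq_square)
    with unipartite_gap[where d = "pair_degree q" and V = "layer n s", OF finite_layer b ne, unfolded L]
    show ?thesis unfolding e by simp
  next
    case False
    have disj: "layer n s \<inter> layer n t = {}" by (rule layer_disjoint[OF False])
    have b': "pair_degree q i \<le> max_degree n k t s" if "i \<in> layer n t" for i
      using degree_le_max[OF that] that False by (auto simp: st mem_layer)
    have "(\<Sum>i\<in>layer n t. pair_degree q i) = total_links n k t s"
      unfolding total_links_def st using False by (intro sum.cong refl) (auto simp: mem_layer)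
    then have L': "(\<Sum>i\<in>layer n t. pair_degree q i) = total_links n k s t"
      using total_links_commute[of s t] q by (simp add: st layer_pairs_def)
    have sp: "320 * (max_degree n k s t * max_degree n k t s) \<le> total_links n k s t" using sparse False by (simp add: st)
    have e: "pair_links q = cross_links (layer n s) (layer n t)" "pair_nodes q = layer n s \<union> layer n t"
      using False by (simp_all add: st)
    have "0 \<le> real (max_degree n k s t) * real (max_degree n k t s)" by simp
    then have "20 * real (max_degree n k s t * max_degree n k t s) + gfun (total_links n k s t) \<le> pair_error q"
      using gfun_le_ln_Suc[of "total_links n k s t"] unfolding st pair_error_def prod.case of_nat_mult by linarith
    with bipartite_gap[where d = "pair_degree q", OF finite_layer finite_layer disj L L' b b' sp]
    show ?thesis unfolding e by (rule gap_within_mono)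
  qed
qed

lemma relative_entropy_approx:
  assumes sparse: "\<And>s t. (s, t) \<in> layer_pairs \<Longrightarrow> s \<noteq> t \<Longrightarrow> 320 * (max_degree n k s t * max_degree n k t s) \<le> total_links n k s t"
  shows "\<bar>relative_entropy (multilayer_graphs M n \<Gamma>) (P_mic M n \<Gamma> k) (P_can M n \<Gamma> k) - excess\<bar> \<le> (\<Sum>q\<in>layer_pairs. pair_error q)"
proof -
  let ?S = "relative_entropy (multilayer_graphs M n \<Gamma>) (P_mic M n \<Gamma> k) (P_can M n \<Gamma> k)"
  have sp: "320 * (max_degree n k (fst q) (snd q) * max_degree n k (snd q) (fst q)) \<le> total_links n k (fst q) (snd q)"
    if "q \<in> layer_pairs" "fst q \<noteq> snd q" for q using sparse[of "fst q" "snd q"] that by simp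
  note gap = pair_gap_within[OF _ sp, unfolded gap_within_def]
  obtain p where p: "\<And>q. q \<in> layer_pairs \<Longrightarrow> pair_feasible q p" "?S \<le> (\<Sum>q\<in>layer_pairs. pair_gap q p)"
    using relative_entropy_bounds(2) by blast
  have "(\<Sum>q\<in>layer_pairs. pair_gap q p) \<le> (\<Sum>q\<in>layer_pairs. (\<Sum>i\<in>pair_nodes q. gfun (pair_degree q i)) + pair_error q)"
    using gap p(1) by (intro sum_mono) blast
  then have upper: "?S \<le> excess + (\<Sum>q\<in>layer_pairs. pair_error q)"
    using p(2) by (simp add: excess_eq sum.distrib)
  obtain P where P: "pair_feasible q (P q)" "(\<Sum>i\<in>pair_nodes q. gfun (pair_degree q i)) - pair_error q \<le> pair_gap q (P q)"
    if "q \<in> layer_pairs" for q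
    using gap by metis
  \<comment> \<open>Each link lies in exactly one pair, so the separate choices glue to one
    function. \<open>relative_entropy_bounds\<close> asks for such a common
    \<open>p\<close>.\<close>
  define p' where "p' g = P (THE q. q \<in> layer_pairs \<and> g \<in> pair_links q) g" for g
  have p': "p' g = P q g" if "q \<in> layer_pairs" "g \<in> pair_links q" for q g
  proof -
    have "(THE q. q \<in> layer_pairs \<and> g \<in> pair_links q) = q"
      using that by (intro the_equality) (blast intro: pair_links_unique)+
    then show ?thesis by (simp add: p'_def)
  qed
  have "pair_feasible q p'" if "q \<in> layer_pairs" for q
    using P(1)[OF that] p'[OF that] unfolding feasible_odds_def by (auto cong: sum.cong)
  then have "(\<Sum>q\<in>layer_pairs. pair_gap q p') \<le> ?S" by (rule relative_entropy_bounds(1))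
  moreover have "(\<Sum>q\<in>layer_pairs. pair_gap q p') = (\<Sum>q\<in>layer_pairs. pair_gap q (P q))"
    by (intro sum.cong refl arg_cong2[of _ _ _ _ "(-)"]) (simp add: p')
  moreover have "(\<Sum>q\<in>layer_pairs. (\<Sum>i\<in>pair_nodes q. gfun (pair_degree q i)) - pair_error q) \<le> (\<Sum>q\<in>layer_pairs. pair_gap q (P q))"
    by (intro sum_mono P(2))
  ultimately have "excess - (\<Sum>q\<in>layer_pairs. pair_error q) \<le> ?S"
    by (simp add: excess_eq sum_subtractf)
  with upper show ?thesis by (simp add: abs_le_iff)
qed

end

section \<open>The limit\<close>

lemma l1g_norm_nonneg: "0 \<le> l1g_norm h"
  unfolding l1g_norm_def by (rule suminf_0_le) (simp add: gfun_nonneg)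

lemma l1g_norm_triangle: "l1g_norm h \<le> l1g_norm h' + l1g_norm (\<lambda>x. h x - h' x)"
proof -
  have "l1g_norm h \<le> (\<Sum>x. ereal (\<bar>h' x\<bar> * gfun x) + ereal (\<bar>h x - h' x\<bar> * gfun x))"
    unfolding l1g_norm_def
  proof (rule suminf_le_pos)
    fix x
    have "\<bar>h x\<bar> * gfun x \<le> (\<bar>h' x\<bar> + \<bar>h x - h' x\<bar>) * gfun x"
      by (intro mult_right_mono gfun_nonneg) linarith
    then show "ereal (\<bar>h x\<bar> * gfun x) \<le> ereal (\<bar>h' x\<bar> * gfun x) + ereal (\<bar>h x - h' x\<bar> * gfun x)"
      by (simp add: distrib_right)
  qed (simp add: gfun_nonneg)
  also have "\<dots> = l1g_norm h' + l1g_norm (\<lambda>x. h x - h' x)"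
    unfolding l1g_norm_def by (rule suminf_add_ereal) (simp_all add: gfun_nonneg)
  finally show ?thesis .
qed

lemma l1g_norm_minus_commute: "l1g_norm (\<lambda>x. h x - h' x) = l1g_norm (\<lambda>x. h' x - h x)"
  by (simp add: l1g_norm_def abs_minus_commute)

lemma l1g_norm_empirical_degree:
  "l1g_norm (empirical_degree n k s t) = ereal ((\<Sum>i\<in>layer n s. gfun (k i t)) / real (n s))"
proof -
  let ?K = "(\<lambda>i. k i t) ` layer n s"
  have fin: "finite (layer n s)" by (simp add: layer_def)
  have nn: "0 \<le> empirical_degree n k s t x" for x
    unfolding empirical_degree_def by (intro divide_nonneg_nonneg sum_nonneg) auto
  have zero: "empirical_degree n k s t x = 0" if "x \<notin> ?K" for x
    unfolding empirical_degree_def using that by (auto simp: indicator_def intro!: sum.neutral)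
  have "l1g_norm (empirical_degree n k s t) = (\<Sum>x\<in>?K. ereal (\<bar>empirical_degree n k s t x\<bar> * gfun x))"
    unfolding l1g_norm_def by (rule suminf_finite) (use fin zero in auto)
  also have "\<dots> = ereal (\<Sum>x\<in>?K. empirical_degree n k s t x * gfun x)"
    using nn by simp
  also have "(\<Sum>x\<in>?K. empirical_degree n k s t x * gfun x) =
      (\<Sum>x\<in>?K. \<Sum>i\<in>layer n s. indicator {k i t} x * gfun x) / real (n s)"
    by (simp add: empirical_degree_def sum_divide_distrib sum_distrib_right)
  also have "(\<Sum>x\<in>?K. \<Sum>i\<in>layer n s. indicator {k i t} x * gfun x) = (\<Sum>i\<in>layer n s. \<Sum>x\<in>?K. indicator {k i t} x * gfun x)"
    by (rule sum.swap)
  also have "\<dots> = (\<Sum>i\<in>layer n s. gfun (k i t))"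
  proof (rule sum.cong[OF refl])
    fix i assume i: "i \<in> layer n s"
    have "(\<Sum>x\<in>?K. indicator {k i t} x * gfun x) = (\<Sum>x\<in>{k i t}. gfun x)"
      by (rule sum.mono_neutral_cong_right) (use fin i in \<open>auto simp: indicator_def\<close>)
    then show "(\<Sum>x\<in>?K. indicator {k i t} x * gfun x) = gfun (k i t)" by simp
  qed
  finally show ?thesis .
qed

text \<open>The limit is not assumed to have finite norm. It inherits finiteness from some
  \<open>h r\<close>, whose norm is finite and whose distance to \<open>f\<close> is eventually
  below 1.\<close>

lemma l1g_norm_limit:
  fixes h :: "nat \<Rightarrow> nat \<Rightarrow> real"
  assumes lim: "(\<lambda>r. l1g_norm (\<lambda>x. h r x - f x)) \<longlonglongrightarrow> 0" and a: "\<And>r. l1g_norm (h r) = ereal (a r)"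
  obtains F where "l1g_norm f = ereal F" "a \<longlonglongrightarrow> F"
proof -
  define e where "e r = l1g_norm (\<lambda>x. h r x - f x)" for r
  have e0: "0 \<le> e r" for r by (simp add: e_def l1g_norm_nonneg)
  have "eventually (\<lambda>r. e r < 1) sequentially" using order_tendstoD(2)[OF lim, of 1] by (simp add: e_def)
  then have fine: "eventually (\<lambda>r. e r = ereal (real_of_ereal (e r))) sequentially"
  proof eventually_elim
    case (elim r)
    then show ?case using e0[of r] by (cases "e r") auto
  qed
  have t1: "l1g_norm f \<le> ereal (a r) + e r" for r
    using l1g_norm_triangle[of f "h r"] l1g_norm_minus_commute[of f "h r"] by (simp add: a e_def)
  have t2: "ereal (a r) \<le> l1g_norm f + e r" for r
    using l1g_norm_triangle[of "h r" f] by (simp add: a e_def)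
  obtain r0 where r0: "e r0 = ereal (real_of_ereal (e r0))" using eventually_happens'[OF _ fine] by auto
  have "l1g_norm f \<le> ereal (a r0 + real_of_ereal (e r0))" using t1[of r0] r0 by (metis plus_ereal.simps(1))
  then obtain F where F: "l1g_norm f = ereal F" using l1g_norm_nonneg[of f] by (cases "l1g_norm f") auto
  have x0: "(\<lambda>r. real_of_ereal (e r)) \<longlonglongrightarrow> 0"
    by (rule lim_real_of_ereal) (use lim in \<open>simp add: e_def zero_ereal_def\<close>)
  have "eventually (\<lambda>r. norm (a r - F) \<le> real_of_ereal (e r)) sequentially"
    using fine
  proof eventually_elim
    case (elim r)
    have "ereal F \<le> ereal (a r + real_of_ereal (e r))" using t1[of r] elim F by (metis plus_ereal.simps(1))
    moreover have "ereal (a r) \<le> ereal (F + real_of_ereal (e r))" using t2[of r] elim F by (metis plus_ereal.simps(1))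
    ultimately show ?case by simp
  qed
  then have "(\<lambda>r. a r - F) \<longlonglongrightarrow> 0" using x0 by (rule Lim_null_comparison)
  then have "a \<longlonglongrightarrow> F" by (simp add: LIM_zero_iff)
  with F show ?thesis by (rule that)
qed

lemma powr_two_thirds_cubed:
  assumes "0 \<le> (L :: real)"
  shows "(L powr (2 / 3)) ^ 3 = L ^ 2"
proof (cases "L = 0")
  case False
  then have "(L powr (2 / 3)) ^ 3 = L powr (3 * (2 / 3))" by (subst powr_power) auto
  also have "\<dots> = L powr real 2" by simp
  also have "\<dots> = L ^ 2" using False assms by (subst powr_realpow) auto
  finally show ?thesis .
qed simp

theorem theorem1p8:
  fixes M :: nat and \<Gamma> :: "nat set set"
    and n :: "nat \<Rightarrow> nat \<Rightarrow> nat"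
    and k :: "nat \<Rightarrow> node \<Rightarrow> nat \<Rightarrow> nat"
    and A :: "nat \<Rightarrow> real"
    and f :: "nat \<Rightarrow> nat \<Rightarrow> nat pmf"
  defines "N \<equiv> (\<lambda>r. \<Sum>s=1..M. n r s)"
  assumes "M \<ge> 1"
    and "master_graph M \<Gamma>"
    and "\<And>s. s \<in> {1..M} \<Longrightarrow> filterlim (\<lambda>r. n r s) at_top sequentially"
    and "\<And>r. realised M (n r) \<Gamma> (k r)"
    and "\<And>r s t i. \<lbrakk>s \<in> {1..M}; t \<in> {1..M}; adj \<Gamma> s t = 0; i \<in> layer (n r) s\<rbrakk> \<Longrightarrow> k r i t = 0"
    and "\<And>s. s \<in> {1..M} \<Longrightarrow> (\<lambda>r. real (n r s) / real (N r)) \<longlonglongrightarrow> A s"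
    and "\<And>s t. \<lbrakk>s \<in> {1..M}; t \<in> {1..M}; s \<noteq> t\<rbrakk> \<Longrightarrow>
           (\<lambda>r. real (max_degree (n r) (k r) s t) * real (max_degree (n r) (k r) t s))
             \<in> o(\<lambda>r. real (total_links (n r) (k r) s t) powr (2 / 3))"
    and "\<And>s. s \<in> {1..M} \<Longrightarrow>
           (\<lambda>r. real (max_degree (n r) (k r) s s)) \<in> o(\<lambda>r. real (n r s) powr (1 / 2))"
    and "\<And>s t. \<lbrakk>s \<in> {1..M}; t \<in> {1..M}\<rbrakk> \<Longrightarrow>
           (\<lambda>r. l1g_norm (\<lambda>x. empirical_degree (n r) (k r) s t x - pmf (f s t) x)) \<longlonglongrightarrow> 0"
  shows "(\<lambda>r. ereal (relative_entropy (multilayer_graphs M (n r) \<Gamma>)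
                       (P_mic M (n r) \<Gamma> (k r)) (P_can M (n r) \<Gamma> (k r)) / real (N r)))
           \<longlonglongrightarrow> (\<Sum>(s, t)\<in>{(s, t). s \<in> {1..M} \<and> t \<in> {1..M} \<and> adj \<Gamma> s t = 1}.
                  ereal (A s) * l1g_norm (pmf (f s t)))"
proof -
  note to_top = assms(4) and real_k = assms(5) and ratio = assms(7) and cross = assms(8)
    and self = assms(9) and conv = assms(10)
  have loc: "multilayer M \<Gamma> (n r) (k r)" for r by unfold_locales (rule real_k)
  define Q where "Q = multilayer.linked M \<Gamma>"
  define P where "P = multilayer.layer_pairs M \<Gamma>"
  have Q_eq: "Q = {(s, t). s \<in> {1..M} \<and> t \<in> {1..M} \<and> adj \<Gamma> s t = 1}"
    unfolding Q_def multilayer.linked_def[OF loc[of 0]] ..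
  have PQ: "P \<subseteq> Q" unfolding P_def Q_def multilayer.layer_pairs_def[OF loc[of 0]] by auto
  have finP: "finite P" unfolding P_def by (rule multilayer.finite_layer_pairs[OF loc[of 0]])
  let ?m = "\<lambda>r s t. max_degree (n r) (k r) s t" and ?L = "\<lambda>r s t. total_links (n r) (k r) s t"
  define S where "S r = relative_entropy (multilayer_graphs M (n r) \<Gamma>) (P_mic M (n r) \<Gamma> (k r)) (P_can M (n r) \<Gamma> (k r))" for r
  define W where "W r = (\<Sum>(s, t)\<in>Q. \<Sum>i\<in>layer (n r) s. gfun (k r i t))" for r
  define err where "err r q = (case q of (s, t) \<Rightarrow> 110000 * (real (?m r s t) * real (?m r t s)) + (1 + ln (1 + real (?L r s t))))" for r q
  have nN: "n r s \<le> N r" if "s \<in> {1..M}" for r s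
    unfolding N_def using that by (intro member_le_sum) auto
  have one: "1 \<in> {1..M}" using assms(2) by simp
  have Ntop: "filterlim (\<lambda>r. real (N r)) at_top sequentially"
    by (rule filterlim_at_top_mono[OF filterlim_compose[OF filterlim_real_sequentially to_top[OF one]]])
      (use nN[OF one] in auto)
  then have Npos: "eventually (\<lambda>r. real (N r) \<ge> 1) sequentially" unfolding filterlim_at_top by blast
  have prod_small: "(\<lambda>r. real (?m r s t) * real (?m r t s) / real (N r)) \<longlonglongrightarrow> 0" if "(s, t) \<in> Q" for s t
  proof (rule tendstoI)
    fix e :: real assume e: "e > 0"
    \<comment> \<open>\<open>d \<le> 1\<close> allows \<open>d ^ 2\<close> to be replaced by
      \<open>d\<close> and \<open>d ^ 3\<close> by \<open>d ^ 2\<close> below, and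
      \<open>d < e\<close> makes the final inequality strict.\<close>
    define d where "d = min 1 (e / 2)"
    have d: "0 < d" "d \<le> 1" "d < e" using e by (auto simp: d_def)
    have st: "s \<in> {1..M}" "t \<in> {1..M}" using that by (auto simp: Q_eq)
    have "eventually (\<lambda>r. real (?m r s t) * real (?m r t s) \<le> d * real (N r)) sequentially"
    proof (cases "s = t")
      case True
      have "eventually (\<lambda>r. norm (real (?m r s s)) \<le> d * norm (real (n r s) powr (1 / 2))) sequentially"
        by (rule landau_o.smallD[OF self[OF st(1)] d(1)])
      then show ?thesis
      proof eventually_elim
        case (elim r)
        then have "real (?m r s s) ^ 2 \<le> (d * real (n r s) powr (1 / 2)) ^ 2" by (intro power_mono) auto
        also have "\<dots> = d ^ 2 * real (n r s)" by (simp add: power_mult_distrib powr_half_sqrt)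
        also have "\<dots> \<le> d * real (N r)"
          using d nN[OF st(1), of r] by (intro mult_mono) (auto simp: power2_eq_square mult_left_le)
        finally show ?case using True by (simp add: power2_eq_square)
      qed
    next
      case False
      have "eventually (\<lambda>r. norm (real (?m r s t) * real (?m r t s)) \<le> d * norm (real (?L r s t) powr (2 / 3))) sequentially"
        by (rule landau_o.smallD[OF cross[OF st False] d(1)])
      then show ?thesis
      proof eventually_elim
        case (elim r)
        define x where "x = real (?m r s t) * real (?m r t s)"
        define L where "L = real (?L r s t)"
        have x0: "0 \<le> x" by (simp add: x_def)
        have L1: "L \<le> real (N r) * real (?m r s t)"
        proof -
          have "?L r s t \<le> n r s * ?m r s t" by (rule multilayer.total_links_le(1)[OF loc])
          also have "\<dots> \<le> N r * ?m r s t" by (intro mult_right_mono nN st) simp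
          finally show ?thesis unfolding L_def by (metis of_nat_le_iff of_nat_mult)
        qed
        have L2: "L \<le> real (N r) * real (?m r t s)"
        proof -
          have "?L r s t = ?L r t s" by (rule multilayer.total_links_commute[OF loc]) (use that in \<open>simp add: Q_def\<close>)
          also have "\<dots> \<le> n r t * ?m r t s" by (rule multilayer.total_links_le(1)[OF loc])
          also have "\<dots> \<le> N r * ?m r t s" by (intro mult_right_mono nN st) simp
          finally show ?thesis unfolding L_def by (metis of_nat_le_iff of_nat_mult)
        qed
        \<comment> \<open>The two bounds on \<open>L\<close> multiply to
          \<open>L^2 \<le> N^2 * x\<close>. Cubing \<open>x \<le> d * L^(2/3)\<close> then gives
          \<open>x^3 \<le> d^3 * N^2 * x\<close>, hence \<open>x \<le> d * N\<close>. This is how a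
          hypothesis in terms of links becomes an estimate in terms of nodes.\<close>
        have "L * L \<le> (real (N r) * real (?m r s t)) * (real (N r) * real (?m r t s))"
          using L1 L2 by (intro mult_mono) (auto simp: L_def)
        then have LL: "L ^ 2 \<le> real (N r) ^ 2 * x" by (simp add: power2_eq_square x_def mult_ac)
        have "x \<le> d * L powr (2 / 3)" using elim by (simp add: x_def L_def)
        then have "x ^ 3 \<le> (d * L powr (2 / 3)) ^ 3" using x0 by (intro power_mono)
        also have "\<dots> = d ^ 3 * L ^ 2" by (simp add: power_mult_distrib powr_two_thirds_cubed L_def)
        also have "\<dots> \<le> d ^ 3 * (real (N r) ^ 2 * x)" using LL d by (intro mult_left_mono) auto
        also have "\<dots> \<le> d ^ 2 * (real (N r) ^ 2 * x)"
          using d x0 by (intro mult_right_mono power_decreasing) auto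
        finally have x3: "x * x ^ 2 \<le> x * (d * real (N r)) ^ 2"
          by (simp add: power_mult_distrib power3_eq_cube power2_eq_square mult_ac)
        show ?case
        proof (cases "x = 0")
          case True
          then show ?thesis using d by (simp add: x_def[symmetric])
        next
          case False
          then have "x ^ 2 \<le> (d * real (N r)) ^ 2" using x3 x0 by simp
          then have "x \<le> d * real (N r)" by (rule power2_le_imp_le) (use d in simp)
          then show ?thesis by (simp add: x_def)
        qed
      qed
    qed
    then show "eventually (\<lambda>r. dist (real (?m r s t) * real (?m r t s) / real (N r)) 0 < e) sequentially"
      using Npos
    proof eventually_elim
      case (elim r)
      then have "real (?m r s t) * real (?m r t s) / real (N r) \<le> d" by (simp add: divide_simps)
      then show ?case using d by (simp add: dist_real_def)
    qed
  qed
  have log_small: "(\<lambda>r. (1 + ln (1 + real (?L r s t))) / real (N r)) \<longlonglongrightarrow> 0" if "(s, t) \<in> Q" for s t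
  proof -
    have inv: "(\<lambda>r. 1 / real (N r)) \<longlonglongrightarrow> 0"
      by (rule filterlim_compose[OF _ Ntop]) (use tendsto_inverse_0_at_top[OF filterlim_ident] in \<open>simp add: divide_inverse\<close>)
    have "(\<lambda>r. ln (real (N r)) / real (N r)) \<longlonglongrightarrow> 0" by (rule filterlim_compose[OF ln_x_over_x_tendsto_0 Ntop])
    then have "(\<lambda>r. (1 + 2 * ln 2) * (1 / real (N r)) + 2 * (ln (real (N r)) / real (N r))) \<longlonglongrightarrow> (1 + 2 * ln 2) * 0 + 2 * 0"
      by (intro tendsto_intros inv)
    then have lim: "(\<lambda>r. (1 + 2 * ln 2) * (1 / real (N r)) + 2 * (ln (real (N r)) / real (N r))) \<longlonglongrightarrow> 0" by simp
    have "eventually (\<lambda>r. norm ((1 + ln (1 + real (?L r s t))) / real (N r)) \<le>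
       (1 + 2 * ln 2) * (1 / real (N r)) + 2 * (ln (real (N r)) / real (N r))) sequentially"
      using Npos
    proof eventually_elim
      case (elim r)
      have "?L r s t \<le> n r s * n r t" by (rule multilayer.total_links_le(2)[OF loc]) (use that in \<open>simp add: Q_def\<close>)
      also have "\<dots> \<le> N r * N r" using that by (intro mult_mono nN) (auto simp: Q_eq)
      finally have "real (?L r s t) \<le> real (N r) * real (N r)" by (metis of_nat_le_iff of_nat_mult)
      moreover have "1 * 1 \<le> real (N r) * real (N r)" using elim by (intro mult_mono) auto
      ultimately have "1 + real (?L r s t) \<le> (2 * real (N r)) ^ 2" by (simp add: power2_eq_square)
      then have "ln (1 + real (?L r s t)) \<le> ln ((2 * real (N r)) ^ 2)" by (intro ln_mono) auto
      also have "\<dots> = 2 * ln (2 * real (N r))" using elim by (subst ln_realpow) auto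
      also have "\<dots> = 2 * ln 2 + 2 * ln (real (N r))" using elim by (subst ln_mult_pos) auto
      finally have "(1 + ln (1 + real (?L r s t))) / real (N r) \<le> (1 + 2 * ln 2 + 2 * ln (real (N r))) / real (N r)"
        by (intro divide_right_mono) auto
      moreover have "0 \<le> (1 + ln (1 + real (?L r s t))) / real (N r)"
        by (intro divide_nonneg_nonneg add_nonneg_nonneg ln_ge_zero) auto
      ultimately show ?case by (simp add: add_divide_distrib)
    qed
    then show ?thesis using lim by (rule Lim_null_comparison)
  qed
  have err0: "(\<lambda>r. \<Sum>q\<in>P. err r q / real (N r)) \<longlonglongrightarrow> 0"
  proof (rule tendsto_null_sum)
    fix q assume "q \<in> P"
    obtain s t where q: "q = (s, t)" by (cases q)
    then have st: "(s, t) \<in> Q" using PQ \<open>q \<in> P\<close> by auto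
    have "(\<lambda>r. 110000 * (real (?m r s t) * real (?m r t s) / real (N r)) + (1 + ln (1 + real (?L r s t))) / real (N r)) \<longlonglongrightarrow> 110000 * 0 + 0"
      by (intro tendsto_intros prod_small log_small st)
    then show "(\<lambda>r. err r q / real (N r)) \<longlonglongrightarrow> 0" by (simp add: err_def q add_divide_distrib)
  qed
  have sparse: "eventually (\<lambda>r. \<forall>q\<in>P. fst q \<noteq> snd q \<longrightarrow> 320 * (?m r (fst q) (snd q) * ?m r (snd q) (fst q)) \<le> ?L r (fst q) (snd q)) sequentially"
  proof (rule eventually_ball_finite[OF finP], rule ballI)
    fix q assume "q \<in> P"
    show "eventually (\<lambda>r. fst q \<noteq> snd q \<longrightarrow> 320 * (?m r (fst q) (snd q) * ?m r (snd q) (fst q)) \<le> ?L r (fst q) (snd q)) sequentially"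
    proof (cases "fst q = snd q")
      case False
      obtain s t where q: "q = (s, t)" by (cases q)
      have st: "s \<in> {1..M}" "t \<in> {1..M}" "s \<noteq> t" using \<open>q \<in> P\<close> PQ False by (auto simp: Q_eq q)
      have "eventually (\<lambda>r. norm (real (?m r s t) * real (?m r t s)) \<le> 1 / 320 * norm (real (?L r s t) powr (2 / 3))) sequentially"
        by (rule landau_o.smallD[OF cross[OF st]]) simp
      then show ?thesis
      proof eventually_elim
        case (elim r)
        \<comment> \<open>The number of links is 0 or at least 1, so raising the exponent from 2/3
          to 1 cannot decrease the power.\<close>
        have "real (?L r s t) powr (2 / 3) \<le> real (?L r s t)"
        proof (cases "?L r s t = 0")
          case False
          then have "real (?L r s t) powr (2 / 3) \<le> real (?L r s t) powr 1" by (intro powr_mono) auto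
          then show ?thesis using False by simp
        qed simp
        with elim have "real (320 * (?m r s t * ?m r t s)) \<le> real (?L r s t)" by simp
        then show ?case unfolding q by (simp only: fst_conv snd_conv of_nat_le_iff simp_thms)
      qed
    qed simp
  qed
  have "eventually (\<lambda>r. norm (S r / real (N r) - W r / real (N r)) \<le> (\<Sum>q\<in>P. err r q / real (N r))) sequentially"
    using sparse
  proof eventually_elim
    case (elim r)
    have "\<bar>S r - W r\<bar> \<le> (\<Sum>q\<in>P. err r q)"
      using multilayer.relative_entropy_approx[OF loc, of r] elim
      unfolding S_def W_def P_def Q_def err_def multilayer.excess_def[OF loc] multilayer.pair_error_def[OF loc]
      by fastforce
    then show ?case
      by (simp add: diff_divide_distrib[symmetric] sum_divide_distrib[symmetric] abs_divide divide_right_mono)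
  qed
  then have SW: "(\<lambda>r. S r / real (N r) - W r / real (N r)) \<longlonglongrightarrow> 0" using err0 by (rule Lim_null_comparison)
  define a where "a s t r = (\<Sum>i\<in>layer (n r) s. gfun (k r i t)) / real (n r s)" for s t r
  have "\<exists>F. l1g_norm (pmf (f s t)) = ereal F \<and> a s t \<longlonglongrightarrow> F" if "(s, t) \<in> Q" for s t
  proof -
    have "s \<in> {1..M}" "t \<in> {1..M}" using that by (auto simp: Q_eq)
    from l1g_norm_limit[OF conv[OF this], of "a s t"] show ?thesis
      by (auto simp: a_def l1g_norm_empirical_degree)
  qed
  then obtain F where F: "\<And>s t. (s, t) \<in> Q \<Longrightarrow> l1g_norm (pmf (f s t)) = ereal (F s t) \<and> a s t \<longlonglongrightarrow> F s t" by metis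
  have "(\<lambda>r. \<Sum>(s, t)\<in>Q. real (n r s) / real (N r) * a s t r) \<longlonglongrightarrow> (\<Sum>(s, t)\<in>Q. A s * F s t)"
    unfolding case_prod_unfold
  proof (intro tendsto_sum tendsto_mult)
    fix q assume "q \<in> Q"
    then show "a (fst q) (snd q) \<longlonglongrightarrow> F (fst q) (snd q)" using F by simp
    show "(\<lambda>r. real (n r (fst q)) / real (N r)) \<longlonglongrightarrow> A (fst q)" using \<open>q \<in> Q\<close> by (intro ratio) (auto simp: Q_eq)
  qed
  moreover have "eventually (\<lambda>r. (\<Sum>(s, t)\<in>Q. real (n r s) / real (N r) * a s t r) = W r / real (N r)) sequentially"
  proof -
    \<comment> \<open>Nonempty layers let the factor \<open>n r s\<close> cancel against the
      denominator of the empirical mean.\<close>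
    have "eventually (\<lambda>r. \<forall>s\<in>{1..M}. n r s \<ge> 1) sequentially"
      using to_top by (intro eventually_ball_finite) (auto simp: filterlim_at_top)
    then show ?thesis
    proof eventually_elim
      case (elim r)
      have "(\<Sum>(s, t)\<in>Q. real (n r s) / real (N r) * a s t r) = (\<Sum>(s, t)\<in>Q. (\<Sum>i\<in>layer (n r) s. gfun (k r i t)) / real (N r))"
        by (intro sum.cong refl) (use elim in \<open>force simp: a_def Q_eq\<close>)
      then show ?case by (simp add: W_def sum_divide_distrib case_prod_unfold)
    qed
  qed
  ultimately have "(\<lambda>r. W r / real (N r)) \<longlonglongrightarrow> (\<Sum>(s, t)\<in>Q. A s * F s t)"
    by (rule Lim_transform_eventually)
  from tendsto_add[OF SW this] have "(\<lambda>r. S r / real (N r)) \<longlonglongrightarrow> (\<Sum>(s, t)\<in>Q. A s * F s t)" by simp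
  then have "(\<lambda>r. ereal (S r / real (N r))) \<longlonglongrightarrow> ereal (\<Sum>(s, t)\<in>Q. A s * F s t)" by (rule tendsto_ereal)
  also have "ereal (\<Sum>(s, t)\<in>Q. A s * F s t) = (\<Sum>(s, t)\<in>Q. ereal (A s) * l1g_norm (pmf (f s t)))"
    unfolding sum_ereal[symmetric] by (intro sum.cong refl) (use F in auto)
  finally show ?thesis unfolding S_def Q_eq .
qed

end
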